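(* (i) If a finite group $G$ is isomorphic to $\mathrm{Gal}(\mathbb H/\mathbb F)$ for some Galois extension $\mathbb H$ of $\mathbb F=\mathfrak K(t)$, then for $\mathcal D$-almost all $s$ there is a Galois extension of $\mathfrak F_s=\mathbb F_s(t)$ with Galois group isomorphic to $G$. (ii) Under the same hypothesis, $G$ is isomorphic to the Galois group of some Galois extension of $\mathcal U(\mathbb F)=\prod_s\mathfrak F_s/\mathcal D$; in particular, if every finite group is a Galois group over $\mathbb F$, then every finite group is a Galois group over $\mathcal U(\mathbb F)$.
   Context: Let $S$ be an infinite set, $\mathcal D$ a nonprincipal ultrafilter on $S$; ultraproducts $\prod_sA_s/\mathcal D$ consist of tuples modulo agreement on a set in $\mathcal D$, classes written $\mathrm{ulim}_sa_s$, componentwise operations; "for $\mathcal D$-almost all $s$" means on a set belonging to $\mathcal D$. For each $s$ let $\mathbb F_s$ be a field and $\mathfrak F_s=\mathbb F_s(t)$; $\mathfrak K=\prod_s\mathbb F_s/\mathcal D$ and $\mathbb F=\mathfrak K(t)$. *)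

theory Defs
  imports "HOL-Algebra.Algebra"
begin

definition nonprincipal_ultrafilter :: "'s set \<Rightarrow> 's set set \<Rightarrow> bool" where
  "nonprincipal_ultrafilter S D \<longleftrightarrow>
     D \<subseteq> Pow S \<and> S \<in> D \<and> {} \<notin> D \<and>
     (\<forall>A\<in>D. \<forall>B\<in>D. A \<inter> B \<in> D) \<and>
     (\<forall>A\<in>D. \<forall>B. A \<subseteq> B \<and> B \<subseteq> S \<longrightarrow> B \<in> D) \<and>
     (\<forall>A. A \<subseteq> S \<longrightarrow> A \<in> D \<or> S - A \<in> D) \<and>
     (\<forall>s. {s} \<notin> D)"

definition quot_ring ::
  "'x set \<Rightarrow> ('x \<times> 'x) set \<Rightarrow> ('x \<Rightarrow> 'x \<Rightarrow> 'x) \<Rightarrow> ('x \<Rightarrow> 'x \<Rightarrow> 'x)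
     \<Rightarrow> 'x \<Rightarrow> 'x \<Rightarrow> 'x set ring" where
  "quot_ring Y r pl ti z e =
     \<lparr> carrier = Y // r,
       monoid.mult = (\<lambda>A B. r `` {ti (SOME a. a \<in> A) (SOME b. b \<in> B)}),
       one = r `` {e},
       ring.zero = r `` {z},
       ring.add = (\<lambda>A B. r `` {pl (SOME a. a \<in> A) (SOME b. b \<in> B)}) \<rparr>"

definition ultraprod ::
  "'s set \<Rightarrow> 's set set \<Rightarrow> ('s \<Rightarrow> ('a, 'b) ring_scheme) \<Rightarrow> ('s \<Rightarrow> 'a) set ring" where
  "ultraprod S D R =
     quot_ring (\<Pi>\<^sub>E s\<in>S. carrier (R s))
       {(f, g). f \<in> (\<Pi>\<^sub>E s\<in>S. carrier (R s)) \<and> g \<in> (\<Pi>\<^sub>E s\<in>S. carrier (R s))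
                \<and> {s \<in> S. f s = g s} \<in> D}
       (\<lambda>f g. \<lambda>s\<in>S. f s \<oplus>\<^bsub>R s\<^esub> g s)
       (\<lambda>f g. \<lambda>s\<in>S. f s \<otimes>\<^bsub>R s\<^esub> g s)
       (\<lambda>s\<in>S. \<zero>\<^bsub>R s\<^esub>)
       (\<lambda>s\<in>S. \<one>\<^bsub>R s\<^esub>)"

definition frac_field :: "('x, 'b) ring_scheme \<Rightarrow> ('x \<times> 'x) set ring" where
  "frac_field R =
     quot_ring (carrier R \<times> (carrier R - {\<zero>\<^bsub>R\<^esub>}))
       {((a, b), (c, d)). a \<in> carrier R \<and> b \<in> carrier R - {\<zero>\<^bsub>R\<^esub>}
           \<and> c \<in> carrier R \<and> d \<in> carrier R - {\<zero>\<^bsub>R\<^esub>}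
           \<and> a \<otimes>\<^bsub>R\<^esub> d = c \<otimes>\<^bsub>R\<^esub> b}
       (\<lambda>(a, b) (c, d). (a \<otimes>\<^bsub>R\<^esub> d \<oplus>\<^bsub>R\<^esub> c \<otimes>\<^bsub>R\<^esub> b, b \<otimes>\<^bsub>R\<^esub> d))
       (\<lambda>(a, b) (c, d). (a \<otimes>\<^bsub>R\<^esub> c, b \<otimes>\<^bsub>R\<^esub> d))
       (\<zero>\<^bsub>R\<^esub>, \<one>\<^bsub>R\<^esub>)
       (\<one>\<^bsub>R\<^esub>, \<one>\<^bsub>R\<^esub>)"

definition rat_fun_field :: "('a, 'b) ring_scheme \<Rightarrow> ('a list \<times> 'a list) set ring" where
  "rat_fun_field k = frac_field (poly_ring k)"

definition Gal :: "('b, 'c) ring_scheme \<Rightarrow> ('h, 'd) ring_scheme \<Rightarrow> ('b \<Rightarrow> 'h) \<Rightarrow> ('h \<Rightarrow> 'h) monoid" where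
  "Gal B H i = (BijGroup (carrier H))
     \<lparr> carrier := {\<sigma> \<in> Bij (carrier H). \<sigma> \<in> ring_hom H H \<and> (\<forall>x\<in>carrier B. \<sigma> (i x) = i x)} \<rparr>"

definition galois_ext :: "('b, 'c) ring_scheme \<Rightarrow> ('h, 'd) ring_scheme \<Rightarrow> ('b \<Rightarrow> 'h) \<Rightarrow> bool" where
  "galois_ext B H i \<longleftrightarrow>
     field B \<and> field H \<and> i \<in> ring_hom B H \<and>
     (\<forall>x\<in>carrier H. ring.algebraic H (i ` carrier B) x) \<and>
     {x \<in> carrier H. \<forall>\<sigma>\<in>carrier (Gal B H i). \<sigma> x = x} = i ` carrier B"

text \<open>G is (isomorphic to) a Galois group over B. The extension field is realised on the
  type of lists over the element type of B, which is large enough for any algebraic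
  extension of an infinite field.\<close>
definition galois_group_over :: "('b, 'c) ring_scheme \<Rightarrow> ('g, 'm) monoid_scheme \<Rightarrow> bool" where
  "galois_group_over B G \<longleftrightarrow>
     (\<exists>(H :: 'b list ring) (i :: 'b \<Rightarrow> 'b list). galois_ext B H i \<and> G \<cong> Gal B H i)"

end

(* Let K be the ultraproduct of the F_s, B = K(t) and U the ultraproduct of the F_s(t); B embeds into U.

   U contains no further elements algebraic over B. If u = ulim u_s is a nonzero root of a polynomial over K[t]
   with nonzero leading coefficient q_N and constant coefficient q_0, then for almost all s the reduced
   numerator and denominator of u_s divide the polynomials over F_s corresponding to q_0 and q_N, so their
   degrees are bounded independently of s and u is a quotient of elements of K[t].

   Consequently the algebra obtained from H by extending scalars from B to U is a field. It carries an action of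
   G with fixed ring U. Any nonzero element y has a multiple e, a nonzero idempotent, whose translates are equal
   or orthogonal to it. If Z is the stabiliser of e, then for k in H the element h = Tr_Z(k) satisfies
   h e = u e with u = Tr_G(k e) in U, so u is algebraic over B, hence lies in B, and h = u. So Tr_Z maps H to B,
   which forces Z = G; then e lies in U, e = 1, and y is a unit. In place of linear algebra the proof uses
   Galois coordinates: elements a_l, b_l of H such that the sum of the a_l g(b_l) is 1 for g = 1 and 0 for
   all other g in G.

   Finally, a Galois extension of U with group G is given by finitely many structure constants subject to
   first-order conditions, which hold over F_s(t) for almost all s. *)
theory Submission
  imports Defs
begin

text \<open>The tensor product of a Galois extension with a larger field can fail to be a field when
  the larger field contains new algebraic elements. The classical route through primitive elements
  and irreducible minimal polynomials, or through linear disjointness, is replaced by identities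
  that survive every equivariant ring homomorphism: once the sum of the a_l g(b_l) is the indicator
  function of g = 1 in H, the same holds for the images in the tensor product, before that ring is
  known to be a field. The same identities yield finite dimension of H, Artin's theorem and
  nondegeneracy of the trace, in every characteristic.

  The degree bound is what separates K(t) from the rest of U: polynomials of bounded degree have a
  fixed number of coefficients, and limits taken coefficient by coefficient give one polynomial over
  K, while a family whose degrees are unbounded along \<open>D\<close> has a limit outside
  K[t].\<close>

text \<open>\<open>quot_ring\<close> computes with representatives picked by \<open>SOME\<close>.
  Compatibility of the operation with \<open>r\<close> allows them to be replaced by any given ones,
  both in fraction fields and in ultraproducts.\<close>

lemma quot_op:
  assumes r: "equiv Y r" and xy: "x \<in> Y" "y \<in> Y"
    and cong: "\<And>a a' b b'. (a, a') \<in> r \<Longrightarrow> (b, b') \<in> r \<Longrightarrow> (f a b, f a' b') \<in> r"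
  shows "r `` {f (SOME a. a \<in> r `` {x}) (SOME b. b \<in> r `` {y})} = r `` {f x y}"
proof -
  have "(SOME a. a \<in> r `` {x}) \<in> r `` {x}"
    using equiv_class_self[OF r xy(1)] by (rule someI)
  moreover have "(SOME b. b \<in> r `` {y}) \<in> r `` {y}"
    using equiv_class_self[OF r xy(2)] by (rule someI)
  ultimately have "(f x y, f (SOME a. a \<in> r `` {x}) (SOME b. b \<in> r `` {y})) \<in> r"
    by (intro cong) auto
  then show ?thesis
    using equiv_class_eq[OF r] by metis
qed

section \<open>First-order axioms of fields\<close>

text \<open>Kept apart from the axioms because it is required at every index and not only at almost
  every one: otherwise the pointwise sum of two families could leave the product.\<close>

definition closed_ring :: "('a, 'b) ring_scheme \<Rightarrow> bool" where
  "closed_ring R \<longleftrightarrow> \<zero>\<^bsub>R\<^esub> \<in> carrier R \<and> \<one>\<^bsub>R\<^esub> \<in> carrier R \<and>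
     (\<forall>x\<in>carrier R. \<forall>y\<in>carrier R. x \<oplus>\<^bsub>R\<^esub> y \<in> carrier R \<and> x \<otimes>\<^bsub>R\<^esub> y \<in> carrier R)"

text \<open>Each conjunct is built from equations between terms by connectives and by quantifiers
  over the carrier, so that it can be transferred to an ultraproduct by following its
  syntax.\<close>

definition field_sentence :: "('a, 'b) ring_scheme \<Rightarrow> bool" where
  "field_sentence R \<longleftrightarrow>
     (\<forall>x\<in>carrier R. \<forall>y\<in>carrier R. \<forall>z\<in>carrier R. (x \<oplus>\<^bsub>R\<^esub> y) \<oplus>\<^bsub>R\<^esub> z = x \<oplus>\<^bsub>R\<^esub> (y \<oplus>\<^bsub>R\<^esub> z)) \<and>
     (\<forall>x\<in>carrier R. \<forall>y\<in>carrier R. x \<oplus>\<^bsub>R\<^esub> y = y \<oplus>\<^bsub>R\<^esub> x) \<and>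
     (\<forall>x\<in>carrier R. \<zero>\<^bsub>R\<^esub> \<oplus>\<^bsub>R\<^esub> x = x) \<and>
     (\<forall>x\<in>carrier R. \<exists>y\<in>carrier R. y \<oplus>\<^bsub>R\<^esub> x = \<zero>\<^bsub>R\<^esub>) \<and>
     (\<forall>x\<in>carrier R. \<forall>y\<in>carrier R. \<forall>z\<in>carrier R. (x \<otimes>\<^bsub>R\<^esub> y) \<otimes>\<^bsub>R\<^esub> z = x \<otimes>\<^bsub>R\<^esub> (y \<otimes>\<^bsub>R\<^esub> z)) \<and>
     (\<forall>x\<in>carrier R. \<forall>y\<in>carrier R. x \<otimes>\<^bsub>R\<^esub> y = y \<otimes>\<^bsub>R\<^esub> x) \<and>
     (\<forall>x\<in>carrier R. \<one>\<^bsub>R\<^esub> \<otimes>\<^bsub>R\<^esub> x = x) \<and>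
     (\<forall>x\<in>carrier R. \<forall>y\<in>carrier R. \<forall>z\<in>carrier R.
        (x \<oplus>\<^bsub>R\<^esub> y) \<otimes>\<^bsub>R\<^esub> z = (x \<otimes>\<^bsub>R\<^esub> z) \<oplus>\<^bsub>R\<^esub> (y \<otimes>\<^bsub>R\<^esub> z)) \<and>
     \<zero>\<^bsub>R\<^esub> \<noteq> \<one>\<^bsub>R\<^esub> \<and>
     (\<forall>x\<in>carrier R. x \<noteq> \<zero>\<^bsub>R\<^esub> \<longrightarrow> (\<exists>y\<in>carrier R. x \<otimes>\<^bsub>R\<^esub> y = \<one>\<^bsub>R\<^esub>))"

lemma (in ring) closed_ring: "closed_ring R"
  by (auto simp: closed_ring_def)

lemma field_iff_sentence:
  fixes R (structure)
  assumes "closed_ring R"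
  shows "field R \<longleftrightarrow> field_sentence R"
proof
  assume "field R"
  then interpret field R .
  have "\<exists>y\<in>carrier R. y \<oplus> x = \<zero>" if "x \<in> carrier R" for x
    using that by (intro bexI[of _ "\<ominus> x"]) (auto simp: l_neg)
  moreover have "\<exists>y\<in>carrier R. x \<otimes> y = \<one>" if "x \<in> carrier R" "x \<noteq> \<zero>" for x
    using that field_Units by (intro bexI[of _ "inv x"]) auto
  ultimately show "field_sentence R"
    unfolding field_sentence_def
    by (intro conjI) (simp_all add: a_assoc m_assoc l_distr, (use a_comm m_comm in blast)+)
next
  assume *: "field_sentence R"
  have "abelian_group R"
    using assms * unfolding closed_ring_def field_sentence_def
    by (intro abelian_groupI) auto
  moreover have "comm_monoid R"
    using assms * unfolding closed_ring_def field_sentence_def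
    by (intro comm_monoidI) auto
  ultimately have "cring R"
    using assms * unfolding closed_ring_def field_sentence_def
    by (intro cringI) auto
  then show "field R"
    using assms * unfolding closed_ring_def field_sentence_def
    by (intro cring.cring_fieldI2) auto
qed

lemma field_closed_ring: "field R \<Longrightarrow> closed_ring R"
  by (intro ring.closed_ring cring.axioms(1) domain.axioms(1) field.axioms(1))

section \<open>Fraction fields\<close>

context domain
begin

abbreviation "frac_rel \<equiv> {((a, b), (c, d)). a \<in> carrier R \<and> b \<in> carrier R - {\<zero>}
           \<and> c \<in> carrier R \<and> d \<in> carrier R - {\<zero>} \<and> a \<otimes> d = c \<otimes> b}"

definition frac :: "'a \<Rightarrow> 'a \<Rightarrow> ('a \<times> 'a) set" where
  "frac a b = frac_rel `` {(a, b)}"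

lemma frac_rel_equiv: "equiv (carrier R \<times> (carrier R - {\<zero>})) frac_rel"
proof (rule equivI)
  show "frac_rel \<subseteq> (carrier R \<times> (carrier R - {\<zero>})) \<times> (carrier R \<times> (carrier R - {\<zero>}))"
    by auto
  show "refl_on (carrier R \<times> (carrier R - {\<zero>})) frac_rel"
    by (auto simp: refl_on_def)
  show "sym frac_rel" by (auto simp: sym_def)
  show "trans frac_rel"
  proof (rule transI, clarsimp)
    fix a b c d x y
    assume c: "a \<in> carrier R" "b \<in> carrier R" "c \<in> carrier R" "d \<in> carrier R" "x \<in> carrier R" "y \<in> carrier R"
      and "d \<noteq> \<zero>" and e: "a \<otimes> d = c \<otimes> b" "c \<otimes> y = x \<otimes> d"
    \<comment> \<open>The denominator \<open>d\<close> of the middle pair is nonzero and can be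
      cancelled in a domain.\<close>
    have "d \<otimes> (a \<otimes> y) = (a \<otimes> d) \<otimes> y" using c by algebra
    also have "\<dots> = (c \<otimes> y) \<otimes> b" unfolding e(1) using c by algebra
    also have "\<dots> = d \<otimes> (x \<otimes> b)" unfolding e(2) using c by algebra
    finally show "a \<otimes> y = x \<otimes> b" using c \<open>d \<noteq> \<zero>\<close> m_lcancel by auto
  qed
qed

lemma frac_eq_iff:
  assumes "a \<in> carrier R" "b \<in> carrier R - {\<zero>}" "c \<in> carrier R" "d \<in> carrier R - {\<zero>}"
  shows "frac a b = frac c d \<longleftrightarrow> a \<otimes> d = c \<otimes> b"
  unfolding frac_def
  by (subst eq_equiv_class_iff[OF frac_rel_equiv]) (use assms in simp_all)

lemma frac_field_carrier:
  "carrier (frac_field R) = {frac a b | a b. a \<in> carrier R \<and> b \<in> carrier R - {\<zero>}}"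
  by (auto simp: frac_field_def quot_ring_def quotient_def frac_def)

lemma frac_zero: "\<zero>\<^bsub>frac_field R\<^esub> = frac \<zero> \<one>"
  and frac_one: "\<one>\<^bsub>frac_field R\<^esub> = frac \<one> \<one>"
  by (simp_all add: frac_field_def quot_ring_def frac_def)

lemma frac_mult:
  assumes "a \<in> carrier R" "b \<in> carrier R - {\<zero>}" "c \<in> carrier R" "d \<in> carrier R - {\<zero>}"
  shows "frac a b \<otimes>\<^bsub>frac_field R\<^esub> frac c d = frac (a \<otimes> c) (b \<otimes> d)"
proof -
  have "frac_rel `` {(\<lambda>(a, b) (c, d). (a \<otimes> c, b \<otimes> d)) (SOME z. z \<in> frac_rel `` {(a, b)})
            (SOME z. z \<in> frac_rel `` {(c, d)})} = frac_rel `` {(\<lambda>(a, b) (c, d). (a \<otimes> c, b \<otimes> d)) (a, b) (c, d)}"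
  proof (rule quot_op[OF frac_rel_equiv])
    fix p p' q q' assume pq: "(p, p') \<in> frac_rel" "(q, q') \<in> frac_rel"
    obtain a b a' b' c d c' d' where eq: "p = (a, b)" "p' = (a', b')" "q = (c, d)" "q' = (c', d')"
      by (metis surj_pair)
    have *: "a \<in> carrier R" "b \<in> carrier R" "c \<in> carrier R" "d \<in> carrier R"
        "a' \<in> carrier R" "b' \<in> carrier R" "c' \<in> carrier R" "d' \<in> carrier R"
      and nz: "b \<noteq> \<zero>" "b' \<noteq> \<zero>" "d \<noteq> \<zero>" "d' \<noteq> \<zero>"
      and e: "a \<otimes> b' = a' \<otimes> b" "c \<otimes> d' = c' \<otimes> d"
      using pq unfolding eq by simp_all
    have "(a \<otimes> c) \<otimes> (b' \<otimes> d') = (a \<otimes> b') \<otimes> (c \<otimes> d')" using * by algebra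
    also have "\<dots> = (a' \<otimes> c') \<otimes> (b \<otimes> d)" unfolding e using * by algebra
    finally show "((\<lambda>(a, b) (c, d). (a \<otimes> c, b \<otimes> d)) p q, (\<lambda>(a, b) (c, d). (a \<otimes> c, b \<otimes> d)) p' q') \<in> frac_rel"
      using * nz by (simp add: eq integral_iff)
  qed (use assms in auto)
  then show ?thesis
    by (simp add: frac_field_def quot_ring_def frac_def)
qed

lemma frac_add:
  assumes "a \<in> carrier R" "b \<in> carrier R - {\<zero>}" "c \<in> carrier R" "d \<in> carrier R - {\<zero>}"
  shows "frac a b \<oplus>\<^bsub>frac_field R\<^esub> frac c d = frac (a \<otimes> d \<oplus> c \<otimes> b) (b \<otimes> d)"
proof -
  let ?f = "\<lambda>(a, b) (c, d). (a \<otimes> d \<oplus> c \<otimes> b, b \<otimes> d)"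
  have "frac_rel `` {?f (SOME z. z \<in> frac_rel `` {(a, b)})
            (SOME z. z \<in> frac_rel `` {(c, d)})} = frac_rel `` {?f (a, b) (c, d)}"
  proof (rule quot_op[OF frac_rel_equiv])
    fix p p' q q' assume pq: "(p, p') \<in> frac_rel" "(q, q') \<in> frac_rel"
    obtain a b a' b' c d c' d' where eq: "p = (a, b)" "p' = (a', b')" "q = (c, d)" "q' = (c', d')"
      by (metis surj_pair)
    have *: "a \<in> carrier R" "b \<in> carrier R" "c \<in> carrier R" "d \<in> carrier R"
        "a' \<in> carrier R" "b' \<in> carrier R" "c' \<in> carrier R" "d' \<in> carrier R"
      and nz: "b \<noteq> \<zero>" "b' \<noteq> \<zero>" "d \<noteq> \<zero>" "d' \<noteq> \<zero>"
      and e: "a \<otimes> b' = a' \<otimes> b" "c \<otimes> d' = c' \<otimes> d"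
      using pq unfolding eq by simp_all
    have "(a \<otimes> d \<oplus> c \<otimes> b) \<otimes> (b' \<otimes> d') = (a \<otimes> b') \<otimes> (d \<otimes> d') \<oplus> (c \<otimes> d') \<otimes> (b \<otimes> b')"
      using * by algebra
    also have "\<dots> = (a' \<otimes> d' \<oplus> c' \<otimes> b') \<otimes> (b \<otimes> d)" unfolding e using * by algebra
    finally show "(?f p q, ?f p' q') \<in> frac_rel"
      using * nz by (simp add: eq integral_iff)
  qed (use assms in auto)
  then show ?thesis
    by (simp add: frac_field_def quot_ring_def frac_def)
qed

lemma frac_closed:
  "a \<in> carrier R \<Longrightarrow> b \<in> carrier R - {\<zero>} \<Longrightarrow> frac a b \<in> carrier (frac_field R)"
  by (auto simp: frac_field_carrier)

lemma frac_field_field: "field (frac_field R)"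
proof -
  have nz: "b \<otimes> d \<in> carrier R - {\<zero>}" if "b \<in> carrier R - {\<zero>}" "d \<in> carrier R - {\<zero>}" for b d
    using that by (auto simp: integral_iff)
  have one: "\<one> \<in> carrier R - {\<zero>}" by auto
  have closed: "closed_ring (frac_field R)"
    unfolding closed_ring_def frac_zero frac_one
  proof (intro conjI ballI)
    fix x y assume "x \<in> carrier (frac_field R)" "y \<in> carrier (frac_field R)"
    then obtain a b c d where "x = frac a b" "y = frac c d"
      and *: "a \<in> carrier R" "b \<in> carrier R - {\<zero>}" "c \<in> carrier R" "d \<in> carrier R - {\<zero>}"
      unfolding frac_field_carrier by blast
    then show "x \<oplus>\<^bsub>frac_field R\<^esub> y \<in> carrier (frac_field R)" "x \<otimes>\<^bsub>frac_field R\<^esub> y \<in> carrier (frac_field R)"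
      using nz[OF *(2,4)] by (simp_all add: frac_add frac_mult frac_closed)
  qed (use one in \<open>simp_all add: frac_closed\<close>)
  \<comment> \<open>Quantifiers over the fraction field become quantifiers over numerators and
    denominators, which turns the axioms into identities in \<open>R\<close>.\<close>
  have all: "(\<forall>x\<in>carrier (frac_field R). P x) \<longleftrightarrow> (\<forall>a\<in>carrier R. \<forall>b\<in>carrier R - {\<zero>}. P (frac a b))" for P
    by (auto simp: frac_field_carrier)
  have ex: "\<exists>x\<in>carrier (frac_field R). P x" if "P (frac a b)" "a \<in> carrier R" "b \<in> carrier R - {\<zero>}" for P a b
    using that by (auto simp: frac_field_carrier)
  have "field_sentence (frac_field R)"
    unfolding field_sentence_def all frac_zero frac_one
  proof (intro conjI ballI impI)
    fix a b assume ab: "a \<in> carrier R" "b \<in> carrier R - {\<zero>}"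
    show "\<exists>y\<in>carrier (frac_field R). y \<oplus>\<^bsub>frac_field R\<^esub> frac a b = frac \<zero> \<one>"
      using ab nz[OF ab(2) ab(2)]
      by (intro ex[of _ "\<ominus> a" b]) (auto simp: frac_add frac_eq_iff l_minus r_neg l_neg)
    assume "frac a b \<noteq> frac \<zero> \<one>"
    then have "a \<noteq> \<zero>" using ab by (auto simp: frac_eq_iff)
    then have a: "a \<in> carrier R - {\<zero>}" using ab by auto
    show "\<exists>y\<in>carrier (frac_field R). frac a b \<otimes>\<^bsub>frac_field R\<^esub> y = frac \<one> \<one>"
      using ab a nz[OF ab(2) a]
      by (intro ex[of _ b a]) (auto simp: frac_mult frac_eq_iff m_comm)
  next
    fix a b c d x y assume *: "a \<in> carrier R" "b \<in> carrier R - {\<zero>}"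
       "c \<in> carrier R" "d \<in> carrier R - {\<zero>}" "x \<in> carrier R" "y \<in> carrier R - {\<zero>}"
    note n = nz[OF *(2,4)] nz[OF *(4,6)] nz[OF *(2,6)] nz[OF nz[OF *(2,4)] *(6)] nz[OF *(2) nz[OF *(4,6)]]
      nz[OF nz[OF *(2,6)] nz[OF *(4,6)]]
    show "frac a b \<oplus>\<^bsub>frac_field R\<^esub> frac c d \<oplus>\<^bsub>frac_field R\<^esub> frac x y =
      frac a b \<oplus>\<^bsub>frac_field R\<^esub> (frac c d \<oplus>\<^bsub>frac_field R\<^esub> frac x y)"
      using * n by (simp add: frac_add frac_eq_iff) algebra
    show "frac a b \<otimes>\<^bsub>frac_field R\<^esub> frac c d \<otimes>\<^bsub>frac_field R\<^esub> frac x y =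
      frac a b \<otimes>\<^bsub>frac_field R\<^esub> (frac c d \<otimes>\<^bsub>frac_field R\<^esub> frac x y)"
      using * n by (simp add: frac_mult frac_eq_iff) algebra
    show "(frac a b \<oplus>\<^bsub>frac_field R\<^esub> frac c d) \<otimes>\<^bsub>frac_field R\<^esub> frac x y =
      frac a b \<otimes>\<^bsub>frac_field R\<^esub> frac x y \<oplus>\<^bsub>frac_field R\<^esub> frac c d \<otimes>\<^bsub>frac_field R\<^esub> frac x y"
      using * n by (simp add: frac_mult frac_add frac_eq_iff) algebra
  next
    fix a b c d assume *: "a \<in> carrier R" "b \<in> carrier R - {\<zero>}" "c \<in> carrier R" "d \<in> carrier R - {\<zero>}"
    show "frac a b \<oplus>\<^bsub>frac_field R\<^esub> frac c d = frac c d \<oplus>\<^bsub>frac_field R\<^esub> frac a b"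
      "frac a b \<otimes>\<^bsub>frac_field R\<^esub> frac c d = frac c d \<otimes>\<^bsub>frac_field R\<^esub> frac a b"
      using * by (simp_all add: frac_add frac_mult a_comm m_comm)
  next
    fix a b assume *: "a \<in> carrier R" "b \<in> carrier R - {\<zero>}"
    show "frac \<zero> \<one> \<oplus>\<^bsub>frac_field R\<^esub> frac a b = frac a b"
      "frac \<one> \<one> \<otimes>\<^bsub>frac_field R\<^esub> frac a b = frac a b"
      using * by (simp_all add: frac_add frac_mult frac_eq_iff)
  next
    show "frac \<zero> \<one> \<noteq> frac \<one> \<one>" by (simp add: frac_eq_iff)
  qed
  then show ?thesis using field_iff_sentence[OF closed] by blast
qed

lemma frac_embed_hom: "(\<lambda>a. frac a \<one>) \<in> ring_hom R (frac_field R)"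
  by (rule ring_hom_memI) (auto simp: frac_closed frac_mult frac_add frac_one)

lemma frac_embed_inj: "inj_on (\<lambda>a. frac a \<one>) (carrier R)"
  by (rule inj_onI) (auto simp: frac_eq_iff)

lemma frac_eq_div:
  assumes "a \<in> carrier R" "b \<in> carrier R - {\<zero>}"
  shows "frac a b \<otimes>\<^bsub>frac_field R\<^esub> frac b \<one> = frac a \<one>"
  using assms by (simp add: frac_mult frac_eq_iff m_assoc)

end

section \<open>Ultraproducts\<close>

locale ultrafilter_on =
  fixes S :: "'s set" and D :: "'s set set"
  assumes D: "nonprincipal_ultrafilter S D"
begin

lemma top: "S \<in> D" and bot: "{} \<notin> D"
  and inter: "A \<in> D \<Longrightarrow> B \<in> D \<Longrightarrow> A \<inter> B \<in> D"
  and up: "A \<in> D \<Longrightarrow> A \<subseteq> B \<Longrightarrow> B \<subseteq> S \<Longrightarrow> B \<in> D"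
  and ultra: "A \<subseteq> S \<Longrightarrow> A \<in> D \<or> S - A \<in> D"
  using D unfolding nonprincipal_ultrafilter_def by blast+

text \<open>\<open>P s\<close> is meant to be a statement about the \<open>s\<close>-th factor of an ultraproduct and \<open>Q\<close> the same statement
  about the ultraproduct.\<close>
definition los :: "('s \<Rightarrow> bool) \<Rightarrow> bool \<Rightarrow> bool" where
  "los P Q \<longleftrightarrow> ({s \<in> S. P s} \<in> D \<longleftrightarrow> Q)"

lemma losD: "los P Q \<Longrightarrow> {s \<in> S. P s} \<in> D \<longleftrightarrow> Q"
  by (simp add: los_def)

lemma ae_mono: "{s \<in> S. P s} \<in> D \<Longrightarrow> (\<And>s. s \<in> S \<Longrightarrow> P s \<Longrightarrow> Q s) \<Longrightarrow> {s \<in> S. Q s} \<in> D"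
  by (erule up) auto

lemma ae_conj: "{s \<in> S. P s} \<in> D \<Longrightarrow> {s \<in> S. Q s} \<in> D \<Longrightarrow> {s \<in> S. P s \<and> Q s} \<in> D"
  using inter[of "{s \<in> S. P s}" "{s \<in> S. Q s}"] by (auto elim: up)

lemma ae_all: "(\<And>s. s \<in> S \<Longrightarrow> P s) \<Longrightarrow> {s \<in> S. P s} \<in> D"
  by (rule up[OF top]) auto

lemma ae_finite:
  "finite I \<Longrightarrow> (\<And>i. i \<in> I \<Longrightarrow> {s \<in> S. P i s} \<in> D) \<Longrightarrow> {s \<in> S. \<forall>i\<in>I. P i s} \<in> D"
proof (induction I rule: finite_induct)
  case empty
  then show ?case using top by simp
next
  case (insert i I)
  have "{s \<in> S. P i s \<and> (\<forall>i\<in>I. P i s)} \<in> D"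
    using insert by (intro ae_conj) auto
  then show ?case by simp
qed

text \<open>Maximality of the filter enters here. Implication and the quantifiers inherit their
  transfer from that of negation.\<close>

lemma ae_not: "{s \<in> S. \<not> P s} \<in> D \<longleftrightarrow> {s \<in> S. P s} \<notin> D"
proof
  assume 1: "{s \<in> S. \<not> P s} \<in> D"
  show "{s \<in> S. P s} \<notin> D"
    using ae_conj[OF 1, of P] bot by auto
next
  assume "{s \<in> S. P s} \<notin> D"
  moreover have "S - {s \<in> S. P s} = {s \<in> S. \<not> P s}" by auto
  ultimately show "{s \<in> S. \<not> P s} \<in> D"
    using ultra[of "{s \<in> S. P s}"] by auto
qed

lemma los_not: "los P Q \<Longrightarrow> los (\<lambda>s. \<not> P s) (\<not> Q)"
  by (simp add: los_def ae_not)

lemma los_conj: "los P Q \<Longrightarrow> los P' Q' \<Longrightarrow> los (\<lambda>s. P s \<and> P' s) (Q \<and> Q')"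
  unfolding los_def using ae_conj[of P P'] ae_mono[of "\<lambda>s. P s \<and> P' s" P] ae_mono[of "\<lambda>s. P s \<and> P' s" P']
  by blast

lemma los_imp: "los P Q \<Longrightarrow> los P' Q' \<Longrightarrow> los (\<lambda>s. P s \<longrightarrow> P' s) (Q \<longrightarrow> Q')"
  using los_not[OF los_conj[OF _ los_not], of P Q P' Q'] by simp

lemma los_finite_ball:
  assumes "finite I" "\<And>i. i \<in> I \<Longrightarrow> los (P i) (Q i)"
  shows "los (\<lambda>s. \<forall>i\<in>I. P i s) (\<forall>i\<in>I. Q i)"
  unfolding los_def
proof
  assume *: "{s \<in> S. \<forall>i\<in>I. P i s} \<in> D"
  have "{s \<in> S. P i s} \<in> D" if "i \<in> I" for i
    using * by (rule ae_mono) (use that in auto)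
  then show "\<forall>i\<in>I. Q i" using assms by (auto simp: los_def)
next
  assume "\<forall>i\<in>I. Q i"
  then show "{s \<in> S. \<forall>i\<in>I. P i s} \<in> D"
    using assms by (intro ae_finite) (auto simp: los_def)
qed

text \<open>If the property fails for almost all \<open>s\<close>, counterexamples can be chosen
  simultaneously, and the limit of this family is a counterexample in the limit. The other direction
  only needs that every element of \<open>C'\<close> is a limit.\<close>

lemma los_ball:
  assumes onto: "ulim ` Pi S C = C'" and ne: "C' \<noteq> {}"
    and los: "\<And>x. x \<in> Pi S C \<Longrightarrow> los (\<lambda>s. P s (x s)) (Q (ulim x))"
  shows "los (\<lambda>s. \<forall>y\<in>C s. P s y) (\<forall>y\<in>C'. Q y)"
  unfolding los_def
proof
  assume *: "{s \<in> S. \<forall>y\<in>C s. P s y} \<in> D"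
  show "\<forall>y\<in>C'. Q y"
  proof
    fix y assume "y \<in> C'"
    then obtain x where x: "x \<in> Pi S C" "y = ulim x" using onto by auto
    then have "{s \<in> S. P s (x s)} \<in> D" using * by (auto elim!: ae_mono)
    then show "Q y" using los x by (auto simp: los_def)
  qed
next
  assume Q: "\<forall>y\<in>C'. Q y"
  show "{s \<in> S. \<forall>y\<in>C s. P s y} \<in> D"
  proof (rule ccontr)
    assume "{s \<in> S. \<forall>y\<in>C s. P s y} \<notin> D"
    then have *: "{s \<in> S. \<exists>y\<in>C s. \<not> P s y} \<in> D"
      using ae_not[of "\<lambda>s. \<forall>y\<in>C s. P s y"] by simp
    obtain z where z: "z \<in> Pi S C" using onto ne by blast
    \<comment> \<open>Where there is no counterexample the value is taken from an arbitrary family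
      \<open>z\<close>, so that \<open>x\<close> is a family over all of \<open>S\<close>.\<close>
    define x where "x s = (if \<exists>y\<in>C s. \<not> P s y then SOME y. y \<in> C s \<and> \<not> P s y else z s)" for s
    have x1: "x s \<in> C s \<and> \<not> P s (x s)" if "\<exists>y\<in>C s. \<not> P s y" for s
      using someI_ex[of "\<lambda>y. y \<in> C s \<and> \<not> P s y"] that by (auto simp: x_def)
    have "x \<in> Pi S C" using z x1 by (auto simp: x_def) 
    then have "{s \<in> S. P s (x s)} \<in> D"
      using los[of x] Q onto by (auto simp: los_def)
    moreover have "{s \<in> S. \<not> P s (x s)} \<in> D"
      using * by (rule ae_mono) (use x1 in auto)
    ultimately show False using ae_not[of "\<lambda>s. P s (x s)"] by blast
  qed
qed

lemma los_bex:
  assumes "ulim ` Pi S C = C'" "C' \<noteq> {}"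
    and "\<And>x. x \<in> Pi S C \<Longrightarrow> los (\<lambda>s. P s (x s)) (Q (ulim x))"
  shows "los (\<lambda>s. \<exists>y\<in>C s. P s y) (\<exists>y\<in>C'. Q y)"
proof -
  have "los (\<lambda>s. \<forall>y\<in>C s. \<not> P s y) (\<forall>y\<in>C'. \<not> Q y)"
    by (rule los_ball[OF assms(1,2)]) (rule los_not[OF assms(3)])
  from los_not[OF this] show ?thesis by simp
qed

end

section \<open>Ultraproducts described by a limit map\<close>

text \<open>An ultraproduct is described only through its limit map, not through equivalence
  classes. Thus lists of length \<open>n\<close> over an ultraproduct are again an instance, with
  coordinatewise limits. Families are constrained on \<open>S\<close> only, so pointwise terms are
  plain functions.\<close>

locale ultralimit = ultrafilter_on S D for S :: "'s set" and D :: "'s set set" +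
  fixes R :: "'s \<Rightarrow> ('r, 'm) ring_scheme" and M :: "('x, 'n) ring_scheme"
    and ulim :: "('s \<Rightarrow> 'r) \<Rightarrow> 'x"
  assumes closed: "s \<in> S \<Longrightarrow> closed_ring (R s)"
    and ulim_onto: "ulim ` Pi S (\<lambda>s. carrier (R s)) = carrier M"
    and ulim_eq: "x \<in> Pi S (\<lambda>s. carrier (R s)) \<Longrightarrow> y \<in> Pi S (\<lambda>s. carrier (R s)) \<Longrightarrow>
      ulim x = ulim y \<longleftrightarrow> {s \<in> S. x s = y s} \<in> D"
    and ulim_add: "x \<in> Pi S (\<lambda>s. carrier (R s)) \<Longrightarrow> y \<in> Pi S (\<lambda>s. carrier (R s)) \<Longrightarrow>
      ulim x \<oplus>\<^bsub>M\<^esub> ulim y = ulim (\<lambda>s. x s \<oplus>\<^bsub>R s\<^esub> y s)"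
    and ulim_mult: "x \<in> Pi S (\<lambda>s. carrier (R s)) \<Longrightarrow> y \<in> Pi S (\<lambda>s. carrier (R s)) \<Longrightarrow>
      ulim x \<otimes>\<^bsub>M\<^esub> ulim y = ulim (\<lambda>s. x s \<otimes>\<^bsub>R s\<^esub> y s)"
    and ulim_zero: "\<zero>\<^bsub>M\<^esub> = ulim (\<lambda>s. \<zero>\<^bsub>R s\<^esub>)"
    and ulim_one: "\<one>\<^bsub>M\<^esub> = ulim (\<lambda>s. \<one>\<^bsub>R s\<^esub>)"
begin

abbreviation "fam \<equiv> Pi S (\<lambda>s. carrier (R s))"

lemma fam_add: "x \<in> fam \<Longrightarrow> y \<in> fam \<Longrightarrow> (\<lambda>s. x s \<oplus>\<^bsub>R s\<^esub> y s) \<in> fam"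
  and fam_mult: "x \<in> fam \<Longrightarrow> y \<in> fam \<Longrightarrow> (\<lambda>s. x s \<otimes>\<^bsub>R s\<^esub> y s) \<in> fam"
  and fam_zero: "(\<lambda>s. \<zero>\<^bsub>R s\<^esub>) \<in> fam" and fam_one: "(\<lambda>s. \<one>\<^bsub>R s\<^esub>) \<in> fam"
  using closed unfolding closed_ring_def Pi_iff by blast+

lemma ulim_closed: "x \<in> fam \<Longrightarrow> ulim x \<in> carrier M"
  using ulim_onto by auto

lemma carrier_ne: "carrier M \<noteq> {}"
  using ulim_closed[OF fam_one] by auto

lemma ulim_cong: "x \<in> fam \<Longrightarrow> (\<And>s. s \<in> S \<Longrightarrow> x s = y s) \<Longrightarrow> ulim x = ulim y"
  by (subst ulim_eq) (auto intro!: ae_all simp: Pi_iff)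

lemma los_eq: "x \<in> fam \<Longrightarrow> y \<in> fam \<Longrightarrow> los (\<lambda>s. x s = y s) (ulim x = ulim y)"
  by (simp add: los_def ulim_eq)

lemmas los_allM = los_ball[OF ulim_onto carrier_ne]
lemmas los_exM = los_bex[OF ulim_onto carrier_ne]

lemma obtain_fam:
  assumes "a \<in> carrier M" obtains x where "x \<in> fam" "a = ulim x"
  using assms ulim_onto by auto

lemma closed_M: "closed_ring M"
  unfolding closed_ring_def
proof (intro conjI ballI)
  fix a b assume "a \<in> carrier M" "b \<in> carrier M"
  then obtain x y where "x \<in> fam" "a = ulim x" "y \<in> fam" "b = ulim y"
    using obtain_fam by metis
  then show "a \<oplus>\<^bsub>M\<^esub> b \<in> carrier M" "a \<otimes>\<^bsub>M\<^esub> b \<in> carrier M"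
    by (simp_all only: ulim_add ulim_mult fam_add fam_mult ulim_closed)
qed (simp_all only: ulim_zero ulim_one fam_zero fam_one ulim_closed)

lemma los_field: "los (\<lambda>s. field (R s)) (field M)"
proof -
  \<comment> \<open>The introduction rules follow the syntax of \<open>field_sentence\<close>. What
    remains are equations between terms, where the operations of \<open>M\<close> are pulled inside
    \<open>ulim\<close>.\<close>
  have "los (\<lambda>s. field_sentence (R s)) (field_sentence M)"
    unfolding field_sentence_def
    by (intro los_conj los_allM los_exM los_imp los_not;
        simp add: ulim_add ulim_mult ulim_zero ulim_one fam_add fam_mult fam_zero fam_one los_eq)
  moreover have "{s \<in> S. field (R s)} = {s \<in> S. field_sentence (R s)}"
    using field_iff_sentence[OF closed] by blast
  ultimately show ?thesis
    using field_iff_sentence[OF closed_M] by (simp add: los_def)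
qed

end

text \<open>The representatives in \<open>ultraprod\<close> are extensional functions; the
  restriction admits families with arbitrary values outside \<open>S\<close>.\<close>

definition ulim_cls :: "'s set \<Rightarrow> 's set set \<Rightarrow> ('s \<Rightarrow> ('a, 'b) ring_scheme) \<Rightarrow> ('s \<Rightarrow> 'a) \<Rightarrow> ('s \<Rightarrow> 'a) set" where
  "ulim_cls S D R x = {(f, g). f \<in> (\<Pi>\<^sub>E s\<in>S. carrier (R s)) \<and> g \<in> (\<Pi>\<^sub>E s\<in>S. carrier (R s))
                \<and> {s \<in> S. f s = g s} \<in> D} `` {restrict x S}"

lemma (in ultrafilter_on) ultralimit_ultraprod:
  assumes closed: "\<And>s. s \<in> S \<Longrightarrow> closed_ring (R s)"
  shows "ultralimit S D R (ultraprod S D R) (ulim_cls S D R)"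
proof -
  let ?Y = "\<Pi>\<^sub>E s\<in>S. carrier (R s)"
  let ?r = "{(f, g). f \<in> ?Y \<and> g \<in> ?Y \<and> {s \<in> S. f s = g s} \<in> D}"
  have r: "equiv ?Y ?r"
  proof (rule equivI)
    show "refl_on ?Y ?r" using top by (auto simp: refl_on_def)
    show "sym ?r" by (auto simp: sym_def eq_commute)
    show "trans ?r"
    proof (rule transI, clarsimp)
      fix f g h assume "{s \<in> S. f s = g s} \<in> D" "{s \<in> S. g s = h s} \<in> D"
      from ae_conj[OF this] show "{s \<in> S. f s = h s} \<in> D" by (rule ae_mono) simp
    qed
  qed auto
  have Y: "restrict x S \<in> ?Y" if "x \<in> Pi S (\<lambda>s. carrier (R s))" for x
    using that by auto
  \<comment> \<open>Addition and multiplication are the two instances, with \<open>h s\<close> the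
    operation of the factor at \<open>s\<close>.\<close>
  have op: "?r `` {(\<lambda>s\<in>S. h s ((SOME a. a \<in> ?r `` {restrict x S}) s) ((SOME b. b \<in> ?r `` {restrict y S}) s))}
      = ?r `` {restrict (\<lambda>s. h s (x s) (y s)) S}"
    if x: "x \<in> Pi S (\<lambda>s. carrier (R s))" and y: "y \<in> Pi S (\<lambda>s. carrier (R s))"
      and h: "\<And>s a b. s \<in> S \<Longrightarrow> a \<in> carrier (R s) \<Longrightarrow> b \<in> carrier (R s) \<Longrightarrow> h s a b \<in> carrier (R s)" for x y h
  proof -
    have "?r `` {(\<lambda>f g. \<lambda>s\<in>S. h s (f s) (g s)) (SOME a. a \<in> ?r `` {restrict x S}) (SOME b. b \<in> ?r `` {restrict y S})}
      = ?r `` {(\<lambda>f g. \<lambda>s\<in>S. h s (f s) (g s)) (restrict x S) (restrict y S)}"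
    proof (rule quot_op[OF r Y[OF x] Y[OF y]])
      fix a a' b b' assume 1: "(a, a') \<in> ?r" "(b, b') \<in> ?r"
      then have "{s \<in> S. a s = a' s} \<in> D" "{s \<in> S. b s = b' s} \<in> D" by auto
      from ae_conj[OF this] have "{s \<in> S. h s (a s) (b s) = h s (a' s) (b' s)} \<in> D"
        by (rule ae_mono) simp
      moreover have "{s \<in> S. (\<lambda>s\<in>S. h s (a s) (b s)) s = (\<lambda>s\<in>S. h s (a' s) (b' s)) s} = {s \<in> S. h s (a s) (b s) = h s (a' s) (b' s)}"
        by auto
      ultimately show "((\<lambda>s\<in>S. h s (a s) (b s)), (\<lambda>s\<in>S. h s (a' s) (b' s))) \<in> ?r"
        using 1 h by (auto simp: PiE_iff)
    qed
    moreover have "(\<lambda>s\<in>S. h s (restrict x S s) (restrict y S s)) = restrict (\<lambda>s. h s (x s) (y s)) S"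
      by (rule restrict_ext) simp
    ultimately show ?thesis by (simp only:)
  qed
  show ?thesis
  proof
    show "ulim_cls S D R ` Pi S (\<lambda>s. carrier (R s)) = carrier (ultraprod S D R)" (is "?L = ?C")
    proof
      have "carrier (ultraprod S D R) = ?Y // ?r" by (simp add: ultraprod_def quot_ring_def)
      then show "?L \<subseteq> ?C" unfolding ulim_cls_def using Y by (metis (no_types, lifting) quotientI image_subsetI)
      show "?C \<subseteq> ?L"
      proof
        fix A assume "A \<in> ?C"
        then obtain f where f: "f \<in> ?Y" "A = ?r `` {f}"
          by (auto simp: ultraprod_def quot_ring_def quotient_def)
        then have "A = ulim_cls S D R f" by (simp add: ulim_cls_def PiE_restrict)
        then show "A \<in> ?L" using f(1) by (auto simp: PiE_def)
      qed
    qed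
  next
    fix x y assume xy: "x \<in> Pi S (\<lambda>s. carrier (R s))" "y \<in> Pi S (\<lambda>s. carrier (R s))"
    have "{s \<in> S. restrict x S s = restrict y S s} = {s \<in> S. x s = y s}" by auto
    then show "ulim_cls S D R x = ulim_cls S D R y \<longleftrightarrow> {s \<in> S. x s = y s} \<in> D"
      unfolding ulim_cls_def
      by (subst eq_equiv_class_iff[OF r Y[OF xy(1)] Y[OF xy(2)]]) (use Y[OF xy(1)] Y[OF xy(2)] in simp)
    show "ulim_cls S D R x \<oplus>\<^bsub>ultraprod S D R\<^esub> ulim_cls S D R y = ulim_cls S D R (\<lambda>s. x s \<oplus>\<^bsub>R s\<^esub> y s)"
    proof -
      have e: "add (ultraprod S D R) = (\<lambda>A B. ?r `` {(\<lambda>s\<in>S. (SOME a. a \<in> A) s \<oplus>\<^bsub>R s\<^esub> (SOME b. b \<in> B) s)})"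
        by (simp add: ultraprod_def quot_ring_def)
      show ?thesis unfolding e ulim_cls_def
        by (rule op[OF xy]) (use closed in \<open>auto simp: closed_ring_def\<close>)
    qed
    show "ulim_cls S D R x \<otimes>\<^bsub>ultraprod S D R\<^esub> ulim_cls S D R y = ulim_cls S D R (\<lambda>s. x s \<otimes>\<^bsub>R s\<^esub> y s)"
    proof -
      have e: "monoid.mult (ultraprod S D R) = (\<lambda>A B. ?r `` {(\<lambda>s\<in>S. (SOME a. a \<in> A) s \<otimes>\<^bsub>R s\<^esub> (SOME b. b \<in> B) s)})"
        by (simp add: ultraprod_def quot_ring_def)
      show ?thesis unfolding e ulim_cls_def
        by (rule op[OF xy]) (use closed in \<open>auto simp: closed_ring_def\<close>)
    qed
  qed (use closed in \<open>simp_all add: ultraprod_def quot_ring_def ulim_cls_def\<close>)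
qed

section \<open>Galois coordinates\<close>

lemma (in abelian_monoid) finsum_swap:
  assumes "finite A" "finite B" "\<And>i j. i \<in> A \<Longrightarrow> j \<in> B \<Longrightarrow> f i j \<in> carrier G"
  shows "(\<Oplus>i\<in>A. \<Oplus>j\<in>B. f i j) = (\<Oplus>j\<in>B. \<Oplus>i\<in>A. f i j)"
  using assms
proof (induction A rule: finite_induct)
  case empty
  then show ?case by simp
next
  case (insert a A)
  have "(\<Oplus>j\<in>B. \<Oplus>i\<in>insert a A. f i j) = (\<Oplus>j\<in>B. f a j \<oplus> (\<Oplus>i\<in>A. f i j))"
    using insert by (intro finsum_cong') (auto simp: Pi_iff intro!: finsum_closed)
  also have "\<dots> = (\<Oplus>j\<in>B. f a j) \<oplus> (\<Oplus>j\<in>B. \<Oplus>i\<in>A. f i j)"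
    using insert by (intro finsum_addf) (auto simp: Pi_iff intro!: finsum_closed)
  finally show ?case
    using insert by (subst finsum_insert) (auto simp: Pi_iff intro!: finsum_closed)
qed

lemma (in abelian_monoid) finsum_split:
  fixes m n :: nat
  assumes "\<And>i. i < m + n \<Longrightarrow> f i \<in> carrier G"
  shows "(\<Oplus>i\<in>{..<m + n}. f i) = (\<Oplus>i\<in>{..<m}. f i) \<oplus> (\<Oplus>i\<in>{..<n}. f (m + i))"
  using assms
proof (induction n)
  case 0
  then show ?case by (simp add: finsum_closed Pi_iff)
next
  case (Suc n)
  then show ?case
    by (simp add: lessThan_Suc finsum_insert finsum_closed Pi_iff a_ac)
qed

lemma (in abelian_monoid) finsum_delta:
  assumes "finite A" "i \<in> A" "f \<in> A \<rightarrow> carrier G"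
  shows "(\<Oplus>j\<in>A. if j = i then f j else \<zero>) = f i"
  using add.finprod_singleton_swap[OF assms(2,1,3)] by simp

context cring
begin

lemma ring_hom_finsum:
  assumes "\<tau> \<in> ring_hom R R" "f \<in> A \<rightarrow> carrier R"
  shows "\<tau> (\<Oplus>i\<in>A. f i) = (\<Oplus>i\<in>A. \<tau> (f i))"
proof -
  interpret \<tau>: ring_hom_cring R R \<tau>
    by (intro ring_hom_cringI assms(1)) (rule is_cring)+
  show ?thesis using \<tau>.hom_finsum[OF assms(2)] by (simp add: comp_def)
qed

text \<open>The image of the tensor with terms a_l and b_l under the multiplication twisted by
  \<open>\<tau>\<close>. As a function of \<open>\<tau>\<close> it will be made the indicator
  function of the identity.\<close>

definition coord_kernel :: "nat \<Rightarrow> (nat \<Rightarrow> 'a) \<Rightarrow> (nat \<Rightarrow> 'a) \<Rightarrow> ('a \<Rightarrow> 'a) \<Rightarrow> 'a" where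
  "coord_kernel m a b \<tau> = (\<Oplus>l\<in>{..<m}. a l \<otimes> \<tau> (b l))"

text \<open>Interchange of the two sums. When the kernel vanishes at all but one of the
  \<open>\<tau> i\<close>, the right side collapses to a single term.\<close>

lemma coord_kernel_sum:
  assumes a: "a \<in> {..<m} \<rightarrow> carrier R" and b: "b \<in> {..<m} \<rightarrow> carrier R" and I: "finite I"
    and \<tau>: "\<And>i. i \<in> I \<Longrightarrow> \<tau> i \<in> carrier R \<rightarrow> carrier R" and x: "x \<in> I \<rightarrow> carrier R"
  shows "(\<Oplus>l\<in>{..<m}. a l \<otimes> (\<Oplus>i\<in>I. \<tau> i (b l) \<otimes> x i)) = (\<Oplus>i\<in>I. coord_kernel m a b (\<tau> i) \<otimes> x i)"
proof -
  have c: "a l \<in> carrier R" "\<tau> i (b l) \<in> carrier R" "x i \<in> carrier R" if "l < m" "i \<in> I" for l i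
    using that assms by (auto simp: Pi_iff)
  have x': "x i \<in> carrier R" if "i \<in> I" for i using x that by auto
  have "(\<Oplus>l\<in>{..<m}. a l \<otimes> (\<Oplus>i\<in>I. \<tau> i (b l) \<otimes> x i)) = (\<Oplus>l\<in>{..<m}. \<Oplus>i\<in>I. a l \<otimes> (\<tau> i (b l) \<otimes> x i))"
    using a c by (intro finsum_cong' finsum_rdistr I) (auto simp: Pi_iff intro!: finsum_closed)
  also have "\<dots> = (\<Oplus>i\<in>I. \<Oplus>l\<in>{..<m}. a l \<otimes> (\<tau> i (b l) \<otimes> x i))"
    using c by (intro finsum_swap I) auto
  also have "\<dots> = (\<Oplus>i\<in>I. coord_kernel m a b (\<tau> i) \<otimes> x i)"
  proof (rule finsum_cong')
    fix i assume i: "i \<in> I"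
    show "(\<Oplus>l\<in>{..<m}. a l \<otimes> (\<tau> i (b l) \<otimes> x i)) = coord_kernel m a b (\<tau> i) \<otimes> x i"
      unfolding coord_kernel_def using i c x'
      by (subst finsum_ldistr) (auto simp: m_assoc intro!: finsum_cong')
  qed (use c x' in \<open>auto simp: coord_kernel_def intro!: finsum_closed\<close>)
  finally show ?thesis .
qed

end

context field
begin

text \<open>The function \<open>\<sigma> \<mapsto> (\<tau> c - \<sigma> c) / (\<tau> c - c)\<close> is \<open>1\<close> at the identity and \<open>0\<close> at \<open>\<tau>\<close>; functions
  of the form \<open>\<sigma> \<mapsto> \<Sum> a \<sigma>(b)\<close> are closed under products.\<close>
lemma exists_coord_kernel:
  assumes "finite T" "\<And>\<tau>. \<tau> \<in> T \<Longrightarrow> \<tau> \<in> ring_hom R R"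
    "\<And>\<tau>. \<tau> \<in> T \<Longrightarrow> \<exists>x\<in>carrier R. \<tau> x \<noteq> x"
  shows "\<exists>m a b. a \<in> {..<m} \<rightarrow> carrier R \<and> b \<in> {..<m} \<rightarrow> carrier R \<and>
    coord_kernel m a b (\<lambda>x. x) = \<one> \<and> (\<forall>\<tau>\<in>T. coord_kernel m a b \<tau> = \<zero>)"
  using assms
proof (induction T rule: finite_induct)
  case empty
  show ?case
    by (rule exI[of _ 1], rule exI[of _ "\<lambda>_. \<one>"], rule exI[of _ "\<lambda>_. \<one>"])
      (simp add: coord_kernel_def lessThan_Suc)
next
  case (insert \<tau> T)
  then obtain m a b where a: "a \<in> {..<m} \<rightarrow> carrier R" and b: "b \<in> {..<m} \<rightarrow> carrier R"
    and 1: "coord_kernel m a b (\<lambda>x. x) = \<one>" and 0: "\<And>\<tau>. \<tau> \<in> T \<Longrightarrow> coord_kernel m a b \<tau> = \<zero>"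
    by auto
  obtain c where c: "c \<in> carrier R" "\<tau> c \<noteq> c" using insert.prems by auto
  have \<tau>: "\<tau> \<in> ring_hom R R" using insert.prems by auto
  have \<tau>c: "\<tau> c \<in> carrier R" using ring_hom_closed[OF \<tau>] c by auto
  define d where "d = inv (\<tau> c \<ominus> c)"
  have "\<tau> c \<ominus> c \<in> Units R"
    using c \<tau>c by (simp add: field_Units)
  then have d: "d \<in> carrier R" "d \<otimes> (\<tau> c \<ominus> c) = \<one>" by (auto simp: d_def)
  \<comment> \<open>The factor \<open>d \<otimes> (\<tau> c \<ominus> \<sigma> c)\<close> has two
    terms, so multiplying by it doubles the length: the first \<open>m\<close> entries carry
    \<open>d \<otimes> \<tau> c\<close>, the last \<open>m\<close> carry \<open>\<ominus> d\<close>
    and put \<open>c\<close> under \<open>\<sigma>\<close>.\<close>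
  define a' where "a' l = (if l < m then (d \<otimes> \<tau> c) \<otimes> a l else (\<ominus> d) \<otimes> a (l - m))" for l
  define b' where "b' l = (if l < m then b l else b (l - m) \<otimes> c)" for l
  have al: "a l \<in> carrier R" "b l \<in> carrier R" if "l < m" for l
    using a b that by auto
  have a'b': "a' \<in> {..<m + m} \<rightarrow> carrier R" "b' \<in> {..<m + m} \<rightarrow> carrier R"
    using al c d \<tau>c by (auto simp: a'_def b'_def)
  have main: "coord_kernel (m + m) a' b' \<sigma> = (d \<otimes> (\<tau> c \<ominus> \<sigma> c)) \<otimes> coord_kernel m a b \<sigma>"
    if \<sigma>: "\<sigma> \<in> ring_hom R R" for \<sigma>
  proof -
    note \<sigma>c = ring_hom_closed[OF \<sigma> c(1)]
    have \<sigma>b: "\<sigma> (b l) \<in> carrier R" if "l < m" for l using ring_hom_closed[OF \<sigma>] al that by auto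
    have "coord_kernel (m + m) a' b' \<sigma> =
      (\<Oplus>l\<in>{..<m}. a' l \<otimes> \<sigma> (b' l)) \<oplus> (\<Oplus>l\<in>{..<m}. a' (m + l) \<otimes> \<sigma> (b' (m + l)))"
      unfolding coord_kernel_def
      using a'b' ring_hom_closed[OF \<sigma>] by (intro finsum_split) (auto simp: Pi_iff)
    also have "(\<Oplus>l\<in>{..<m}. a' l \<otimes> \<sigma> (b' l)) = (\<Oplus>l\<in>{..<m}. (d \<otimes> \<tau> c) \<otimes> (a l \<otimes> \<sigma> (b l)))"
      using al \<sigma>b d \<tau>c by (intro finsum_cong') (auto simp: a'_def b'_def m_assoc)
    also have "\<dots> = (d \<otimes> \<tau> c) \<otimes> coord_kernel m a b \<sigma>"
      unfolding coord_kernel_def using al \<sigma>b d \<tau>c by (intro finsum_rdistr[symmetric]) auto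
    also have "(\<Oplus>l\<in>{..<m}. a' (m + l) \<otimes> \<sigma> (b' (m + l))) = (\<Oplus>l\<in>{..<m}. ((\<ominus> d) \<otimes> \<sigma> c) \<otimes> (a l \<otimes> \<sigma> (b l)))"
    proof (rule finsum_cong')
      fix l assume l: "l \<in> {..<m}"
      have "\<sigma> (b l \<otimes> c) = \<sigma> (b l) \<otimes> \<sigma> c" using ring_hom_mult[OF \<sigma>] al l c by auto
      then show "a' (m + l) \<otimes> \<sigma> (b' (m + l)) = ((\<ominus> d) \<otimes> \<sigma> c) \<otimes> (a l \<otimes> \<sigma> (b l))"
        using l al[of l] \<sigma>b[of l] d(1) \<sigma>c by (simp add: a'_def b'_def m_ac l_minus r_minus)
    qed (use al \<sigma>b d \<sigma>c in auto)
    also have "\<dots> = ((\<ominus> d) \<otimes> \<sigma> c) \<otimes> coord_kernel m a b \<sigma>"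
      unfolding coord_kernel_def using al \<sigma>b d \<sigma>c by (intro finsum_rdistr[symmetric]) auto
    also have "(d \<otimes> \<tau> c) \<otimes> coord_kernel m a b \<sigma> \<oplus> \<dots> = (d \<otimes> (\<tau> c \<ominus> \<sigma> c)) \<otimes> coord_kernel m a b \<sigma>"
    proof -
      have "coord_kernel m a b \<sigma> \<in> carrier R"
        unfolding coord_kernel_def using al \<sigma>b by (intro finsum_closed) auto
      then show ?thesis using d(1) \<tau>c \<sigma>c by (simp add: a_minus_def l_distr r_distr l_minus r_minus)
    qed
    finally show ?thesis .
  qed
  have idh: "(\<lambda>x. x) \<in> ring_hom R R" by (auto intro: ring_hom_memI)
  have "coord_kernel (m + m) a' b' (\<lambda>x. x) = \<one>"
    using main[OF idh] 1 d by simp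
  moreover have "coord_kernel (m + m) a' b' \<tau> = \<zero>"
  proof -
    have "coord_kernel m a b \<tau> \<in> carrier R"
      unfolding coord_kernel_def using al ring_hom_closed[OF \<tau>] by (intro finsum_closed) auto
    moreover have "\<tau> c \<ominus> \<tau> c = \<zero>" using \<tau>c by simp
    ultimately show ?thesis using main[OF \<tau>] d(1) by simp
  qed
  moreover have "coord_kernel (m + m) a' b' \<sigma> = \<zero>" if "\<sigma> \<in> T" for \<sigma>
    using main[of \<sigma>] 0[OF that] insert.prems(1)[of \<sigma>] that d(1) \<tau>c ring_hom_closed[of \<sigma> R R c] c by simp
  ultimately show ?case using a'b' by blast
qed

end

section \<open>Finite groups acting on commutative rings\<close>

text \<open>The ring is only commutative, because traces and fixed elements of the tensor product
  are used before it is known to be a field.\<close>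

locale ring_action = cring M for M (structure) +
  fixes \<Gamma> :: "('g, 'm) monoid_scheme" and \<rho> :: "'g \<Rightarrow> 'a \<Rightarrow> 'a"
  assumes \<Gamma>: "group \<Gamma>" and finite_\<Gamma>: "finite (carrier \<Gamma>)"
    and act_hom: "g \<in> carrier \<Gamma> \<Longrightarrow> \<rho> g \<in> ring_hom M M"
    and act_mult: "g \<in> carrier \<Gamma> \<Longrightarrow> h \<in> carrier \<Gamma> \<Longrightarrow> x \<in> carrier M \<Longrightarrow> \<rho> (g \<otimes>\<^bsub>\<Gamma>\<^esub> h) x = \<rho> g (\<rho> h x)"
    and act_one: "x \<in> carrier M \<Longrightarrow> \<rho> \<one>\<^bsub>\<Gamma>\<^esub> x = x"
begin

sublocale G: group \<Gamma> by (rule \<Gamma>)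

lemma act_closed: "g \<in> carrier \<Gamma> \<Longrightarrow> x \<in> carrier M \<Longrightarrow> \<rho> g x \<in> carrier M"
  by (rule ring_hom_closed[OF act_hom])

lemma act_add: "g \<in> carrier \<Gamma> \<Longrightarrow> x \<in> carrier M \<Longrightarrow> y \<in> carrier M \<Longrightarrow> \<rho> g (x \<oplus> y) = \<rho> g x \<oplus> \<rho> g y"
  and act_times: "g \<in> carrier \<Gamma> \<Longrightarrow> x \<in> carrier M \<Longrightarrow> y \<in> carrier M \<Longrightarrow> \<rho> g (x \<otimes> y) = \<rho> g x \<otimes> \<rho> g y"
  and act_1: "g \<in> carrier \<Gamma> \<Longrightarrow> \<rho> g \<one> = \<one>"
  by (rule ring_hom_add[OF act_hom], assumption+, rule ring_hom_mult[OF act_hom], assumption+,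
      rule ring_hom_one[OF act_hom])

lemma act_neg: "g \<in> carrier \<Gamma> \<Longrightarrow> x \<in> carrier M \<Longrightarrow> \<rho> g (\<ominus> x) = \<ominus> \<rho> g x"
  by (intro ring_hom_cring.hom_a_inv ring_hom_cringI act_hom) (rule is_cring)+

lemma act_inv: "g \<in> carrier \<Gamma> \<Longrightarrow> x \<in> carrier M \<Longrightarrow> \<rho> (inv\<^bsub>\<Gamma>\<^esub> g) (\<rho> g x) = x"
  and act_inv': "g \<in> carrier \<Gamma> \<Longrightarrow> x \<in> carrier M \<Longrightarrow> \<rho> g (\<rho> (inv\<^bsub>\<Gamma>\<^esub> g) x) = x"
  by (metis G.inv_closed G.l_inv G.r_inv act_mult act_one)+

definition Tr :: "'g set \<Rightarrow> 'a \<Rightarrow> 'a" where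
  "Tr Z x = (\<Oplus>g\<in>Z. \<rho> g x)"

definition Fixed :: "'a set" where
  "Fixed = {x \<in> carrier M. \<forall>g\<in>carrier \<Gamma>. \<rho> g x = x}"

lemma Tr_closed: "Z \<subseteq> carrier \<Gamma> \<Longrightarrow> x \<in> carrier M \<Longrightarrow> Tr Z x \<in> carrier M"
  unfolding Tr_def by (intro finsum_closed) (auto simp: act_closed)

lemma act_Tr:
  assumes "g \<in> carrier \<Gamma>" "Z \<subseteq> carrier \<Gamma>" "x \<in> carrier M"
  shows "\<rho> g (Tr Z x) = Tr ((\<lambda>h. g \<otimes>\<^bsub>\<Gamma>\<^esub> h) ` Z) x"
proof -
  have "\<rho> g (Tr Z x) = (\<Oplus>h\<in>Z. \<rho> g (\<rho> h x))"
    unfolding Tr_def using assms by (intro ring_hom_finsum act_hom) (auto simp: act_closed)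
  also have "\<dots> = (\<Oplus>h\<in>Z. \<rho> (g \<otimes>\<^bsub>\<Gamma>\<^esub> h) x)"
    using assms by (intro finsum_cong') (auto simp: act_mult act_closed subset_iff)
  also have "\<dots> = Tr ((\<lambda>h. g \<otimes>\<^bsub>\<Gamma>\<^esub> h) ` Z) x"
    unfolding Tr_def using assms
    by (intro finsum_reindex[symmetric]) (auto simp: act_closed subset_iff inj_on_def)
  finally show ?thesis .
qed

lemma translate_carrier: "g \<in> carrier \<Gamma> \<Longrightarrow> (\<lambda>h. g \<otimes>\<^bsub>\<Gamma>\<^esub> h) ` carrier \<Gamma> = carrier \<Gamma>"
  using G.surj_const_mult by blast

lemma Tr_Fixed: "x \<in> carrier M \<Longrightarrow> Tr (carrier \<Gamma>) x \<in> Fixed"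
  unfolding Fixed_def by (auto simp: Tr_closed act_Tr translate_carrier)

lemma Tr_mult_fixed:
  assumes "Z \<subseteq> carrier \<Gamma>" "x \<in> carrier M" "y \<in> carrier M" "\<And>g. g \<in> Z \<Longrightarrow> \<rho> g y = y"
  shows "Tr Z (x \<otimes> y) = Tr Z x \<otimes> y"
proof -
  have "Tr Z (x \<otimes> y) = (\<Oplus>g\<in>Z. \<rho> g x \<otimes> y)"
    unfolding Tr_def using assms by (intro finsum_cong') (auto simp: act_times act_closed subset_iff)
  also have "\<dots> = Tr Z x \<otimes> y"
    unfolding Tr_def using assms finite_subset[OF assms(1) finite_\<Gamma>]
    by (intro finsum_ldistr[symmetric]) (auto simp: act_closed subset_iff)
  finally show ?thesis .
qed

end

text \<open>Such coordinates say that the ring is Galois over its fixed ring. Being equations, they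
  are preserved by equivariant ring homomorphisms.\<close>

locale galois_coords = ring_action M \<Gamma> \<rho> for M (structure) and \<Gamma> \<rho> +
  fixes m and a b :: "nat \<Rightarrow> 'a"
  assumes ab: "a \<in> {..<m} \<rightarrow> carrier M" "b \<in> {..<m} \<rightarrow> carrier M"
    and kernel_act: "g \<in> carrier \<Gamma> \<Longrightarrow> coord_kernel m a b (\<rho> g) = (if g = \<one>\<^bsub>\<Gamma>\<^esub> then \<one> else \<zero>)"
begin

text \<open>After interchanging the sums, the coefficient of \<open>\<rho> g x\<close> is the kernel
  at \<open>g\<close>, so only \<open>g = 1\<close> contributes. \<open>Z\<close> is an arbitrary
  subset, since the sum then detects whether \<open>Z\<close> contains the identity.\<close>

lemma coords_Tr:
  assumes Z: "Z \<subseteq> carrier \<Gamma>" and x: "x \<in> carrier M"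
  shows "(\<Oplus>l\<in>{..<m}. a l \<otimes> Tr Z (b l \<otimes> x)) = (if \<one>\<^bsub>\<Gamma>\<^esub> \<in> Z then x else \<zero>)"
proof -
  have fin: "finite Z" using Z finite_\<Gamma> finite_subset by auto
  have "(\<Oplus>l\<in>{..<m}. a l \<otimes> Tr Z (b l \<otimes> x)) = (\<Oplus>l\<in>{..<m}. a l \<otimes> (\<Oplus>g\<in>Z. \<rho> g (b l) \<otimes> \<rho> g x))"
  proof (rule finsum_cong')
    fix l assume "l \<in> {..<m}"
    then have "Tr Z (b l \<otimes> x) = (\<Oplus>g\<in>Z. \<rho> g (b l) \<otimes> \<rho> g x)"
      unfolding Tr_def using x Z ab
      by (intro finsum_cong') (auto simp: act_closed act_times subset_iff Pi_iff)
    then show "a l \<otimes> Tr Z (b l \<otimes> x) = a l \<otimes> (\<Oplus>g\<in>Z. \<rho> g (b l) \<otimes> \<rho> g x)" by simp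
  qed (use x Z ab in \<open>auto simp: act_closed subset_iff Pi_iff intro!: finsum_closed\<close>)
  also have "\<dots> = (\<Oplus>g\<in>Z. coord_kernel m a b (\<rho> g) \<otimes> \<rho> g x)"
    using x Z by (intro coord_kernel_sum ab fin) (auto simp: act_closed subset_iff)
  also have "\<dots> = (\<Oplus>g\<in>Z. if g = \<one>\<^bsub>\<Gamma>\<^esub> then \<rho> g x else \<zero>)"
    using x Z kernel_act by (intro finsum_cong') (auto simp: act_closed subset_iff)
  also have "\<dots> = (if \<one>\<^bsub>\<Gamma>\<^esub> \<in> Z then x else \<zero>)"
  proof (cases "\<one>\<^bsub>\<Gamma>\<^esub> \<in> Z")
    case True
    then show ?thesis using finsum_delta[OF fin True, of "\<lambda>g. \<rho> g x"] x Z by (simp add: act_one act_closed subset_iff)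
  next
    case False
    have "(\<Oplus>g\<in>Z. if g = \<one>\<^bsub>\<Gamma>\<^esub> then \<rho> g x else \<zero>) = (\<Oplus>g\<in>Z. \<zero>)"
      by (rule finsum_cong') (use False in auto)
    then show ?thesis using False by simp
  qed
  finally show ?thesis .
qed

lemma coords_expand: "x \<in> carrier M \<Longrightarrow> x = (\<Oplus>l\<in>{..<m}. a l \<otimes> Tr (carrier \<Gamma>) (b l \<otimes> x))"
  using coords_Tr[of "carrier \<Gamma>" x] by simp

text \<open>If all these traces vanished, the expansion of \<open>x\<close> in the
  \<open>a l\<close> would be zero.\<close>

lemma Tr_nondegenerate:
  assumes "x \<in> carrier M" "x \<noteq> \<zero>"
  obtains l where "l < m" "Tr (carrier \<Gamma>) (b l \<otimes> x) \<noteq> \<zero>"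
proof (rule ccontr)
  assume *: "\<not> thesis"
  have "x = (\<Oplus>l\<in>{..<m}. a l \<otimes> Tr (carrier \<Gamma>) (b l \<otimes> x))" by (rule coords_expand) fact
  also have "\<dots> = (\<Oplus>l\<in>{..<m}. \<zero>)"
  proof (rule finsum_cong')
    fix l assume l: "l \<in> {..<m}"
    then have "Tr (carrier \<Gamma>) (b l \<otimes> x) = \<zero>" using * that by auto
    then show "a l \<otimes> Tr (carrier \<Gamma>) (b l \<otimes> x) = \<zero>" using l ab by (auto simp: Pi_iff)
  qed auto
  finally show False using assms by simp
qed

end

lemma (in ring) combine_eq_finsum:
  assumes "length Ks = length Us" "set Ks \<subseteq> carrier R" "set Us \<subseteq> carrier R"
  shows "combine Ks Us = (\<Oplus>k\<in>{..<length Us}. Ks ! k \<otimes> Us ! k)"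
  using assms
proof (induction Ks Us rule: list_induct2)
  case Nil
  then show ?case by simp
next
  case (Cons k Ks u Us)
  have "(\<Oplus>i\<in>{..<1 + length Us}. (k # Ks) ! i \<otimes> (u # Us) ! i) =
    (\<Oplus>i\<in>{..<1}. (k # Ks) ! i \<otimes> (u # Us) ! i) \<oplus> (\<Oplus>i\<in>{..<length Us}. (k # Ks) ! (1 + i) \<otimes> (u # Us) ! (1 + i))"
    using Cons by (intro finsum_split m_closed) (auto simp: nth_Cons' subset_iff)
  then show ?case using Cons by (simp add: lessThan_Suc)
qed

section \<open>Finite groups acting faithfully on fields\<close>

locale field_action = ring_action M \<Gamma> \<rho> + field M for M (structure) and \<Gamma> \<rho> +
  assumes faithful: "g \<in> carrier \<Gamma> \<Longrightarrow> g \<noteq> \<one>\<^bsub>\<Gamma>\<^esub> \<Longrightarrow> \<exists>x\<in>carrier M. \<rho> g x \<noteq> x"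
begin

text \<open>Faithfulness says that every \<open>\<rho> g\<close> with \<open>g\<close> not the
  identity moves some element, and the kernel can be made to vanish at these finitely many maps at
  once.\<close>

lemma exists_galois_coords: "\<exists>m a b. galois_coords M \<Gamma> \<rho> m a b"
proof -
  obtain m a b where ab: "a \<in> {..<m} \<rightarrow> carrier M" "b \<in> {..<m} \<rightarrow> carrier M"
    and 1: "coord_kernel m a b (\<lambda>x. x) = \<one>"
    and 0: "\<And>g. g \<in> carrier \<Gamma> - {\<one>\<^bsub>\<Gamma>\<^esub>} \<Longrightarrow> coord_kernel m a b (\<rho> g) = \<zero>"
  proof -
    let ?T = "\<rho> ` (carrier \<Gamma> - {\<one>\<^bsub>\<Gamma>\<^esub>})"
    have "finite ?T" "\<And>\<tau>. \<tau> \<in> ?T \<Longrightarrow> \<tau> \<in> ring_hom M M" "\<And>\<tau>. \<tau> \<in> ?T \<Longrightarrow> \<exists>x\<in>carrier M. \<tau> x \<noteq> x"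
      using finite_\<Gamma> act_hom faithful by auto
    from exists_coord_kernel[OF this] show thesis using that by blast
  qed
  have "coord_kernel m a b (\<rho> \<one>\<^bsub>\<Gamma>\<^esub>) = coord_kernel m a b (\<lambda>x. x)"
    unfolding coord_kernel_def using ab by (intro finsum_cong') (auto simp: act_one Pi_iff)
  then have "galois_coords M \<Gamma> \<rho> m a b"
    using ab 1 0 by unfold_locales auto
  then show ?thesis by blast
qed

lemma Fixed_subfield: "subfield Fixed M"
proof (rule subfieldI')
  show "subring Fixed M"
    by (rule subringI) (auto simp: Fixed_def act_add act_times act_1 act_neg)
  fix k assume k: "k \<in> Fixed - {\<zero>}"
  then have u: "k \<in> Units M" "k \<in> carrier M" by (auto simp: Fixed_def field_Units)
  have "\<rho> g (inv k) = inv k" if g: "g \<in> carrier \<Gamma>" for g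
  proof -
    have "\<rho> g (inv k) \<otimes> k = \<rho> g (inv k \<otimes> k)"
      using k g u by (simp add: act_times Fixed_def del: Units_l_inv)
    also have "\<dots> = \<one>" using u g by (simp add: act_1)
    finally show ?thesis using u g by (metis Units_inv_closed act_closed comm_inv_char m_comm)
  qed
  then show "inv k \<in> Fixed" using u by (auto simp: Fixed_def)
qed

text \<open>Suppose \<open>f\<close> is none of the \<open>\<rho> g\<close>. Then the kernel can be
  made one at the identity and zero at all nontrivial \<open>\<rho> g\<close> and at all
  \<open>f\<close> after \<open>\<rho> g\<close>. Since \<open>f\<close> fixes traces, the expansion
  of one in these coordinates can be computed with or without \<open>f\<close> applied to the
  traces, giving one and zero.\<close>

lemma Artin:
  assumes f: "f \<in> ring_hom M M" and fixf: "\<And>x. x \<in> Fixed \<Longrightarrow> f x = x"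
  shows "\<exists>g\<in>carrier \<Gamma>. \<forall>x\<in>carrier M. f x = \<rho> g x"
proof (rule ccontr)
  assume *: "\<not> ?thesis"
  let ?T = "\<rho> ` (carrier \<Gamma> - {\<one>\<^bsub>\<Gamma>\<^esub>}) \<union> (\<lambda>g x. f (\<rho> g x)) ` carrier \<Gamma>"
  have hom2: "(\<lambda>x. f (\<rho> g x)) \<in> ring_hom M M" if "g \<in> carrier \<Gamma>" for g
    using ring_hom_trans[OF act_hom[OF that] f] by (simp add: comp_def)
  \<comment> \<open>If \<open>f\<close> after \<open>\<rho> g\<close> were the identity,
    \<open>f\<close> would be the action of the inverse of \<open>g\<close>.\<close>
  have moved: "\<exists>x\<in>carrier M. f (\<rho> g x) \<noteq> x" if g: "g \<in> carrier \<Gamma>" for g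
  proof (rule ccontr)
    assume c: "\<not> ?thesis"
    have "f x = \<rho> (inv\<^bsub>\<Gamma>\<^esub> g) x" if "x \<in> carrier M" for x
      using c act_inv'[OF g that] act_closed[OF G.inv_closed[OF g] that] by metis
    then show False using * g by auto
  qed
  obtain m a b where a: "a \<in> {..<m} \<rightarrow> carrier M" and b: "b \<in> {..<m} \<rightarrow> carrier M"
    and 1: "coord_kernel m a b (\<lambda>x. x) = \<one>"
    and 0: "\<And>\<tau>. \<tau> \<in> ?T \<Longrightarrow> coord_kernel m a b \<tau> = \<zero>"
  proof -
    have "finite ?T" "\<And>\<tau>. \<tau> \<in> ?T \<Longrightarrow> \<tau> \<in> ring_hom M M" "\<And>\<tau>. \<tau> \<in> ?T \<Longrightarrow> \<exists>x\<in>carrier M. \<tau> x \<noteq> x"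
      using finite_\<Gamma> act_hom faithful hom2 moved by auto
    from exists_coord_kernel[OF this] show thesis using that by blast
  qed
  have kern1: "coord_kernel m a b (\<rho> \<one>\<^bsub>\<Gamma>\<^esub>) = \<one>"
    unfolding 1[symmetric] coord_kernel_def using b a by (intro finsum_cong') (auto simp: act_one Pi_iff)
  interpret c: galois_coords M \<Gamma> \<rho> m a b
    using a b kern1 0 by unfold_locales auto
  have "\<one> = (\<Oplus>l\<in>{..<m}. a l \<otimes> Tr (carrier \<Gamma>) (b l \<otimes> \<one>))"
    by (rule c.coords_expand) simp
  also have "\<dots> = (\<Oplus>l\<in>{..<m}. a l \<otimes> (\<Oplus>g\<in>carrier \<Gamma>. f (\<rho> g (b l)) \<otimes> \<one>))"
  proof (rule finsum_cong')
    fix l assume "l \<in> {..<m}"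
    then have bl: "b l \<in> carrier M" using b by auto
    have "Tr (carrier \<Gamma>) (b l \<otimes> \<one>) = f (Tr (carrier \<Gamma>) (b l))"
      using bl fixf[OF Tr_Fixed] by simp
    also have "\<dots> = (\<Oplus>g\<in>carrier \<Gamma>. f (\<rho> g (b l)))"
      unfolding Tr_def using bl by (intro ring_hom_finsum f) (auto simp: act_closed)
    also have "\<dots> = (\<Oplus>g\<in>carrier \<Gamma>. f (\<rho> g (b l)) \<otimes> \<one>)"
      using bl by (intro finsum_cong') (auto simp: act_closed ring_hom_closed[OF f])
    finally show "a l \<otimes> Tr (carrier \<Gamma>) (b l \<otimes> \<one>) = a l \<otimes> (\<Oplus>g\<in>carrier \<Gamma>. f (\<rho> g (b l)) \<otimes> \<one>)" by simp
  qed (use a b in \<open>auto simp: act_closed ring_hom_closed[OF f] Pi_iff intro!: finsum_closed\<close>)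
  also have "\<dots> = (\<Oplus>g\<in>carrier \<Gamma>. coord_kernel m a b (\<lambda>x. f (\<rho> g x)) \<otimes> \<one>)"
    using a b finite_\<Gamma> by (intro coord_kernel_sum) (auto simp: act_closed ring_hom_closed[OF f])
  also have "\<dots> = (\<Oplus>g\<in>carrier \<Gamma>. \<zero>)"
    using 0 by (intro finsum_cong') auto
  finally show False by simp
qed

text \<open>Some \<open>b l\<close> has nonzero trace \<open>v\<close>, and division by the fixed
  element \<open>v\<close> commutes with the trace. This replaces averaging over the group, whose
  order may be zero in the field.\<close>

lemma exists_Tr_one: "\<exists>t\<in>carrier M. Tr (carrier \<Gamma>) t = \<one>"
proof -
  obtain m a b where "galois_coords M \<Gamma> \<rho> m a b" using exists_galois_coords by blast
  then interpret c: galois_coords M \<Gamma> \<rho> m a b .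
  obtain l where l: "l < m" "Tr (carrier \<Gamma>) (b l \<otimes> \<one>) \<noteq> \<zero>"
    using c.Tr_nondegenerate[of \<one>] by auto
  have bl: "b l \<in> carrier M" using l c.ab by auto
  define v where "v = Tr (carrier \<Gamma>) (b l)"
  have v: "v \<in> Fixed" "v \<noteq> \<zero>" "v \<in> carrier M" using l bl Tr_Fixed by (auto simp: v_def Tr_closed)
  have iv: "inv v \<in> Fixed" "v \<otimes> inv v = \<one>" "inv v \<in> carrier M"
    using v subfield_m_inv[OF Fixed_subfield, of v] by (auto simp: Fixed_def)
  have "Tr (carrier \<Gamma>) (b l \<otimes> inv v) = \<one>"
    using Tr_mult_fixed[of "carrier \<Gamma>" "b l" "inv v"] iv bl v_def by (auto simp: Fixed_def)
  then show ?thesis using bl iv by (intro bexI[of _ "b l \<otimes> inv v"]) auto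
qed

text \<open>The \<open>a l\<close> span, with the traces of \<open>b l \<otimes> x\<close> as
  coefficients of \<open>x\<close>; this gives finite dimension without any dimension count.\<close>

lemma spanning_list:
  obtains Us where "set Us \<subseteq> carrier M" "Span Fixed Us = carrier M"
proof -
  obtain m a b where "galois_coords M \<Gamma> \<rho> m a b" using exists_galois_coords by blast
  then interpret c: galois_coords M \<Gamma> \<rho> m a b .
  let ?Us = "map a [0..<m]"
  have Us: "set ?Us \<subseteq> carrier M" using c.ab by auto
  have "x \<in> Span Fixed ?Us" if x: "x \<in> carrier M" for x
  proof -
    let ?Ks = "map (\<lambda>l. Tr (carrier \<Gamma>) (b l \<otimes> x)) [0..<m]"
    have Ks: "set ?Ks \<subseteq> Fixed" using c.ab x by (auto intro!: Tr_Fixed)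
    then have Ks': "set ?Ks \<subseteq> carrier M" by (auto simp: Fixed_def)
    have "combine ?Ks ?Us = (\<Oplus>l\<in>{..<m}. a l \<otimes> Tr (carrier \<Gamma>) (b l \<otimes> x))"
      using Us Ks' by (subst combine_eq_finsum) (auto intro!: finsum_cong' m_comm simp: subset_iff)
    then have "x = combine ?Ks ?Us" using c.coords_expand[OF x] by simp
    then show ?thesis
      unfolding Span_mem_iff_length_version[OF Fixed_subfield Us] using Ks
      by (intro exI[of _ ?Ks]) simp
  qed
  moreover have "Span Fixed ?Us \<subseteq> carrier M"
    using Span_in_carrier[OF _ Us] by (auto simp: Fixed_def)
  ultimately show ?thesis using that Us by blast
qed

lemma algebraic_Fixed: "x \<in> carrier M \<Longrightarrow> algebraic Fixed x"
  using finite_dimension_imp_algebraic[OF Fixed_subfield carrier_is_subring, of x]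
    spanning_list Span_finite_dimension[OF Fixed_subfield] unfolding over_def by metis

text \<open>Basis vectors \<open>e k\<close> and coordinate functions \<open>\<pi> k\<close> form
  the interface for structure constants; the lists of the dimension theory stay hidden behind
  it.\<close>

lemma exists_basis:
  obtains n :: nat and e \<pi> where "e \<in> {..<n} \<rightarrow> carrier M"
    "\<And>k x. k < n \<Longrightarrow> x \<in> carrier M \<Longrightarrow> \<pi> k x \<in> Fixed"
    "\<And>x. x \<in> carrier M \<Longrightarrow> (\<Oplus>k\<in>{..<n}. \<pi> k x \<otimes> e k) = x"
    "\<And>c k. c \<in> {..<n} \<rightarrow> Fixed \<Longrightarrow> k < n \<Longrightarrow> \<pi> k (\<Oplus>k\<in>{..<n}. c k \<otimes> e k) = c k"
proof -
  obtain Us where Us: "set Us \<subseteq> carrier M" "Span Fixed Us = carrier M" by (rule spanning_list)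
  obtain Vs where Vs: "set Vs \<subseteq> carrier M" "independent Fixed Vs" "Span Fixed Vs = Span Fixed Us"
    using filter_base[OF Fixed_subfield Us(1)] by auto
  define n where "n = length Vs"
  define e where "e k = Vs ! k" for k
  define P where "P x Ks \<longleftrightarrow> set Ks \<subseteq> Fixed \<and> length Ks = length Vs \<and> x = combine Ks Vs" for x Ks
  define \<pi> where "\<pi> k x = (THE Ks. P x Ks) ! k" for k x
  have ex1: "\<exists>!Ks. P x Ks" if "x \<in> carrier M" for x
    using unique_decomposition[OF Fixed_subfield Vs(2), of x] that Vs Us unfolding P_def by auto
  have Fc: "Fixed \<subseteq> carrier M" by (auto simp: Fixed_def)
  have comb: "combine Ks Vs = (\<Oplus>k\<in>{..<n}. Ks ! k \<otimes> e k)" if "set Ks \<subseteq> Fixed" "length Ks = n" for Ks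
    unfolding e_def n_def using that Vs(1) Fc by (intro combine_eq_finsum) (auto simp: n_def)
  show ?thesis
  proof
    show e: "e \<in> {..<n} \<rightarrow> carrier M" using Vs(1) by (auto simp: e_def n_def)
    fix x assume x: "x \<in> carrier M"
    have P: "P x (THE Ks. P x Ks)" by (rule theI'[OF ex1[OF x]])
    show "\<pi> k x \<in> Fixed" if "k < n" for k
    proof -
      have "set (THE Ks. P x Ks) \<subseteq> Fixed" "length (THE Ks. P x Ks) = n"
        using P unfolding P_def n_def by blast+
      then show ?thesis using nth_mem[of k "THE Ks. P x Ks"] that unfolding \<pi>_def by auto
    qed
    show "(\<Oplus>k\<in>{..<n}. \<pi> k x \<otimes> e k) = x"
    proof -
      have "set (THE Ks. P x Ks) \<subseteq> Fixed" "length (THE Ks. P x Ks) = n" "x = combine (THE Ks. P x Ks) Vs"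
        using P unfolding P_def n_def by blast+
      then show ?thesis using comb[of "THE Ks. P x Ks"] unfolding \<pi>_def by metis
    qed
  next
    fix c k assume c: "c \<in> {..<n} \<rightarrow> Fixed" and k: "k < n"
    let ?Ks = "map c [0..<n]" let ?x = "\<Oplus>k\<in>{..<n}. c k \<otimes> e k"
    have e: "e i \<in> carrier M" if "i < n" for i using Vs(1) that by (auto simp: e_def n_def)
    have x: "?x \<in> carrier M" using c Fc e by (intro finsum_closed) (auto simp: Pi_iff)
    have set: "set ?Ks \<subseteq> Fixed" using c by auto
    have "?x = combine ?Ks Vs"
      unfolding comb[OF set, simplified] using c Fc e by (intro finsum_cong') (auto simp: Pi_iff subset_iff)
    then have "P ?x ?Ks" using set unfolding P_def n_def by (metis length_map length_upt minus_nat.diff_0)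
    then have "(THE Ks. P ?x Ks) = ?Ks" by (rule the1_equality[OF ex1[OF x]])
    then show "\<pi> k ?x = c k" using k by (simp add: \<pi>_def)
  qed
qed

end

section \<open>A criterion for a Galois algebra to be a field\<close>

context ring_action
begin

lemma act_finprod:
  assumes "g \<in> carrier \<Gamma>" "T \<subseteq> carrier \<Gamma>" "y \<in> carrier M"
  shows "\<rho> g (\<Otimes>h\<in>T. \<rho> h y) = (\<Otimes>h\<in>(\<lambda>h. g \<otimes>\<^bsub>\<Gamma>\<^esub> h) ` T. \<rho> h y)"
proof -
  interpret r: ring_hom_cring M M "\<rho> g"
    by (intro ring_hom_cringI act_hom assms) (rule is_cring)+
  have "\<rho> g (\<Otimes>h\<in>T. \<rho> h y) = (\<Otimes>h\<in>T. \<rho> g (\<rho> h y))"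
  proof -
    have "(\<lambda>h. \<rho> h y) \<in> T \<rightarrow> carrier M" using assms by (auto simp: act_closed)
    from r.hom_finprod[OF this] show ?thesis by (simp only: comp_def)
  qed
  also have "\<dots> = (\<Otimes>h\<in>T. \<rho> (g \<otimes>\<^bsub>\<Gamma>\<^esub> h) y)"
    using assms by (intro finprod_cong') (auto simp: act_mult act_closed subset_iff)
  also have "\<dots> = (\<Otimes>h\<in>(\<lambda>h. g \<otimes>\<^bsub>\<Gamma>\<^esub> h) ` T. \<rho> h y)"
    using assms by (intro finprod_reindex[symmetric]) (auto simp: act_closed subset_iff inj_on_def)
  finally show ?thesis .
qed

text \<open>In the sum of the \<open>\<rho> g k \<otimes> \<rho> g z \<otimes> z\<close> the terms
  outside \<open>Z\<close> vanish and those in \<open>Z\<close> have the common factor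
  \<open>z \<otimes> z\<close>. It is applied to \<open>z\<close> itself and to the idempotent made
  from it.\<close>

lemma Tr_times_orthogonal:
  assumes Z: "Z \<subseteq> carrier \<Gamma>" and k: "k \<in> carrier M" and z: "z \<in> carrier M"
    and inv_e: "\<And>g. g \<in> Z \<Longrightarrow> \<rho> g z = z" and orth: "\<And>g. g \<in> carrier \<Gamma> - Z \<Longrightarrow> z \<otimes> \<rho> g z = \<zero>"
  shows "Tr (carrier \<Gamma>) (k \<otimes> z) \<otimes> z = Tr Z k \<otimes> (z \<otimes> z)"
proof -
  have finZ: "finite Z" using Z finite_\<Gamma> finite_subset by auto
  have "Tr (carrier \<Gamma>) (k \<otimes> z) \<otimes> z = (\<Oplus>g\<in>carrier \<Gamma>. \<rho> g (k \<otimes> z) \<otimes> z)"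
    unfolding Tr_def using k z finite_\<Gamma> by (intro finsum_ldistr) (auto simp: act_closed)
  also have "\<dots> = (\<Oplus>g\<in>Z. \<rho> g k \<otimes> (z \<otimes> z))"
  proof (rule add.finprod_mono_neutral_cong_right[OF finite_\<Gamma> Z])
    fix g assume g: "g \<in> carrier \<Gamma> - Z"
    have "\<rho> g (k \<otimes> z) \<otimes> z = \<rho> g k \<otimes> (z \<otimes> \<rho> g z)"
      using g k z by (simp add: act_times act_closed m_ac)
    then show "\<rho> g (k \<otimes> z) \<otimes> z = \<zero>" using g k by (simp add: orth act_closed)
  next
    fix g assume "g \<in> Z"
    then show "\<rho> g (k \<otimes> z) \<otimes> z = \<rho> g k \<otimes> (z \<otimes> z)"
      using Z k z by (simp add: act_times act_closed inv_e m_assoc subset_iff)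
  qed (use k z in \<open>auto simp: act_closed\<close>)
  also have "\<dots> = Tr Z k \<otimes> (z \<otimes> z)"
    unfolding Tr_def using k z Z finZ by (intro finsum_ldistr[symmetric]) (auto simp: act_closed)
  finally show ?thesis .
qed

end

text \<open>\<open>E\<close> is (the image of) the Galois extension and \<open>Fixed\<close> is (the image of) the enlarged base field.
  The last assumption says that the elements of \<open>Fixed\<close> that are algebraic over \<open>E \<inter> Fixed\<close> lie in \<open>E\<close>.\<close>
locale galois_algebra = galois_coords M \<Gamma> \<rho> m a b for M (structure) and \<Gamma> \<rho> m a b +
  fixes E :: "'a set"
  assumes subfield_E: "subfield E M" and subfield_Fixed: "subfield Fixed M"
    and act_E: "g \<in> carrier \<Gamma> \<Longrightarrow> x \<in> E \<Longrightarrow> \<rho> g x \<in> E"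
    and b_E: "b \<in> {..<m} \<rightarrow> E"
    and alg_closed: "h \<in> E \<Longrightarrow> u \<in> Fixed \<Longrightarrow> e \<in> carrier M \<Longrightarrow> e \<noteq> \<zero> \<Longrightarrow> h \<otimes> e = u \<otimes> e \<Longrightarrow> u \<in> E"
begin

lemma E_closed: "x \<in> E \<Longrightarrow> x \<in> carrier M"
  using subfieldE(3)[OF subfield_E] by auto

lemma Fixed_closed: "x \<in> Fixed \<Longrightarrow> x \<in> carrier M"
  by (simp add: Fixed_def)

lemma one_neq_zero: "\<one> \<noteq> \<zero>"
  using subfieldE(6)[OF subfield_E] by simp

text \<open>The ambient ring may a priori have zero divisors, but none of them lies in the subfield
  \<open>E\<close>.\<close>

lemma E_cancel: "x \<in> E \<Longrightarrow> y \<in> carrier M \<Longrightarrow> x \<otimes> y = \<zero> \<Longrightarrow> y \<noteq> \<zero> \<Longrightarrow> x = \<zero>"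
proof (rule ccontr)
  assume x: "x \<in> E" "x \<noteq> \<zero>" and y: "y \<in> carrier M" "x \<otimes> y = \<zero>" "y \<noteq> \<zero>"
  then have i: "inv x \<in> E" "inv x \<otimes> x = \<one>" using subfield_m_inv[OF subfield_E, of x] by auto
  have "y = (inv x \<otimes> x) \<otimes> y" using i y by simp
  also have "\<dots> = inv x \<otimes> (x \<otimes> y)" using i(1) x y E_closed by (simp only: m_assoc)
  finally have "y = inv x \<otimes> (x \<otimes> y)" .
  then show False using y i E_closed by simp
qed

lemma Tr_E:
  assumes "Z \<subseteq> carrier \<Gamma>" "k \<in> E"
  shows "Tr Z k \<in> E"
proof -
  have "finite Z" using assms finite_\<Gamma> finite_subset by auto
  then show ?thesis using assms(1)
  proof (induction Z rule: finite_induct)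
    case empty
    then show ?case using subringE(2)[OF subfieldE(1)[OF subfield_E]] by (simp add: Tr_def)
  next
    case (insert g Z)
    have "Tr (insert g Z) k = \<rho> g k \<oplus> Tr Z k"
      unfolding Tr_def using insert assms E_closed by (intro finsum_insert) (auto simp: act_closed)
    then show ?case
      using insert act_E assms subringE(7)[OF subfieldE(1)[OF subfield_E]] by auto
  qed
qed

lemma block_idempotent_eq_one:
  assumes e: "e \<in> carrier M" "e \<noteq> \<zero>" "e \<otimes> e = e" and Z: "Z \<subseteq> carrier \<Gamma>" "\<one>\<^bsub>\<Gamma>\<^esub> \<in> Z"
    and inv_e: "\<And>g. g \<in> Z \<Longrightarrow> \<rho> g e = e" and orth: "\<And>g. g \<in> carrier \<Gamma> - Z \<Longrightarrow> e \<otimes> \<rho> g e = \<zero>"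
  shows "e = \<one>"
proof -
  have TrZ: "Tr Z k \<in> Fixed" if k: "k \<in> E" for k
  proof -
    define h where "h = Tr Z k"
    define u where "u = Tr (carrier \<Gamma>) (k \<otimes> e)"
    have kc: "k \<in> carrier M" using k E_closed by auto
    have h: "h \<in> E" "h \<in> carrier M" using Tr_E[OF Z(1) k] E_closed by (auto simp: h_def)
    have u: "u \<in> Fixed" "u \<in> carrier M" using Tr_Fixed[of "k \<otimes> e"] kc e Fixed_closed by (auto simp: u_def)
    have ue: "u \<otimes> e = h \<otimes> e"
      using Tr_times_orthogonal[OF Z(1) kc e(1) inv_e orth] e(3) by (simp add: u_def h_def)
    then have uE: "u \<in> E" using alg_closed[OF h(1) u(1) e(1,2)] by simp
    \<comment> \<open>Both \<open>h\<close> and \<open>u\<close> lie in the field \<open>E\<close>,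
      so their difference, which annihilates the nonzero \<open>e\<close>, must be zero.\<close>
    have "h \<oplus> \<ominus> u \<in> E"
      using uE h subringE(5,7)[OF subfieldE(1)[OF subfield_E]] by auto
    moreover have "(h \<oplus> \<ominus> u) \<otimes> e = \<zero>"
      using ue h u e by (simp add: l_distr l_minus r_neg)
    ultimately have "h \<oplus> \<ominus> u = \<zero>" using E_cancel e by blast
    then have "h = u" using h u by (metis a_minus_def r_right_minus_eq)
    then show ?thesis using u by (simp add: h_def)
  qed
  \<comment> \<open>The elements \<open>Tr Z (b l)\<close> are fixed, so replacing \<open>Z\<close>
    by its translate under the inverse of \<open>g\<close> does not change the sum in
    \<open>coords_Tr\<close>. For \<open>Z\<close> the sum is one; hence the translate also contains
    the identity, which means that \<open>g\<close> lies in \<open>Z\<close>.\<close>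
  have "g \<in> Z" if g: "g \<in> carrier \<Gamma>" for g
  proof -
    let ?g = "inv\<^bsub>\<Gamma>\<^esub> g"
    let ?gZ = "(\<lambda>h. ?g \<otimes>\<^bsub>\<Gamma>\<^esub> h) ` Z"
    have gZ: "?gZ \<subseteq> carrier \<Gamma>" using g Z by auto
    have "\<one> = (\<Oplus>l\<in>{..<m}. a l \<otimes> Tr Z (b l \<otimes> \<one>))"
      using coords_Tr[OF Z(1), of \<one>] Z by simp
    also have "\<dots> = (\<Oplus>l\<in>{..<m}. a l \<otimes> Tr ?gZ (b l \<otimes> \<one>))"
    proof (rule finsum_cong')
      fix l assume l: "l \<in> {..<m}"
      then have bl: "b l \<in> E" "b l \<in> carrier M" using b_E E_closed by auto
      have "Tr Z (b l) = \<rho> ?g (Tr Z (b l))" using TrZ[OF bl(1)] g by (simp add: Fixed_def)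
      also have "\<dots> = Tr ?gZ (b l)" using g Z bl by (intro act_Tr) auto
      finally show "a l \<otimes> Tr Z (b l \<otimes> \<one>) = a l \<otimes> Tr ?gZ (b l \<otimes> \<one>)" using bl by simp
    qed (use ab gZ in \<open>auto simp: Pi_iff Tr_closed\<close>)
    also have "\<dots> = (if \<one>\<^bsub>\<Gamma>\<^esub> \<in> ?gZ then \<one> else \<zero>)"
      by (rule coords_Tr[OF gZ]) simp
    finally have "\<one>\<^bsub>\<Gamma>\<^esub> \<in> ?gZ" using one_neq_zero by metis
    then obtain h where h: "h \<in> Z" "\<one>\<^bsub>\<Gamma>\<^esub> = ?g \<otimes>\<^bsub>\<Gamma>\<^esub> h" by auto
    then have "h = g" using g Z by (metis G.inv_closed G.inv_equality G.inv_inv G.inv_comm subsetD)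
    then show ?thesis using h by simp
  qed
  \<comment> \<open>Now \<open>e\<close> is fixed by the whole group and nonzero, hence a unit; an
    idempotent unit is one.\<close>
  then have eF: "e \<in> Fixed" using e inv_e by (auto simp: Fixed_def)
  then have i: "inv e \<in> carrier M" "inv e \<otimes> e = \<one>"
    using subfield_m_inv[OF subfield_Fixed, of e] e Fixed_closed by auto
  have "e = (inv e \<otimes> e) \<otimes> e" using i e(1) by simp
  also have "\<dots> = inv e \<otimes> (e \<otimes> e)" using i(1) e(1) by (simp only: m_assoc)
  finally have "e = inv e \<otimes> (e \<otimes> e)" .
  then show ?thesis using i e by simp
qed

text \<open>A product \<open>z\<close> of conjugates of \<open>y\<close> is rescaled to an
  idempotent, which has to be one. So \<open>z\<close> is a unit, and therefore each conjugate of
  \<open>y\<close> among its factors, and \<open>y\<close> itself, is a unit.\<close>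

lemma nonzero_invertible:
  assumes y: "y \<in> carrier M" "y \<noteq> \<zero>"
  shows "\<exists>w\<in>carrier M. y \<otimes> w = \<one>"
proof -
  txt \<open>The product \<open>z\<close> of a maximal family of conjugates of \<open>y\<close> with nonzero product has the property that each
    translate of \<open>z\<close> is equal or orthogonal to \<open>z\<close>.\<close>
  let ?P = "\<lambda>T. \<Otimes>g\<in>T. \<rho> g y"
  \<comment> \<open>The empty family is excluded: its product is one, which says nothing about
    \<open>y\<close>.\<close>
  let ?A = "{T. T \<subseteq> carrier \<Gamma> \<and> T \<noteq> {} \<and> ?P T \<noteq> \<zero>}"
  have "?P {\<one>\<^bsub>\<Gamma>\<^esub>} = y" using y by (subst finprod_insert) (auto simp: act_one)
  then have "{\<one>\<^bsub>\<Gamma>\<^esub>} \<in> ?A" using y by auto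
  then have ne: "card ` ?A \<noteq> {}" by blast
  have fin: "finite (card ` ?A)" using finite_\<Gamma> by simp
  obtain T where T: "T \<in> ?A" and "card T = Max (card ` ?A)"
    using Max_in[OF fin ne] by (metis (no_types, lifting) imageE)
  then have Tmax: "\<And>T'. T' \<in> ?A \<Longrightarrow> card T' \<le> card T"
    using Max_ge[OF fin] by auto
  have T': "T \<subseteq> carrier \<Gamma>" "T \<noteq> {}" "finite T" using T finite_\<Gamma> finite_subset by auto
  define z where "z = ?P T"
  have Pc: "?P T' \<in> carrier M" if "T' \<subseteq> carrier \<Gamma>" for T'
    using that y by (intro finprod_closed) (auto simp: act_closed)
  have z: "z \<in> carrier M" "z \<noteq> \<zero>" using T Pc[OF T'(1)] by (auto simp: z_def)
  define Z where "Z = {g \<in> carrier \<Gamma>. (\<lambda>h. g \<otimes>\<^bsub>\<Gamma>\<^esub> h) ` T = T}"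
  have Z: "Z \<subseteq> carrier \<Gamma>" "\<one>\<^bsub>\<Gamma>\<^esub> \<in> Z"
    using T' by (auto simp: Z_def subset_iff image_def)
  have zfix: "\<rho> g z = z" if "g \<in> Z" for g
    using act_finprod[OF _ T'(1) y(1), of g] that by (simp add: Z_def z_def)
  \<comment> \<open>\<open>T\<close> and its translate have the same size, so if they differ their
    union is larger and has product zero by maximality. The product over the union times that over
    the intersection is \<open>z \<otimes> \<rho> g z\<close>.\<close>
  have zorth: "z \<otimes> \<rho> g z = \<zero>" if g: "g \<in> carrier \<Gamma> - Z" for g
  proof -
    let ?gT = "(\<lambda>h. g \<otimes>\<^bsub>\<Gamma>\<^esub> h) ` T"
    have gT: "?gT \<subseteq> carrier \<Gamma>" "finite ?gT" using g T' by auto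
    have "card ?gT = card T" using g T' by (intro card_image) (auto simp: inj_on_def subset_iff)
    then have "\<not> ?gT \<subseteq> T" using g T'(3) by (auto simp: Z_def dest: card_subset_eq)
    then have "card T < card (T \<union> ?gT)"
      using T' gT by (intro psubset_card_mono) auto
    then have "?P (T \<union> ?gT) = \<zero>" using Tmax[of "T \<union> ?gT"] T' gT by auto
    moreover have "?P (T \<union> ?gT) \<otimes> ?P (T \<inter> ?gT) = z \<otimes> ?P ?gT"
      unfolding z_def using T' gT y by (intro finprod_Un_Int) (auto simp: act_closed)
    moreover have "?P ?gT = \<rho> g z" unfolding z_def using act_finprod[of g T y] g T' y by simp
    ultimately show ?thesis using Pc[of "T \<inter> ?gT"] T' by (simp add: le_infI1)
  qed
  \<comment> \<open>The stabiliser is closed under translation by its elements, so traces over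
    \<open>Z\<close> are invariant under \<open>Z\<close>.\<close>
  have Zgrp: "(\<lambda>h. g \<otimes>\<^bsub>\<Gamma>\<^esub> h) ` Z = Z" if g: "g \<in> Z" for g
  proof (rule card_subset_eq)
    show "finite Z" using Z finite_\<Gamma> finite_subset by auto
    show "card ((\<lambda>h. g \<otimes>\<^bsub>\<Gamma>\<^esub> h) ` Z) = card Z"
      using g Z by (intro card_image) (auto simp: inj_on_def subset_iff)
    show "(\<lambda>h. g \<otimes>\<^bsub>\<Gamma>\<^esub> h) ` Z \<subseteq> Z"
    proof clarify
      fix h assume h: "h \<in> Z"
      have "(\<lambda>k. (g \<otimes>\<^bsub>\<Gamma>\<^esub> h) \<otimes>\<^bsub>\<Gamma>\<^esub> k) ` T = (\<lambda>k. g \<otimes>\<^bsub>\<Gamma>\<^esub> k) ` ((\<lambda>k. h \<otimes>\<^bsub>\<Gamma>\<^esub> k) ` T)"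
        unfolding image_image using g h Z T' by (intro image_cong) (auto simp: G.m_assoc subset_iff)
      then show "g \<otimes>\<^bsub>\<Gamma>\<^esub> h \<in> Z" using g h by (simp add: Z_def)
    qed
  qed
  obtain l where l: "l < m" "Tr (carrier \<Gamma>) (b l \<otimes> z) \<noteq> \<zero>" using Tr_nondegenerate[OF z] .
  define u where "u = Tr (carrier \<Gamma>) (b l \<otimes> z)"
  define h where "h = Tr Z (b l)"
  have bl: "b l \<in> E" "b l \<in> carrier M" using b_E l E_closed by auto
  have u: "u \<in> Fixed" "u \<noteq> \<zero>" "u \<in> carrier M"
    using l Tr_Fixed[of "b l \<otimes> z"] bl z Fixed_closed by (auto simp: u_def)
  have h: "h \<in> E" "h \<in> carrier M" using Tr_E[OF Z(1) bl(1)] E_closed by (auto simp: h_def)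
  have uz: "u \<otimes> z = h \<otimes> (z \<otimes> z)"
    unfolding u_def h_def by (rule Tr_times_orthogonal[OF Z(1) bl(2) z(1) zfix zorth])
  have iu: "inv u \<in> Fixed" "u \<otimes> inv u = \<one>" "inv u \<in> carrier M"
    using u subfield_m_inv[OF subfield_Fixed, of u] Fixed_closed by auto
  \<comment> \<open>From \<open>u \<otimes> z = h \<otimes> (z \<otimes> z)\<close> with
    \<open>u\<close> invertible it follows that multiplication by \<open>e\<close> fixes
    \<open>z\<close>. As \<open>e\<close> is a multiple of \<open>z\<close>, it is
    idempotent.\<close>
  define e where "e = (h \<otimes> inv u) \<otimes> z"
  have e: "e \<in> carrier M" using h iu z by (simp add: e_def)
  have ez: "e \<otimes> z = z"
  proof -
    have "e \<otimes> z = inv u \<otimes> (h \<otimes> (z \<otimes> z))" using h iu z by (simp add: e_def m_ac)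
    also have "\<dots> = (u \<otimes> inv u) \<otimes> z" unfolding uz[symmetric] using u iu(3) z by (simp add: m_ac)
    finally show ?thesis using iu z by simp
  qed
  have "e = \<one>"
  proof (rule block_idempotent_eq_one[OF e _ _ Z])
    show "e \<noteq> \<zero>" using ez z by auto
    have "e \<otimes> e = (h \<otimes> inv u) \<otimes> (e \<otimes> z)" using h iu z e by (simp add: e_def m_ac)
    then show "e \<otimes> e = e" unfolding ez by (simp only: e_def)
    fix g
    show "\<rho> g e = e" if "g \<in> Z"
    proof -
      have g: "g \<in> carrier \<Gamma>" using that Z by auto
      have "\<rho> g h = h" unfolding h_def using act_Tr[OF g Z(1) bl(2)] Zgrp[OF that] by simp
      then show ?thesis using g h iu z zfix[OF that] by (simp add: e_def act_times Fixed_def)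
    qed
    show "e \<otimes> \<rho> g e = \<zero>" if "g \<in> carrier \<Gamma> - Z"
    proof -
      have g: "g \<in> carrier \<Gamma>" using that by auto
      have c: "\<rho> g (h \<otimes> inv u) \<in> carrier M" "\<rho> g z \<in> carrier M" using g h iu z by (simp_all add: act_closed)
      have "e \<otimes> \<rho> g e = ((h \<otimes> inv u) \<otimes> z) \<otimes> (\<rho> g (h \<otimes> inv u) \<otimes> \<rho> g z)"
        unfolding e_def using g h iu z by (simp add: act_times)
      also have "\<dots> = ((h \<otimes> inv u) \<otimes> \<rho> g (h \<otimes> inv u)) \<otimes> (z \<otimes> \<rho> g z)"
        using c h iu(3) z by (simp add: m_ac)
      finally show ?thesis using zorth[OF that] c h iu by simp
    qed
  qed
  then have one: "\<one> = (h \<otimes> inv u) \<otimes> z" by (simp add: e_def)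
  obtain g where g: "g \<in> T" using T' by auto
  then have gc: "g \<in> carrier \<Gamma>" using T' by auto
  \<comment> \<open>Taking one factor \<open>\<rho> g y\<close> out of \<open>z\<close> leaves a
    cofactor that inverts it, since \<open>e = \<one>\<close>. The inverse of \<open>g\<close> then
    carries the relation back to \<open>y\<close>.\<close>
  define w where "w = (h \<otimes> inv u) \<otimes> ?P (T - {g})"
  have w: "w \<in> carrier M" using h iu Pc[of "T - {g}"] T' by (auto simp: w_def)
  have zg: "z = \<rho> g y \<otimes> ?P (T - {g})"
  proof -
    have "?P (insert g (T - {g})) = \<rho> g y \<otimes> ?P (T - {g})"
      using g T' y by (intro finprod_insert) (auto simp: act_closed subset_iff)
    then show ?thesis using g by (simp add: z_def insert_absorb)
  qed
  have "\<rho> g y \<otimes> w = \<one>"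
  proof -
    have "?P (T - {g}) \<in> carrier M" using T'(1) by (intro Pc) auto
    moreover have "\<rho> g y \<in> carrier M" using gc y by (simp add: act_closed)
    ultimately have "\<rho> g y \<otimes> w = (h \<otimes> inv u) \<otimes> (\<rho> g y \<otimes> ?P (T - {g}))"
      using h iu(3) by (simp add: w_def m_ac)
    then show ?thesis using one zg by simp
  qed
  then have "\<rho> (inv\<^bsub>\<Gamma>\<^esub> g) (\<rho> g y \<otimes> w) = \<one>" using gc by (simp add: act_1)
  then have "y \<otimes> \<rho> (inv\<^bsub>\<Gamma>\<^esub> g) w = \<one>" using gc y w by (simp add: act_times act_closed act_inv)
  then show ?thesis using gc w by (auto intro!: act_closed)
qed

theorem field_M: "field M"
  using nonzero_invertible one_neq_zero by (intro cring_fieldI2) auto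

end

section \<open>Algebras given by structure constants\<close>

text \<open>\<open>c k i j\<close> is the coefficient of the \<open>k\<close>-th basis vector in the
  product of the \<open>i\<close>-th and the \<open>j\<close>-th, and \<open>w\<close> is the
  coordinate vector of one. Coordinate lists live in the type that \<open>galois_group_over\<close>
  prescribes for extension fields.\<close>

definition sc_ring :: "('a, 'b) ring_scheme \<Rightarrow> nat \<Rightarrow> (nat \<Rightarrow> nat \<Rightarrow> nat \<Rightarrow> 'a) \<Rightarrow> (nat \<Rightarrow> 'a) \<Rightarrow> 'a list ring" where
  "sc_ring U n c w =
     \<lparr> carrier = {xs. length xs = n \<and> set xs \<subseteq> carrier U},
       monoid.mult = (\<lambda>x y. map (\<lambda>k. \<Oplus>\<^bsub>U\<^esub>i\<in>{..<n}. \<Oplus>\<^bsub>U\<^esub>j\<in>{..<n}. (x ! i \<otimes>\<^bsub>U\<^esub> y ! j) \<otimes>\<^bsub>U\<^esub> c k i j) [0..<n]),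
       one = map w [0..<n],
       ring.zero = map (\<lambda>k. \<zero>\<^bsub>U\<^esub>) [0..<n],
       ring.add = (\<lambda>x y. map (\<lambda>k. x ! k \<oplus>\<^bsub>U\<^esub> y ! k) [0..<n]) \<rparr>"

definition sc_act :: "('a, 'b) ring_scheme \<Rightarrow> nat \<Rightarrow> (nat \<Rightarrow> nat \<Rightarrow> 'a) \<Rightarrow> 'a list \<Rightarrow> 'a list" where
  "sc_act U n r x = map (\<lambda>k. \<Oplus>\<^bsub>U\<^esub>i\<in>{..<n}. x ! i \<otimes>\<^bsub>U\<^esub> r k i) [0..<n]"

definition sc_emb :: "('a, 'b) ring_scheme \<Rightarrow> nat \<Rightarrow> (nat \<Rightarrow> 'a) \<Rightarrow> 'a \<Rightarrow> 'a list" where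
  "sc_emb U n w u = map (\<lambda>k. u \<otimes>\<^bsub>U\<^esub> w k) [0..<n]"

lemma (in abelian_monoid) finsum_product:
  assumes "finite A" "finite B" "\<And>i j. i \<in> A \<Longrightarrow> j \<in> B \<Longrightarrow> f i j \<in> carrier G"
  shows "(\<Oplus>i\<in>A. \<Oplus>j\<in>B. f i j) = (\<Oplus>p\<in>A \<times> B. f (fst p) (snd p))"
  using assms
proof (induction A rule: finite_induct)
  case empty
  then show ?case by simp
next
  case (insert a A)
  have "(\<Oplus>p\<in>insert a A \<times> B. f (fst p) (snd p)) = (\<Oplus>p\<in>(Pair a ` B) \<union> A \<times> B. f (fst p) (snd p))"
    by (rule arg_cong[where f = "finsum G _"]) auto
  also have "\<dots> = (\<Oplus>p\<in>Pair a ` B. f (fst p) (snd p)) \<oplus> (\<Oplus>p\<in>A \<times> B. f (fst p) (snd p))"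
    using insert by (intro finsum_Un_disjoint) auto
  also have "(\<Oplus>p\<in>Pair a ` B. f (fst p) (snd p)) = (\<Oplus>j\<in>B. f a j)"
    using insert by (subst finsum_reindex) (auto simp: inj_on_def)
  finally show ?case
    using insert by (subst finsum_insert) (auto simp: Pi_iff intro!: finsum_closed)
qed

section \<open>Base change of a Galois extension\<close>

text \<open>The base field is represented by \<open>Fixed\<close> inside \<open>H\<close>, and
  \<open>\<theta>\<close> embeds it in \<open>U\<close>. The last assumption is the relative
  algebraic closedness that makes the tensor product a field.\<close>

locale base_change = field_action H \<Gamma> \<rho> + U: field U
  for H :: "('h, 'c) ring_scheme" (structure) and \<Gamma> :: "('g, 'm) monoid_scheme" and \<rho>
    and U :: "('u, 'd) ring_scheme" +
  fixes \<theta> :: "'h \<Rightarrow> 'u" and n :: nat and e :: "nat \<Rightarrow> 'h" and \<pi> :: "nat \<Rightarrow> 'h \<Rightarrow> 'h"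
  assumes \<theta>: "\<theta> \<in> ring_hom (H\<lparr>carrier := Fixed\<rparr>) U"
    and e: "k < n \<Longrightarrow> e k \<in> carrier H"
    and \<pi>: "k < n \<Longrightarrow> x \<in> carrier H \<Longrightarrow> \<pi> k x \<in> Fixed"
    and expand: "x \<in> carrier H \<Longrightarrow> (\<Oplus>k\<in>{..<n}. \<pi> k x \<otimes> e k) = x"
    and unique: "c \<in> {..<n} \<rightarrow> Fixed \<Longrightarrow> k < n \<Longrightarrow> \<pi> k (\<Oplus>k\<in>{..<n}. c k \<otimes> e k) = c k"
    and rel_closed: "u \<in> carrier U \<Longrightarrow> set p \<subseteq> Fixed \<Longrightarrow> p \<noteq> [] \<Longrightarrow> hd p \<noteq> \<zero> \<Longrightarrow>
      U.eval (map \<theta> p) u = \<zero>\<^bsub>U\<^esub> \<Longrightarrow> u \<in> \<theta> ` Fixed"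
begin

lemma Fixed_ops: "x \<in> Fixed \<Longrightarrow> y \<in> Fixed \<Longrightarrow> x \<oplus> y \<in> Fixed" "x \<in> Fixed \<Longrightarrow> y \<in> Fixed \<Longrightarrow> x \<otimes> y \<in> Fixed"
  "\<zero> \<in> Fixed" "\<one> \<in> Fixed" "x \<in> Fixed \<Longrightarrow> x \<in> carrier H"
  using subringE[OF subfieldE(1)[OF Fixed_subfield]] by auto

lemma \<theta>_closed: "x \<in> Fixed \<Longrightarrow> \<theta> x \<in> carrier U"
  and \<theta>_add: "x \<in> Fixed \<Longrightarrow> y \<in> Fixed \<Longrightarrow> \<theta> (x \<oplus> y) = \<theta> x \<oplus>\<^bsub>U\<^esub> \<theta> y"
  and \<theta>_mult: "x \<in> Fixed \<Longrightarrow> y \<in> Fixed \<Longrightarrow> \<theta> (x \<otimes> y) = \<theta> x \<otimes>\<^bsub>U\<^esub> \<theta> y"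
  and \<theta>_one: "\<theta> \<one> = \<one>\<^bsub>U\<^esub>"
  using ring_hom_memE[OF \<theta>] by auto

lemma \<theta>_zero: "\<theta> \<zero> = \<zero>\<^bsub>U\<^esub>"
  using \<theta>_add[of \<zero> \<zero>] \<theta>_closed[of \<zero>] Fixed_ops by (simp add: U.add.l_cancel_one)

lemma \<theta>_finsum:
  assumes "finite A" "\<And>i. i \<in> A \<Longrightarrow> f i \<in> Fixed"
  shows "(\<Oplus>i\<in>A. f i) \<in> Fixed" "\<theta> (\<Oplus>i\<in>A. f i) = (\<Oplus>\<^bsub>U\<^esub>i\<in>A. \<theta> (f i))"
  using assms
proof (induction A rule: finite_induct)
  case empty
  { case 1 show ?case using Fixed_ops by simp }
  { case 2 show ?case using \<theta>_zero by simp }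
next
  case (insert a A)
  have *: "(\<Oplus>i\<in>insert a A. f i) = f a \<oplus> (\<Oplus>i\<in>A. f i)" if "\<And>i. i \<in> insert a A \<Longrightarrow> f i \<in> Fixed"
    using insert that Fixed_ops(5) by (intro finsum_insert) auto
  { case 1 then show ?case using * insert Fixed_ops by auto }
  { case 2 then show ?case using * insert Fixed_ops
      by (subst U.finsum_insert) (auto simp: \<theta>_add \<theta>_closed) }
qed

text \<open>Functionals on \<open>H\<close> over the fixed field. Coordinates composed with a
  multiplication or with the action are again of this kind, which covers all structure
  constants.\<close>

definition lin :: "('h \<Rightarrow> 'h) \<Rightarrow> bool" where
  "lin f \<longleftrightarrow> (\<forall>x\<in>carrier H. f x \<in> Fixed) \<and> (\<forall>x\<in>carrier H. \<forall>y\<in>carrier H. f (x \<oplus> y) = f x \<oplus> f y) \<and>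
     (\<forall>c\<in>Fixed. \<forall>x\<in>carrier H. f (c \<otimes> x) = c \<otimes> f x)"

lemma lin_closed: "lin f \<Longrightarrow> x \<in> carrier H \<Longrightarrow> f x \<in> Fixed"
  and lin_add: "lin f \<Longrightarrow> x \<in> carrier H \<Longrightarrow> y \<in> carrier H \<Longrightarrow> f (x \<oplus> y) = f x \<oplus> f y"
  and lin_smult: "lin f \<Longrightarrow> c \<in> Fixed \<Longrightarrow> x \<in> carrier H \<Longrightarrow> f (c \<otimes> x) = c \<otimes> f x"
  by (simp_all add: lin_def)

lemma lin_finsum:
  assumes "lin f" "finite A" "\<And>i. i \<in> A \<Longrightarrow> x i \<in> carrier H"
  shows "f (\<Oplus>i\<in>A. x i) = (\<Oplus>i\<in>A. f (x i))"
  using assms(2,3)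
proof (induction A rule: finite_induct)
  case empty
  show ?case using lin_smult[OF assms(1), of \<zero> \<zero>] lin_closed[OF assms(1), of \<zero>] Fixed_ops by simp
next
  case (insert a A)
  then show ?case
    using lin_closed[OF assms(1)] Fixed_ops(5)
    by (simp add: finsum_insert Pi_iff lin_add[OF assms(1)] finsum_closed)
qed

lemma \<pi>_lin:
  assumes k: "k < n"
  shows "lin (\<pi> k)"
  unfolding lin_def
proof (intro conjI ballI)
  fix x y assume x: "x \<in> carrier H" and y: "y \<in> carrier H"
  have "x \<oplus> y = (\<Oplus>k\<in>{..<n}. \<pi> k x \<otimes> e k) \<oplus> (\<Oplus>k\<in>{..<n}. \<pi> k y \<otimes> e k)"
    using expand x y by simp
  also have "\<dots> = (\<Oplus>k\<in>{..<n}. \<pi> k x \<otimes> e k \<oplus> \<pi> k y \<otimes> e k)"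
    using x y \<pi> e Fixed_ops(5) by (intro finsum_addf[symmetric]) auto
  also have "\<dots> = (\<Oplus>k\<in>{..<n}. (\<pi> k x \<oplus> \<pi> k y) \<otimes> e k)"
    using x y \<pi> e Fixed_ops(5) by (intro finsum_cong') (auto simp: l_distr)
  finally show "\<pi> k (x \<oplus> y) = \<pi> k x \<oplus> \<pi> k y"
    using unique[of "\<lambda>k. \<pi> k x \<oplus> \<pi> k y" k] x y k \<pi> Fixed_ops by simp
next
  fix c x assume c: "c \<in> Fixed" and x: "x \<in> carrier H"
  have "c \<otimes> x = c \<otimes> (\<Oplus>k\<in>{..<n}. \<pi> k x \<otimes> e k)" using expand x by simp
  also have "\<dots> = (\<Oplus>k\<in>{..<n}. c \<otimes> (\<pi> k x \<otimes> e k))"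
    using x \<pi> e Fixed_ops(5) c by (intro finsum_rdistr) auto
  also have "\<dots> = (\<Oplus>k\<in>{..<n}. (c \<otimes> \<pi> k x) \<otimes> e k)"
    using x \<pi> e Fixed_ops(5) c by (intro finsum_cong') (auto simp: m_assoc)
  finally show "\<pi> k (c \<otimes> x) = c \<otimes> \<pi> k x"
    using unique[of "\<lambda>k. c \<otimes> \<pi> k x" k] x c k \<pi> Fixed_ops by simp
qed (use \<pi> k in auto)

lemma lin_compose_mult:
  assumes f: "lin f" and h: "h \<in> carrier H"
  shows "lin (\<lambda>x. f (x \<otimes> h))" "lin (\<lambda>x. f (h \<otimes> x))"
proof -
  show "lin (\<lambda>x. f (x \<otimes> h))"
    using h lin_closed[OF f] lin_add[OF f] lin_smult[OF f] Fixed_ops(5)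
    unfolding lin_def by (simp add: l_distr m_assoc)
  show "lin (\<lambda>x. f (h \<otimes> x))"
    using h lin_closed[OF f] lin_add[OF f] lin_smult[OF f] Fixed_ops(5)
    unfolding lin_def by (simp add: r_distr m_lcomm)
qed

lemma lin_compose_act: "lin f \<Longrightarrow> g \<in> carrier \<Gamma> \<Longrightarrow> lin (\<lambda>x. f (\<rho> g x))"
proof -
  assume f: "lin f" and g: "g \<in> carrier \<Gamma>"
  have "\<rho> g (c \<otimes> x) = c \<otimes> \<rho> g x" if "c \<in> Fixed" "x \<in> carrier H" for c x
    using that g by (simp add: act_times Fixed_def)
  then show ?thesis
    using f g unfolding lin_def by (simp add: act_closed act_add)
qed

text \<open>\<open>f\<close> is determined by its values on the basis, and \<open>\<theta>\<close>
  carries this expansion into \<open>U\<close>.\<close>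

lemma lin_expand:
  assumes f: "lin f" and h: "h \<in> carrier H"
  shows "(\<Oplus>\<^bsub>U\<^esub>k\<in>{..<n}. \<theta> (\<pi> k h) \<otimes>\<^bsub>U\<^esub> \<theta> (f (e k))) = \<theta> (f h)"
proof -
  have "f h = f (\<Oplus>k\<in>{..<n}. \<pi> k h \<otimes> e k)" using expand[OF h] by simp
  also have "\<dots> = (\<Oplus>k\<in>{..<n}. f (\<pi> k h \<otimes> e k))"
    using h e \<pi> Fixed_ops(5) by (intro lin_finsum[OF f]) auto
  also have "\<dots> = (\<Oplus>k\<in>{..<n}. \<pi> k h \<otimes> f (e k))"
    using h e \<pi> lin_closed[OF f] Fixed_ops(5) by (intro finsum_cong') (auto simp: lin_smult[OF f])
  finally have "\<theta> (f h) = (\<Oplus>\<^bsub>U\<^esub>k\<in>{..<n}. \<theta> (\<pi> k h \<otimes> f (e k)))"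
    using h e \<pi> lin_closed[OF f] by (simp only:) (intro \<theta>_finsum(2), auto intro: Fixed_ops(2))
  also have "\<dots> = (\<Oplus>\<^bsub>U\<^esub>k\<in>{..<n}. \<theta> (\<pi> k h) \<otimes>\<^bsub>U\<^esub> \<theta> (f (e k)))"
    using h e \<pi> lin_closed[OF f] by (intro U.finsum_cong') (auto simp: \<theta>_mult \<theta>_closed)
  finally show ?thesis by simp
qed

definition "str_const k i j = \<theta> (\<pi> k (e i \<otimes> e j))"
definition "unit_const k = \<theta> (\<pi> k \<one>)"
definition "act_const g k i = \<theta> (\<pi> k (\<rho> g (e i)))"

abbreviation "T \<equiv> sc_ring U n str_const unit_const"
abbreviation "act g \<equiv> sc_act U n (act_const g)"
abbreviation "scal \<equiv> sc_emb U n unit_const"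

text \<open>\<open>vec P t h\<close> is the element \<open>\<Sum>\<^sub>p t\<^sub>p \<otimes> h\<^sub>p\<close> of the tensor product of \<open>U\<close> and \<open>H\<close>.\<close>
definition vec :: "'p set \<Rightarrow> ('p \<Rightarrow> 'u) \<Rightarrow> ('p \<Rightarrow> 'h) \<Rightarrow> 'u list" where
  "vec P t h = map (\<lambda>k. \<Oplus>\<^bsub>U\<^esub>p\<in>P. t p \<otimes>\<^bsub>U\<^esub> \<theta> (\<pi> k (h p))) [0..<n]"

lemma lin\<theta>_closed: "lin f \<Longrightarrow> x \<in> carrier H \<Longrightarrow> \<theta> (f x) \<in> carrier U"
  by (simp add: lin_closed \<theta>_closed)

lemma vec_nth: "k < n \<Longrightarrow> vec P t h ! k = (\<Oplus>\<^bsub>U\<^esub>p\<in>P. t p \<otimes>\<^bsub>U\<^esub> \<theta> (\<pi> k (h p)))"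
  by (simp add: vec_def)

lemma vec_closed:
  assumes "t \<in> P \<rightarrow> carrier U" "h \<in> P \<rightarrow> carrier H"
  shows "vec P t h \<in> carrier T"
  using assms by (auto simp: vec_def sc_ring_def Pi_iff \<pi> \<theta>_closed intro!: U.finsum_closed)

lemma carrierT_nth: "x \<in> carrier T \<Longrightarrow> i < n \<Longrightarrow> x ! i \<in> carrier U"
  by (auto simp: sc_ring_def)

lemma carrierT_length: "x \<in> carrier T \<Longrightarrow> length x = n"
  by (auto simp: sc_ring_def)

text \<open>The left side is the \<open>U\<close>-linear extension of \<open>f\<close> to the tensor
  product, evaluated through coordinates. That it is computed termwise on any sum of tensors is the
  source of the rules for products and for the action.\<close>

lemma fhat_vec:
  assumes f: "lin f" and P: "finite P" and t: "t \<in> P \<rightarrow> carrier U" and h: "h \<in> P \<rightarrow> carrier H"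
  shows "(\<Oplus>\<^bsub>U\<^esub>k\<in>{..<n}. vec P t h ! k \<otimes>\<^bsub>U\<^esub> \<theta> (f (e k))) = (\<Oplus>\<^bsub>U\<^esub>p\<in>P. t p \<otimes>\<^bsub>U\<^esub> \<theta> (f (h p)))"
proof -
  have c: "t p \<in> carrier U" "h p \<in> carrier H" if "p \<in> P" for p using t h that by auto
  have d: "\<theta> (\<pi> k (h p)) \<in> carrier U" "\<theta> (f (e k)) \<in> carrier U" if "k < n" "p \<in> P" for k p
    using c that \<pi> \<theta>_closed lin_closed[OF f] e by auto
  have d': "\<theta> (f (e k)) \<in> carrier U" if "k < n" for k
    using that \<theta>_closed lin_closed[OF f] e by auto
  have "(\<Oplus>\<^bsub>U\<^esub>k\<in>{..<n}. vec P t h ! k \<otimes>\<^bsub>U\<^esub> \<theta> (f (e k))) =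
    (\<Oplus>\<^bsub>U\<^esub>k\<in>{..<n}. \<Oplus>\<^bsub>U\<^esub>p\<in>P. t p \<otimes>\<^bsub>U\<^esub> (\<theta> (\<pi> k (h p)) \<otimes>\<^bsub>U\<^esub> \<theta> (f (e k))))"
  proof (rule U.finsum_cong')
    fix k assume k: "k \<in> {..<n}"
    have "vec P t h ! k \<otimes>\<^bsub>U\<^esub> \<theta> (f (e k)) = (\<Oplus>\<^bsub>U\<^esub>p\<in>P. (t p \<otimes>\<^bsub>U\<^esub> \<theta> (\<pi> k (h p))) \<otimes>\<^bsub>U\<^esub> \<theta> (f (e k)))"
      using k c d d' P by (simp add: vec_nth U.finsum_ldistr Pi_iff)
    also have "\<dots> = (\<Oplus>\<^bsub>U\<^esub>p\<in>P. t p \<otimes>\<^bsub>U\<^esub> (\<theta> (\<pi> k (h p)) \<otimes>\<^bsub>U\<^esub> \<theta> (f (e k))))"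
      using k c d by (intro U.finsum_cong') (auto simp: U.m_assoc)
    finally show "vec P t h ! k \<otimes>\<^bsub>U\<^esub> \<theta> (f (e k)) = (\<Oplus>\<^bsub>U\<^esub>p\<in>P. t p \<otimes>\<^bsub>U\<^esub> (\<theta> (\<pi> k (h p)) \<otimes>\<^bsub>U\<^esub> \<theta> (f (e k))))" .
  qed (use c d in \<open>auto simp: Pi_iff intro!: U.finsum_closed\<close>)
  also have "\<dots> = (\<Oplus>\<^bsub>U\<^esub>p\<in>P. \<Oplus>\<^bsub>U\<^esub>k\<in>{..<n}. t p \<otimes>\<^bsub>U\<^esub> (\<theta> (\<pi> k (h p)) \<otimes>\<^bsub>U\<^esub> \<theta> (f (e k))))"
    using c d P by (intro U.finsum_swap) auto
  also have "\<dots> = (\<Oplus>\<^bsub>U\<^esub>p\<in>P. t p \<otimes>\<^bsub>U\<^esub> \<theta> (f (h p)))"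
  proof (rule U.finsum_cong')
    fix p assume p: "p \<in> P"
    have "(\<Oplus>\<^bsub>U\<^esub>k\<in>{..<n}. t p \<otimes>\<^bsub>U\<^esub> (\<theta> (\<pi> k (h p)) \<otimes>\<^bsub>U\<^esub> \<theta> (f (e k)))) =
      t p \<otimes>\<^bsub>U\<^esub> (\<Oplus>\<^bsub>U\<^esub>k\<in>{..<n}. \<theta> (\<pi> k (h p)) \<otimes>\<^bsub>U\<^esub> \<theta> (f (e k)))"
      using p c d by (intro U.finsum_rdistr[symmetric]) auto
    then show "(\<Oplus>\<^bsub>U\<^esub>k\<in>{..<n}. t p \<otimes>\<^bsub>U\<^esub> (\<theta> (\<pi> k (h p)) \<otimes>\<^bsub>U\<^esub> \<theta> (f (e k)))) = t p \<otimes>\<^bsub>U\<^esub> \<theta> (f (h p))"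
      using lin_expand[OF f c(2)[OF p]] by simp
  qed (use c lin\<theta>_closed[OF f] in auto)
  finally show ?thesis .
qed

lemma \<pi>_e: "k < n \<Longrightarrow> i < n \<Longrightarrow> \<pi> k (e i) = (if k = i then \<one> else \<zero>)"
proof -
  assume ki: "k < n" "i < n"
  have "(\<Oplus>k\<in>{..<n}. (if k = i then \<one> else \<zero>) \<otimes> e k) = (\<Oplus>k\<in>{..<n}. if k = i then e k else \<zero>)"
    using e by (intro finsum_cong') auto
  also have "\<dots> = e i" using ki e by (intro finsum_delta) auto
  finally have "(\<Oplus>k\<in>{..<n}. (if k = i then \<one> else \<zero>) \<otimes> e k) = e i" .
  then show ?thesis using unique[of "\<lambda>k. if k = i then \<one> else \<zero>" k] ki Fixed_ops by auto
qed

text \<open>Every element of the algebra is a sum of tensors, so multiplicative identities need only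
  be checked on expressions \<open>vec P t h\<close>.\<close>

lemma vec_basis:
  assumes x: "x \<in> carrier T"
  shows "vec {..<n} (\<lambda>i. x ! i) e = x"
proof (rule nth_equalityI)
  show "length (vec {..<n} (\<lambda>i. x ! i) e) = length x" using x by (simp add: vec_def carrierT_length)
  fix k assume "k < length (vec {..<n} (\<lambda>i. x ! i) e)"
  then have k: "k < n" by (simp add: vec_def)
  have "vec {..<n} (\<lambda>i. x ! i) e ! k = (\<Oplus>\<^bsub>U\<^esub>i\<in>{..<n}. if i = k then x ! i else \<zero>\<^bsub>U\<^esub>)"
    unfolding vec_nth[OF k] using k x
    by (intro U.finsum_cong') (auto simp: \<pi>_e \<theta>_one \<theta>_zero carrierT_nth)
  also have "\<dots> = x ! k" using k x by (intro U.finsum_delta) (auto simp: carrierT_nth)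
  finally show "vec {..<n} (\<lambda>i. x ! i) e ! k = x ! k" .
qed

text \<open>With the identity as \<open>\<phi>\<close> this is a congruence rule; with the swap and
  the reassociation of pairs it gives commutativity and associativity.\<close>

lemma vec_reindex:
  assumes "bij_betw \<phi> P Q" "t \<in> Q \<rightarrow> carrier U" "h \<in> Q \<rightarrow> carrier H"
    "\<And>p. p \<in> P \<Longrightarrow> t' p = t (\<phi> p)" "\<And>p. p \<in> P \<Longrightarrow> h' p = h (\<phi> p)"
  shows "vec Q t h = vec P t' h'"
proof -
  have Q: "Q = \<phi> ` P" "inj_on \<phi> P" using assms(1) by (auto simp: bij_betw_def)
  have "(\<Oplus>\<^bsub>U\<^esub>p\<in>Q. t p \<otimes>\<^bsub>U\<^esub> \<theta> (\<pi> k (h p))) = (\<Oplus>\<^bsub>U\<^esub>p\<in>P. t' p \<otimes>\<^bsub>U\<^esub> \<theta> (\<pi> k (h' p)))" if "k < n" for k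
  proof -
    have "(\<Oplus>\<^bsub>U\<^esub>p\<in>Q. t p \<otimes>\<^bsub>U\<^esub> \<theta> (\<pi> k (h p))) = (\<Oplus>\<^bsub>U\<^esub>p\<in>P. t (\<phi> p) \<otimes>\<^bsub>U\<^esub> \<theta> (\<pi> k (h (\<phi> p))))"
      unfolding Q(1) using assms(2,3) that Q
      by (intro U.finsum_reindex) (auto simp: Pi_iff \<pi> \<theta>_closed)
    also have "\<dots> = (\<Oplus>\<^bsub>U\<^esub>p\<in>P. t' p \<otimes>\<^bsub>U\<^esub> \<theta> (\<pi> k (h' p)))"
      using assms that Q by (intro U.finsum_cong') (auto simp: Pi_iff \<pi> \<theta>_closed)
    finally show ?thesis .
  qed
  then show ?thesis by (auto simp: vec_def)
qed

text \<open>\<open>fhat_vec\<close> is applied twice: to \<open>\<pi> k\<close> after multiplication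
  by \<open>e i\<close> for the second factor, and to \<open>\<pi> k\<close> after multiplication by
  \<open>h' q\<close> for the first. Ring axioms then come from \<open>U\<close> and
  \<open>H\<close> instead of identities between structure constants.\<close>

lemma vec_mult:
  assumes P: "finite P" "t \<in> P \<rightarrow> carrier U" "h \<in> P \<rightarrow> carrier H"
    and Q: "finite Q" "t' \<in> Q \<rightarrow> carrier U" "h' \<in> Q \<rightarrow> carrier H"
  shows "vec P t h \<otimes>\<^bsub>T\<^esub> vec Q t' h' = vec (P \<times> Q) (\<lambda>p. t (fst p) \<otimes>\<^bsub>U\<^esub> t' (snd p)) (\<lambda>p. h (fst p) \<otimes> h' (snd p))"
proof -
  have "(\<Oplus>\<^bsub>U\<^esub>i\<in>{..<n}. \<Oplus>\<^bsub>U\<^esub>j\<in>{..<n}. (vec P t h ! i \<otimes>\<^bsub>U\<^esub> vec Q t' h' ! j) \<otimes>\<^bsub>U\<^esub> str_const k i j) =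
      (\<Oplus>\<^bsub>U\<^esub>p\<in>P \<times> Q. (t (fst p) \<otimes>\<^bsub>U\<^esub> t' (snd p)) \<otimes>\<^bsub>U\<^esub> \<theta> (\<pi> k (h (fst p) \<otimes> h' (snd p))))" if k: "k < n" for k
  proof -
    note x = carrierT_nth[OF vec_closed[OF P(2,3)]] and y = carrierT_nth[OF vec_closed[OF Q(2,3)]]
    have hc: "h p \<in> carrier H" "t p \<in> carrier U" if "p \<in> P" for p using that P by auto
    have hc': "h' p \<in> carrier H" "t' p \<in> carrier U" if "p \<in> Q" for p using that Q by auto
    note \<theta>\<pi> = lin\<theta>_closed[OF \<pi>_lin[OF k]]
    have "(\<Oplus>\<^bsub>U\<^esub>i\<in>{..<n}. \<Oplus>\<^bsub>U\<^esub>j\<in>{..<n}. (vec P t h ! i \<otimes>\<^bsub>U\<^esub> vec Q t' h' ! j) \<otimes>\<^bsub>U\<^esub> str_const k i j) =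
      (\<Oplus>\<^bsub>U\<^esub>i\<in>{..<n}. \<Oplus>\<^bsub>U\<^esub>q\<in>Q. t' q \<otimes>\<^bsub>U\<^esub> (vec P t h ! i \<otimes>\<^bsub>U\<^esub> \<theta> (\<pi> k (e i \<otimes> h' q))))"
    proof (rule U.finsum_cong')
      fix i assume i: "i \<in> {..<n}"
      have ei: "e i \<in> carrier H" using i e by auto
      have "(\<Oplus>\<^bsub>U\<^esub>j\<in>{..<n}. (vec P t h ! i \<otimes>\<^bsub>U\<^esub> vec Q t' h' ! j) \<otimes>\<^bsub>U\<^esub> str_const k i j) =
        (\<Oplus>\<^bsub>U\<^esub>j\<in>{..<n}. vec P t h ! i \<otimes>\<^bsub>U\<^esub> (vec Q t' h' ! j \<otimes>\<^bsub>U\<^esub> \<theta> (\<pi> k (e i \<otimes> e j))))"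
        using i x y e by (intro U.finsum_cong') (auto simp: str_const_def U.m_assoc \<theta>\<pi>)
      also have "\<dots> = vec P t h ! i \<otimes>\<^bsub>U\<^esub> (\<Oplus>\<^bsub>U\<^esub>j\<in>{..<n}. vec Q t' h' ! j \<otimes>\<^bsub>U\<^esub> \<theta> (\<pi> k (e i \<otimes> e j)))"
        using i x y e by (intro U.finsum_rdistr[symmetric]) (auto simp: \<theta>\<pi>)
      also have "\<dots> = vec P t h ! i \<otimes>\<^bsub>U\<^esub> (\<Oplus>\<^bsub>U\<^esub>q\<in>Q. t' q \<otimes>\<^bsub>U\<^esub> \<theta> (\<pi> k (e i \<otimes> h' q)))"
        using fhat_vec[OF lin_compose_mult(2)[OF \<pi>_lin[OF k] ei] Q] by simp
      also have "\<dots> = (\<Oplus>\<^bsub>U\<^esub>q\<in>Q. vec P t h ! i \<otimes>\<^bsub>U\<^esub> (t' q \<otimes>\<^bsub>U\<^esub> \<theta> (\<pi> k (e i \<otimes> h' q))))"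
        using i x e Q hc' by (intro U.finsum_rdistr) (auto simp: \<theta>\<pi>)
      also have "\<dots> = (\<Oplus>\<^bsub>U\<^esub>q\<in>Q. t' q \<otimes>\<^bsub>U\<^esub> (vec P t h ! i \<otimes>\<^bsub>U\<^esub> \<theta> (\<pi> k (e i \<otimes> h' q))))"
        using i x e hc' by (intro U.finsum_cong') (auto simp: \<theta>\<pi> U.m_lcomm)
      finally show "(\<Oplus>\<^bsub>U\<^esub>j\<in>{..<n}. (vec P t h ! i \<otimes>\<^bsub>U\<^esub> vec Q t' h' ! j) \<otimes>\<^bsub>U\<^esub> str_const k i j) =
        (\<Oplus>\<^bsub>U\<^esub>q\<in>Q. t' q \<otimes>\<^bsub>U\<^esub> (vec P t h ! i \<otimes>\<^bsub>U\<^esub> \<theta> (\<pi> k (e i \<otimes> h' q))))" .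
    qed (use x e hc' in \<open>auto simp: \<theta>\<pi> Pi_iff intro!: U.finsum_closed\<close>)
    also have "\<dots> = (\<Oplus>\<^bsub>U\<^esub>q\<in>Q. \<Oplus>\<^bsub>U\<^esub>i\<in>{..<n}. t' q \<otimes>\<^bsub>U\<^esub> (vec P t h ! i \<otimes>\<^bsub>U\<^esub> \<theta> (\<pi> k (e i \<otimes> h' q))))"
      using x e hc' Q by (intro U.finsum_swap) (auto simp: \<theta>\<pi>)
    also have "\<dots> = (\<Oplus>\<^bsub>U\<^esub>q\<in>Q. \<Oplus>\<^bsub>U\<^esub>p\<in>P. (t p \<otimes>\<^bsub>U\<^esub> t' q) \<otimes>\<^bsub>U\<^esub> \<theta> (\<pi> k (h p \<otimes> h' q)))"
    proof (rule U.finsum_cong')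
      fix q assume q: "q \<in> Q"
      have "(\<Oplus>\<^bsub>U\<^esub>i\<in>{..<n}. t' q \<otimes>\<^bsub>U\<^esub> (vec P t h ! i \<otimes>\<^bsub>U\<^esub> \<theta> (\<pi> k (e i \<otimes> h' q)))) =
        t' q \<otimes>\<^bsub>U\<^esub> (\<Oplus>\<^bsub>U\<^esub>i\<in>{..<n}. vec P t h ! i \<otimes>\<^bsub>U\<^esub> \<theta> (\<pi> k (e i \<otimes> h' q)))"
        using x e hc'[OF q] by (intro U.finsum_rdistr[symmetric]) (auto simp: \<theta>\<pi>)
      also have "\<dots> = t' q \<otimes>\<^bsub>U\<^esub> (\<Oplus>\<^bsub>U\<^esub>p\<in>P. t p \<otimes>\<^bsub>U\<^esub> \<theta> (\<pi> k (h p \<otimes> h' q)))"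
        using fhat_vec[OF lin_compose_mult(1)[OF \<pi>_lin[OF k] hc'(1)[OF q]] P] by simp
      also have "\<dots> = (\<Oplus>\<^bsub>U\<^esub>p\<in>P. t' q \<otimes>\<^bsub>U\<^esub> (t p \<otimes>\<^bsub>U\<^esub> \<theta> (\<pi> k (h p \<otimes> h' q))))"
        using hc hc'[OF q] P by (intro U.finsum_rdistr) (auto simp: \<theta>\<pi>)
      also have "\<dots> = (\<Oplus>\<^bsub>U\<^esub>p\<in>P. (t p \<otimes>\<^bsub>U\<^esub> t' q) \<otimes>\<^bsub>U\<^esub> \<theta> (\<pi> k (h p \<otimes> h' q)))"
        using hc hc'[OF q] by (intro U.finsum_cong') (auto simp: \<theta>\<pi> U.m_ac)
      finally show "(\<Oplus>\<^bsub>U\<^esub>i\<in>{..<n}. t' q \<otimes>\<^bsub>U\<^esub> (vec P t h ! i \<otimes>\<^bsub>U\<^esub> \<theta> (\<pi> k (e i \<otimes> h' q)))) =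
        (\<Oplus>\<^bsub>U\<^esub>p\<in>P. (t p \<otimes>\<^bsub>U\<^esub> t' q) \<otimes>\<^bsub>U\<^esub> \<theta> (\<pi> k (h p \<otimes> h' q)))" .
    qed (use hc hc' in \<open>auto simp: \<theta>\<pi> Pi_iff intro!: U.finsum_closed\<close>)
    also have "\<dots> = (\<Oplus>\<^bsub>U\<^esub>p\<in>P. \<Oplus>\<^bsub>U\<^esub>q\<in>Q. (t p \<otimes>\<^bsub>U\<^esub> t' q) \<otimes>\<^bsub>U\<^esub> \<theta> (\<pi> k (h p \<otimes> h' q)))"
      using hc hc' P Q by (intro U.finsum_swap) (auto simp: \<theta>\<pi>)
    also have "\<dots> = (\<Oplus>\<^bsub>U\<^esub>p\<in>P \<times> Q. (t (fst p) \<otimes>\<^bsub>U\<^esub> t' (snd p)) \<otimes>\<^bsub>U\<^esub> \<theta> (\<pi> k (h (fst p) \<otimes> h' (snd p))))"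
      using hc hc' P Q by (intro U.finsum_product) (auto simp: \<theta>\<pi>)
    finally show ?thesis .
  qed
  then show ?thesis by (auto simp: vec_def[of "P \<times> Q"] sc_ring_def)
qed

lemma vec_act:
  assumes "finite P" "t \<in> P \<rightarrow> carrier U" "h \<in> P \<rightarrow> carrier H" and g: "g \<in> carrier \<Gamma>"
  shows "act g (vec P t h) = vec P t (\<lambda>p. \<rho> g (h p))"
proof -
  have "(\<Oplus>\<^bsub>U\<^esub>i\<in>{..<n}. vec P t h ! i \<otimes>\<^bsub>U\<^esub> act_const g k i) = (\<Oplus>\<^bsub>U\<^esub>p\<in>P. t p \<otimes>\<^bsub>U\<^esub> \<theta> (\<pi> k (\<rho> g (h p))))"
    if "k < n" for k
    using fhat_vec[OF lin_compose_act[OF \<pi>_lin[OF that] g] assms(1-3)] by (simp add: act_const_def)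
  then show ?thesis by (auto simp: vec_def[of P t "\<lambda>p. \<rho> g (h p)"] sc_act_def)
qed

end

section \<open>Ring structure and group action on the tensor product\<close>

context base_change
begin

text \<open>A tensor with a single term; the index set is an arbitrary singleton.\<close>

definition emb :: "'h \<Rightarrow> 'u list" where
  "emb x = vec {0::nat} (\<lambda>_. \<one>\<^bsub>U\<^esub>) (\<lambda>_. x)"

lemma scal_vec: "u \<in> carrier U \<Longrightarrow> scal u = vec {0::nat} (\<lambda>_. u) (\<lambda>_. \<one>)"
  by (auto simp: vec_def sc_emb_def unit_const_def \<theta>_closed \<pi>)

lemma one_T: "\<one>\<^bsub>T\<^esub> = emb \<one>"
  by (auto simp: vec_def emb_def sc_ring_def unit_const_def \<theta>_closed \<pi>)

lemma T_nth:
  "k < n \<Longrightarrow> (x \<oplus>\<^bsub>T\<^esub> y) ! k = x ! k \<oplus>\<^bsub>U\<^esub> y ! k" "length (x \<oplus>\<^bsub>T\<^esub> y) = n"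
  "k < n \<Longrightarrow> \<zero>\<^bsub>T\<^esub> ! k = \<zero>\<^bsub>U\<^esub>" "length \<zero>\<^bsub>T\<^esub> = n" "length (vec P t h) = n"
  by (simp_all add: sc_ring_def vec_def)

lemma T_eqI: "length x = n \<Longrightarrow> length y = n \<Longrightarrow> (\<And>k. k < n \<Longrightarrow> x ! k = y ! k) \<Longrightarrow> x = y"
  by (rule nth_equalityI) auto

lemma T_carrierI: "length x = n \<Longrightarrow> (\<And>k. k < n \<Longrightarrow> x ! k \<in> carrier U) \<Longrightarrow> x \<in> carrier T"
  by (auto simp: sc_ring_def in_set_conv_nth)

lemma T_vecE:
  assumes "x \<in> carrier T"
  obtains t h where "x = vec {..<n} t h" "t \<in> {..<n} \<rightarrow> carrier U" "h \<in> {..<n} \<rightarrow> carrier H"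
  using vec_basis[OF assms] carrierT_nth[OF assms] e that[of "\<lambda>i. x ! i" e] by auto

lemma vec_mult_closed:
  assumes "t \<in> P \<rightarrow> carrier U" "t' \<in> Q \<rightarrow> carrier U"
  shows "(\<lambda>p. t (fst p) \<otimes>\<^bsub>U\<^esub> t' (snd p)) \<in> P \<times> Q \<rightarrow> carrier U"
  using assms by (auto simp: Pi_iff)

lemma vec_mult_closed':
  assumes "h \<in> P \<rightarrow> carrier H" "h' \<in> Q \<rightarrow> carrier H"
  shows "(\<lambda>p. h (fst p) \<otimes> h' (snd p)) \<in> P \<times> Q \<rightarrow> carrier H"
  using assms by (auto simp: Pi_iff)

lemma vec_add:
  assumes "t \<in> P \<rightarrow> carrier U" "h \<in> P \<rightarrow> carrier H" "h' \<in> P \<rightarrow> carrier H"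
  shows "vec P t h \<oplus>\<^bsub>T\<^esub> vec P t h' = vec P t (\<lambda>p. h p \<oplus> h' p)"
proof (rule T_eqI)
  fix k assume k: "k < n"
  have "(\<Oplus>\<^bsub>U\<^esub>p\<in>P. t p \<otimes>\<^bsub>U\<^esub> \<theta> (\<pi> k (h p \<oplus> h' p))) =
      (\<Oplus>\<^bsub>U\<^esub>p\<in>P. t p \<otimes>\<^bsub>U\<^esub> \<theta> (\<pi> k (h p)) \<oplus>\<^bsub>U\<^esub> t p \<otimes>\<^bsub>U\<^esub> \<theta> (\<pi> k (h' p)))"
    using assms k by (intro U.finsum_cong')
      (auto simp: Pi_iff lin_add[OF \<pi>_lin] \<theta>_add \<pi> \<theta>_closed U.r_distr)
  also have "\<dots> = (\<Oplus>\<^bsub>U\<^esub>p\<in>P. t p \<otimes>\<^bsub>U\<^esub> \<theta> (\<pi> k (h p))) \<oplus>\<^bsub>U\<^esub> (\<Oplus>\<^bsub>U\<^esub>p\<in>P. t p \<otimes>\<^bsub>U\<^esub> \<theta> (\<pi> k (h' p)))"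
    using assms k by (intro U.finsum_addf) (auto simp: Pi_iff \<pi> \<theta>_closed)
  finally show "(vec P t h \<oplus>\<^bsub>T\<^esub> vec P t h') ! k = vec P t (\<lambda>p. h p \<oplus> h' p) ! k"
    using k by (simp add: T_nth vec_nth)
qed (simp_all add: T_nth)

lemma vec_zero:
  assumes "t \<in> P \<rightarrow> carrier U"
  shows "vec P t (\<lambda>p. \<zero>) = \<zero>\<^bsub>T\<^esub>"
proof (rule T_eqI)
  fix k assume k: "k < n"
  have "\<pi> k \<zero> = \<zero>" using lin_finsum[OF \<pi>_lin[OF k], of "{}"] by simp
  then have "(\<Oplus>\<^bsub>U\<^esub>p\<in>P. t p \<otimes>\<^bsub>U\<^esub> \<theta> (\<pi> k \<zero>)) = (\<Oplus>\<^bsub>U\<^esub>p\<in>P. \<zero>\<^bsub>U\<^esub>)"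
    using assms by (intro U.finsum_cong') (auto simp: \<theta>_zero Pi_iff)
  then show "vec P t (\<lambda>p. \<zero>) ! k = \<zero>\<^bsub>T\<^esub> ! k" using k by (simp add: T_nth vec_nth)
qed (simp_all add: T_nth)

lemma T_mult_closed: "x \<in> carrier T \<Longrightarrow> y \<in> carrier T \<Longrightarrow> x \<otimes>\<^bsub>T\<^esub> y \<in> carrier T"
  by (elim T_vecE) (simp add: vec_mult vec_closed vec_mult_closed vec_mult_closed')

lemma T_mult_comm:
  assumes "x \<in> carrier T" "y \<in> carrier T"
  shows "x \<otimes>\<^bsub>T\<^esub> y = y \<otimes>\<^bsub>T\<^esub> x"
proof -
  obtain t h where x: "x = vec {..<n} t h" "t \<in> {..<n} \<rightarrow> carrier U" "h \<in> {..<n} \<rightarrow> carrier H"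
    using assms by (elim T_vecE)
  obtain t' h' where y: "y = vec {..<n} t' h'" "t' \<in> {..<n} \<rightarrow> carrier U" "h' \<in> {..<n} \<rightarrow> carrier H"
    using assms by (elim T_vecE)
  have "vec ({..<n} \<times> {..<n}) (\<lambda>p. t (fst p) \<otimes>\<^bsub>U\<^esub> t' (snd p)) (\<lambda>p. h (fst p) \<otimes> h' (snd p)) =
     vec ({..<n} \<times> {..<n}) (\<lambda>p. t' (fst p) \<otimes>\<^bsub>U\<^esub> t (snd p)) (\<lambda>p. h' (fst p) \<otimes> h (snd p))"
    using x y by (intro vec_reindex[where \<phi> = prod.swap] vec_mult_closed vec_mult_closed')
      (auto simp: Pi_iff U.m_comm m_comm bij_betw_def product_swap)
  then show ?thesis using x y by (simp add: vec_mult)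
qed

lemma T_mult_assoc:
  assumes "x \<in> carrier T" "y \<in> carrier T" "z \<in> carrier T"
  shows "x \<otimes>\<^bsub>T\<^esub> y \<otimes>\<^bsub>T\<^esub> z = x \<otimes>\<^bsub>T\<^esub> (y \<otimes>\<^bsub>T\<^esub> z)"
proof -
  obtain t h where x: "x = vec {..<n} t h" "t \<in> {..<n} \<rightarrow> carrier U" "h \<in> {..<n} \<rightarrow> carrier H"
    using assms by (elim T_vecE)
  obtain t' h' where y: "y = vec {..<n} t' h'" "t' \<in> {..<n} \<rightarrow> carrier U" "h' \<in> {..<n} \<rightarrow> carrier H"
    using assms by (elim T_vecE)
  obtain t'' h'' where z: "z = vec {..<n} t'' h''" "t'' \<in> {..<n} \<rightarrow> carrier U" "h'' \<in> {..<n} \<rightarrow> carrier H"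
    using assms by (elim T_vecE)
  have "vec ({..<n} \<times> {..<n} \<times> {..<n}) (\<lambda>p. t (fst p) \<otimes>\<^bsub>U\<^esub> (t' (fst (snd p)) \<otimes>\<^bsub>U\<^esub> t'' (snd (snd p))))
         (\<lambda>p. h (fst p) \<otimes> (h' (fst (snd p)) \<otimes> h'' (snd (snd p)))) =
       vec (({..<n} \<times> {..<n}) \<times> {..<n}) (\<lambda>p. (t (fst (fst p)) \<otimes>\<^bsub>U\<^esub> t' (snd (fst p))) \<otimes>\<^bsub>U\<^esub> t'' (snd p))
         (\<lambda>p. (h (fst (fst p)) \<otimes> h' (snd (fst p))) \<otimes> h'' (snd p))"
    using x y z
    by (intro vec_reindex[where \<phi> = "\<lambda>p. (fst (fst p), snd (fst p), snd p)"])
      (auto simp: Pi_iff U.m_assoc m_assoc intro!: bij_betwI[where g = "\<lambda>p. ((fst p, fst (snd p)), snd (snd p))"])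
  then show ?thesis
    using x y z vec_mult_closed[OF x(2) y(2)] vec_mult_closed[OF y(2) z(2)]
      vec_mult_closed'[OF x(3) y(3)] vec_mult_closed'[OF y(3) z(3)]
    by (simp add: vec_mult)
qed

lemma emb_closed: "x \<in> carrier H \<Longrightarrow> emb x \<in> carrier T"
  unfolding emb_def by (rule vec_closed) auto

lemma scal_closed: "u \<in> carrier U \<Longrightarrow> scal u \<in> carrier T"
  by (simp add: scal_vec vec_closed)

lemma single_vec_mult:
  assumes u: "u \<in> carrier U" and x: "x \<in> carrier H" and t: "t \<in> {..<n} \<rightarrow> carrier U" and h: "h \<in> {..<n} \<rightarrow> carrier H"
  shows "vec {0::nat} (\<lambda>_. u) (\<lambda>_. x) \<otimes>\<^bsub>T\<^esub> vec {..<n} t h = vec {..<n} (\<lambda>i. u \<otimes>\<^bsub>U\<^esub> t i) (\<lambda>i. x \<otimes> h i)"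
proof -
  have "vec ({0::nat} \<times> {..<n}) (\<lambda>p. u \<otimes>\<^bsub>U\<^esub> t (snd p)) (\<lambda>p. x \<otimes> h (snd p)) = vec {..<n} (\<lambda>i. u \<otimes>\<^bsub>U\<^esub> t i) (\<lambda>i. x \<otimes> h i)"
    using u x t h
    by (intro vec_reindex[where \<phi> = "\<lambda>i. (0, i)"]) (auto simp: Pi_iff intro!: bij_betwI[where g = snd])
  then show ?thesis using u x t h by (simp add: vec_mult)
qed

lemma single_single_mult:
  assumes "u \<in> carrier U" "x \<in> carrier H" "v \<in> carrier U" "y \<in> carrier H"
  shows "vec {0::nat} (\<lambda>_. u) (\<lambda>_. x) \<otimes>\<^bsub>T\<^esub> vec {0::nat} (\<lambda>_. v) (\<lambda>_. y) =
    vec {0::nat} (\<lambda>_. u \<otimes>\<^bsub>U\<^esub> v) (\<lambda>_. x \<otimes> y)"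
proof -
  have "vec ({0::nat} \<times> {0::nat}) (\<lambda>p. u \<otimes>\<^bsub>U\<^esub> v) (\<lambda>p. x \<otimes> y) = vec {0::nat} (\<lambda>_. u \<otimes>\<^bsub>U\<^esub> v) (\<lambda>_. x \<otimes> y)"
    using assms
    by (intro vec_reindex[where \<phi> = "\<lambda>i. (0, i)"]) (auto simp: Pi_iff intro!: bij_betwI[where g = snd])
  then show ?thesis using assms by (simp add: vec_mult)
qed

lemma T_l_one:
  assumes "x \<in> carrier T"
  shows "\<one>\<^bsub>T\<^esub> \<otimes>\<^bsub>T\<^esub> x = x"
proof -
  obtain t h where x: "x = vec {..<n} t h" "t \<in> {..<n} \<rightarrow> carrier U" "h \<in> {..<n} \<rightarrow> carrier H"
    using assms by (elim T_vecE)
  have "vec {..<n} (\<lambda>i. \<one>\<^bsub>U\<^esub> \<otimes>\<^bsub>U\<^esub> t i) (\<lambda>i. \<one> \<otimes> h i) = vec {..<n} t h"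
    using x by (intro vec_reindex[where \<phi> = "\<lambda>i. i"]) (auto simp: Pi_iff bij_betw_def)
  then show ?thesis using x unfolding one_T emb_def by (simp add: single_vec_mult)
qed

text \<open>Done on coordinates, since \<open>vec_add\<close> only adds sums that share their
  coefficients in \<open>U\<close>.\<close>

lemma T_l_distr:
  assumes x: "x \<in> carrier T" and y: "y \<in> carrier T" and z: "z \<in> carrier T"
  shows "(x \<oplus>\<^bsub>T\<^esub> y) \<otimes>\<^bsub>T\<^esub> z = x \<otimes>\<^bsub>T\<^esub> z \<oplus>\<^bsub>T\<^esub> y \<otimes>\<^bsub>T\<^esub> z"
proof -
  note c = carrierT_nth[OF x] carrierT_nth[OF y] carrierT_nth[OF z]
  have s: "str_const k i j \<in> carrier U" if "k < n" "i < n" "j < n" for k i j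
    using that e by (simp add: str_const_def \<theta>_closed \<pi>)
  have "(\<Oplus>\<^bsub>U\<^esub>i\<in>{..<n}. \<Oplus>\<^bsub>U\<^esub>j\<in>{..<n}. ((x \<oplus>\<^bsub>T\<^esub> y) ! i \<otimes>\<^bsub>U\<^esub> z ! j) \<otimes>\<^bsub>U\<^esub> str_const k i j) =
     (\<Oplus>\<^bsub>U\<^esub>i\<in>{..<n}. \<Oplus>\<^bsub>U\<^esub>j\<in>{..<n}. (x ! i \<otimes>\<^bsub>U\<^esub> z ! j) \<otimes>\<^bsub>U\<^esub> str_const k i j) \<oplus>\<^bsub>U\<^esub>
     (\<Oplus>\<^bsub>U\<^esub>i\<in>{..<n}. \<Oplus>\<^bsub>U\<^esub>j\<in>{..<n}. (y ! i \<otimes>\<^bsub>U\<^esub> z ! j) \<otimes>\<^bsub>U\<^esub> str_const k i j)" if k: "k < n" for k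
  proof -
    have "(\<Oplus>\<^bsub>U\<^esub>j\<in>{..<n}. ((x \<oplus>\<^bsub>T\<^esub> y) ! i \<otimes>\<^bsub>U\<^esub> z ! j) \<otimes>\<^bsub>U\<^esub> str_const k i j) =
      (\<Oplus>\<^bsub>U\<^esub>j\<in>{..<n}. (x ! i \<otimes>\<^bsub>U\<^esub> z ! j) \<otimes>\<^bsub>U\<^esub> str_const k i j) \<oplus>\<^bsub>U\<^esub> (\<Oplus>\<^bsub>U\<^esub>j\<in>{..<n}. (y ! i \<otimes>\<^bsub>U\<^esub> z ! j) \<otimes>\<^bsub>U\<^esub> str_const k i j)"
      if i: "i < n" for i
    proof -
      have "(\<Oplus>\<^bsub>U\<^esub>j\<in>{..<n}. ((x \<oplus>\<^bsub>T\<^esub> y) ! i \<otimes>\<^bsub>U\<^esub> z ! j) \<otimes>\<^bsub>U\<^esub> str_const k i j) =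
       (\<Oplus>\<^bsub>U\<^esub>j\<in>{..<n}. (x ! i \<otimes>\<^bsub>U\<^esub> z ! j) \<otimes>\<^bsub>U\<^esub> str_const k i j \<oplus>\<^bsub>U\<^esub> (y ! i \<otimes>\<^bsub>U\<^esub> z ! j) \<otimes>\<^bsub>U\<^esub> str_const k i j)"
        using c s[OF k i] i by (intro U.finsum_cong') (auto simp: T_nth U.l_distr)
      also have "\<dots> = (\<Oplus>\<^bsub>U\<^esub>j\<in>{..<n}. (x ! i \<otimes>\<^bsub>U\<^esub> z ! j) \<otimes>\<^bsub>U\<^esub> str_const k i j) \<oplus>\<^bsub>U\<^esub> (\<Oplus>\<^bsub>U\<^esub>j\<in>{..<n}. (y ! i \<otimes>\<^bsub>U\<^esub> z ! j) \<otimes>\<^bsub>U\<^esub> str_const k i j)"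
        using c s[OF k i] i by (intro U.finsum_addf) auto
      finally show ?thesis .
    qed
    then have "(\<Oplus>\<^bsub>U\<^esub>i\<in>{..<n}. \<Oplus>\<^bsub>U\<^esub>j\<in>{..<n}. ((x \<oplus>\<^bsub>T\<^esub> y) ! i \<otimes>\<^bsub>U\<^esub> z ! j) \<otimes>\<^bsub>U\<^esub> str_const k i j) =
     (\<Oplus>\<^bsub>U\<^esub>i\<in>{..<n}. (\<Oplus>\<^bsub>U\<^esub>j\<in>{..<n}. (x ! i \<otimes>\<^bsub>U\<^esub> z ! j) \<otimes>\<^bsub>U\<^esub> str_const k i j) \<oplus>\<^bsub>U\<^esub> (\<Oplus>\<^bsub>U\<^esub>j\<in>{..<n}. (y ! i \<otimes>\<^bsub>U\<^esub> z ! j) \<otimes>\<^bsub>U\<^esub> str_const k i j))"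
      using c s[OF k] by (intro U.finsum_cong') (auto simp: Pi_iff intro!: U.finsum_closed U.a_closed)
    also have "\<dots> = (\<Oplus>\<^bsub>U\<^esub>i\<in>{..<n}. \<Oplus>\<^bsub>U\<^esub>j\<in>{..<n}. (x ! i \<otimes>\<^bsub>U\<^esub> z ! j) \<otimes>\<^bsub>U\<^esub> str_const k i j) \<oplus>\<^bsub>U\<^esub>
     (\<Oplus>\<^bsub>U\<^esub>i\<in>{..<n}. \<Oplus>\<^bsub>U\<^esub>j\<in>{..<n}. (y ! i \<otimes>\<^bsub>U\<^esub> z ! j) \<otimes>\<^bsub>U\<^esub> str_const k i j)"
      using c s[OF k] by (intro U.finsum_addf) (auto simp: Pi_iff intro!: U.finsum_closed)
    finally show ?thesis .
  qed
  then show ?thesis by (simp add: sc_ring_def)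
qed

lemma T_cring: "cring T"
proof (rule cringI)
  show "abelian_group T"
  proof (rule abelian_groupI)
    fix x assume x: "x \<in> carrier T"
    let ?y = "map (\<lambda>k. \<ominus>\<^bsub>U\<^esub> x ! k) [0..<n]"
    have "?y \<in> carrier T" using x by (intro T_carrierI) (auto simp: carrierT_nth)
    moreover have "?y \<oplus>\<^bsub>T\<^esub> x = \<zero>\<^bsub>T\<^esub>"
      using x by (intro T_eqI) (auto simp: T_nth carrierT_nth U.l_neg)
    ultimately show "\<exists>y\<in>carrier T. y \<oplus>\<^bsub>T\<^esub> x = \<zero>\<^bsub>T\<^esub>" by blast
  qed (auto intro!: T_carrierI T_eqI simp: T_nth carrierT_nth carrierT_length U.a_ac)
  show "comm_monoid T"
    using T_mult_closed T_mult_comm T_mult_assoc T_l_one emb_closed[of \<one>] one_T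
    by (intro comm_monoidI) auto
qed (rule T_l_distr)

sublocale T: cring T by (rule T_cring)

lemma emb_hom: "emb \<in> ring_hom H T"
proof (rule ring_hom_memI)
  fix x y assume "x \<in> carrier H" "y \<in> carrier H"
  then show "emb (x \<otimes> y) = emb x \<otimes>\<^bsub>T\<^esub> emb y" "emb (x \<oplus> y) = emb x \<oplus>\<^bsub>T\<^esub> emb y"
    by (simp_all add: emb_def single_single_mult vec_add)
qed (simp_all add: emb_closed one_T)

lemma scal_hom: "scal \<in> ring_hom U T"
proof (rule ring_hom_memI)
  fix u v assume uv: "u \<in> carrier U" "v \<in> carrier U"
  then show "scal (u \<otimes>\<^bsub>U\<^esub> v) = scal u \<otimes>\<^bsub>T\<^esub> scal v"
    by (simp add: scal_vec single_single_mult)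
  show "scal (u \<oplus>\<^bsub>U\<^esub> v) = scal u \<oplus>\<^bsub>T\<^esub> scal v"
    using uv by (intro T_eqI) (auto simp: T_nth sc_emb_def unit_const_def U.l_distr \<theta>_closed \<pi>)
next
  show "scal \<one>\<^bsub>U\<^esub> = \<one>\<^bsub>T\<^esub>" by (simp add: scal_vec one_T emb_def)
qed (simp_all add: scal_closed)

lemma act_closed_T: "g \<in> carrier \<Gamma> \<Longrightarrow> x \<in> carrier T \<Longrightarrow> act g x \<in> carrier T"
  by (elim T_vecE) (auto simp: vec_act intro!: vec_closed act_closed)

lemma act_emb: "g \<in> carrier \<Gamma> \<Longrightarrow> x \<in> carrier H \<Longrightarrow> act g (emb x) = emb (\<rho> g x)"
  by (simp add: emb_def vec_act)

lemma act_scal: "g \<in> carrier \<Gamma> \<Longrightarrow> u \<in> carrier U \<Longrightarrow> act g (scal u) = scal u"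
  by (simp add: scal_vec vec_act act_1)

lemma T_ring_action: "ring_action T \<Gamma> (\<lambda>g. act g)"
proof
  show "finite (carrier \<Gamma>)" by (rule finite_\<Gamma>)
  fix g assume g: "g \<in> carrier \<Gamma>"
  show "act g \<in> ring_hom T T"
  proof (rule ring_hom_memI)
    fix x y assume xy: "x \<in> carrier T" "y \<in> carrier T"
    obtain t h where x: "x = vec {..<n} t h" "t \<in> {..<n} \<rightarrow> carrier U" "h \<in> {..<n} \<rightarrow> carrier H"
      using xy by (elim T_vecE)
    obtain t' h' where y: "y = vec {..<n} t' h'" "t' \<in> {..<n} \<rightarrow> carrier U" "h' \<in> {..<n} \<rightarrow> carrier H"
      using xy by (elim T_vecE)
    have c: "(\<lambda>p. \<rho> g (h p)) \<in> {..<n} \<rightarrow> carrier H" "(\<lambda>p. \<rho> g (h' p)) \<in> {..<n} \<rightarrow> carrier H"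
      using x y g by (auto simp: act_closed Pi_iff)
    have "vec ({..<n} \<times> {..<n}) (\<lambda>p. t (fst p) \<otimes>\<^bsub>U\<^esub> t' (snd p)) (\<lambda>p. \<rho> g (h (fst p) \<otimes> h' (snd p))) =
      vec ({..<n} \<times> {..<n}) (\<lambda>p. t (fst p) \<otimes>\<^bsub>U\<^esub> t' (snd p)) (\<lambda>p. \<rho> g (h (fst p)) \<otimes> \<rho> g (h' (snd p)))"
      using x y g by (intro vec_reindex[where \<phi> = "\<lambda>i. i"]) (auto simp: Pi_iff bij_betw_def act_times act_closed)
    then show "act g (x \<otimes>\<^bsub>T\<^esub> y) = act g x \<otimes>\<^bsub>T\<^esub> act g y"
      using x y g c vec_mult_closed[OF x(2) y(2)] vec_mult_closed'[OF x(3) y(3)]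
      by (simp add: vec_mult vec_act)
    show "act g (x \<oplus>\<^bsub>T\<^esub> y) = act g x \<oplus>\<^bsub>T\<^esub> act g y"
    proof (rule T_eqI)
      fix k assume k: "k < n"
      have r: "act_const g k i \<in> carrier U" if "i < n" for i
        using that k e g by (simp add: act_const_def \<theta>_closed \<pi> act_closed)
      note c = carrierT_nth[OF xy(1)] carrierT_nth[OF xy(2)]
      have "(\<Oplus>\<^bsub>U\<^esub>i\<in>{..<n}. (x \<oplus>\<^bsub>T\<^esub> y) ! i \<otimes>\<^bsub>U\<^esub> act_const g k i) =
        (\<Oplus>\<^bsub>U\<^esub>i\<in>{..<n}. x ! i \<otimes>\<^bsub>U\<^esub> act_const g k i \<oplus>\<^bsub>U\<^esub> y ! i \<otimes>\<^bsub>U\<^esub> act_const g k i)"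
        using r c by (intro U.finsum_cong') (auto simp: T_nth U.l_distr)
      also have "\<dots> = (\<Oplus>\<^bsub>U\<^esub>i\<in>{..<n}. x ! i \<otimes>\<^bsub>U\<^esub> act_const g k i) \<oplus>\<^bsub>U\<^esub> (\<Oplus>\<^bsub>U\<^esub>i\<in>{..<n}. y ! i \<otimes>\<^bsub>U\<^esub> act_const g k i)"
        using r c by (intro U.finsum_addf) auto
      finally show "act g (x \<oplus>\<^bsub>T\<^esub> y) ! k = (act g x \<oplus>\<^bsub>T\<^esub> act g y) ! k"
        using k by (simp add: T_nth sc_act_def)
    qed (simp_all add: T_nth sc_act_def)
  next
    show "act g \<one>\<^bsub>T\<^esub> = \<one>\<^bsub>T\<^esub>" using g by (simp add: one_T act_emb act_1)
  qed (use act_closed_T g in auto)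
next
  fix g h x assume g: "g \<in> carrier \<Gamma>" and h: "h \<in> carrier \<Gamma>" and x: "x \<in> carrier T"
  obtain t k where x: "x = vec {..<n} t k" "t \<in> {..<n} \<rightarrow> carrier U" "k \<in> {..<n} \<rightarrow> carrier H"
    using x by (elim T_vecE)
  have c: "(\<lambda>p. \<rho> h (k p)) \<in> {..<n} \<rightarrow> carrier H" using x h by (auto simp: act_closed Pi_iff)
  have "vec {..<n} t (\<lambda>p. \<rho> (g \<otimes>\<^bsub>\<Gamma>\<^esub> h) (k p)) = vec {..<n} t (\<lambda>p. \<rho> g (\<rho> h (k p)))"
    using x g h by (intro vec_reindex[where \<phi> = "\<lambda>i. i"]) (auto simp: Pi_iff bij_betw_def act_mult act_closed)
  then show "act (g \<otimes>\<^bsub>\<Gamma>\<^esub> h) x = act g (act h x)"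
    using x g h c by (simp add: vec_act)
next
  fix x assume x: "x \<in> carrier T"
  obtain t k where x: "x = vec {..<n} t k" "t \<in> {..<n} \<rightarrow> carrier U" "k \<in> {..<n} \<rightarrow> carrier H"
    using x by (elim T_vecE)
  have "vec {..<n} t (\<lambda>p. \<rho> \<one>\<^bsub>\<Gamma>\<^esub> (k p)) = vec {..<n} t k"
    using x by (intro vec_reindex[where \<phi> = "\<lambda>i. i"]) (auto simp: Pi_iff bij_betw_def act_one)
  then show "act \<one>\<^bsub>\<Gamma>\<^esub> x = x" using x by (simp add: vec_act)
qed

sublocale T: ring_action T \<Gamma> "\<lambda>g. act g" by (rule T_ring_action)

lemma T_Tr_vec:
  assumes P: "finite P" "t \<in> P \<rightarrow> carrier U" "h \<in> P \<rightarrow> carrier H" and Z: "Z \<subseteq> carrier \<Gamma>"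
  shows "T.Tr Z (vec P t h) = vec P t (\<lambda>p. Tr Z (h p))"
proof -
  have "finite Z" using Z finite_\<Gamma> finite_subset by auto
  then show ?thesis using Z
  proof (induction Z rule: finite_induct)
    case empty
    then show ?case using P by (simp add: T.Tr_def Tr_def vec_zero)
  next
    case (insert g Z)
    have hc: "h p \<in> carrier H" if "p \<in> P" for p using that P by auto
    have "T.Tr (insert g Z) (vec P t h) = act g (vec P t h) \<oplus>\<^bsub>T\<^esub> T.Tr Z (vec P t h)"
      unfolding T.Tr_def using insert P by (intro T.finsum_insert) (auto simp: T.act_closed vec_closed)
    also have "\<dots> = vec P t (\<lambda>p. \<rho> g (h p)) \<oplus>\<^bsub>T\<^esub> vec P t (\<lambda>p. Tr Z (h p))"
      using insert P by (simp add: vec_act)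
    also have "\<dots> = vec P t (\<lambda>p. \<rho> g (h p) \<oplus> Tr Z (h p))"
      using insert P hc by (intro vec_add) (auto simp: act_closed Tr_closed)
    also have "\<dots> = vec P t (\<lambda>p. Tr (insert g Z) (h p))"
    proof -
      have "Tr (insert g Z) (h p) = \<rho> g (h p) \<oplus> Tr Z (h p)" if "p \<in> P" for p
        unfolding Tr_def using insert hc[OF that] by (intro finsum_insert) (auto simp: act_closed)
      then show ?thesis
        using insert P hc by (intro vec_reindex[where \<phi> = "\<lambda>i. i"]) (auto simp: bij_betw_def act_closed Tr_closed)
    qed
    finally show ?case .
  qed
qed

lemma T_Fixed: "T.Fixed = scal ` carrier U"
proof
  show "scal ` carrier U \<subseteq> T.Fixed"
    by (auto simp: T.Fixed_def scal_closed act_scal)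
  show "T.Fixed \<subseteq> scal ` carrier U"
  proof
    fix x assume "x \<in> T.Fixed"
    then have x: "x \<in> carrier T" "\<And>g. g \<in> carrier \<Gamma> \<Longrightarrow> act g x = x" by (auto simp: T.Fixed_def)
    obtain t h where xv: "x = vec {..<n} t h" "t \<in> {..<n} \<rightarrow> carrier U" "h \<in> {..<n} \<rightarrow> carrier H"
      using x(1) by (elim T_vecE)
    obtain s where s: "s \<in> carrier H" "Tr (carrier \<Gamma>) s = \<one>" using exists_Tr_one by auto
    define c where "c i = Tr (carrier \<Gamma>) (s \<otimes> h i)" for i
    have c: "c i \<in> Fixed" if "i < n" for i using that xv s by (auto simp: c_def Pi_iff intro!: Tr_Fixed)
    have sh: "(\<lambda>i. s \<otimes> h i) \<in> {..<n} \<rightarrow> carrier H" using xv s by auto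
    have "T.Tr (carrier \<Gamma>) (emb s) = emb (Tr (carrier \<Gamma>) s)"
      unfolding emb_def using s by (intro T_Tr_vec) auto
    then have "x = T.Tr (carrier \<Gamma>) (emb s) \<otimes>\<^bsub>T\<^esub> x"
      using s x by (simp add: one_T[symmetric])
    also have "\<dots> = T.Tr (carrier \<Gamma>) (emb s \<otimes>\<^bsub>T\<^esub> x)"
      using x s by (intro T.Tr_mult_fixed[symmetric]) (auto simp: emb_closed)
    also have "emb s \<otimes>\<^bsub>T\<^esub> x = vec {..<n} (\<lambda>i. \<one>\<^bsub>U\<^esub> \<otimes>\<^bsub>U\<^esub> t i) (\<lambda>i. s \<otimes> h i)"
      unfolding emb_def xv(1) using s xv by (intro single_vec_mult) auto
    also have "\<dots> = vec {..<n} t (\<lambda>i. s \<otimes> h i)"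
      using xv sh by (intro vec_reindex[where \<phi> = "\<lambda>i. i"]) (auto simp: bij_betw_def Pi_iff)
    also have "T.Tr (carrier \<Gamma>) \<dots> = vec {..<n} t c"
      unfolding c_def using xv sh by (intro T_Tr_vec) auto
    also have "\<dots> = scal (\<Oplus>\<^bsub>U\<^esub>i\<in>{..<n}. t i \<otimes>\<^bsub>U\<^esub> \<theta> (c i))"
    proof (rule T_eqI)
      fix k assume k: "k < n"
      have "vec {..<n} t c ! k = (\<Oplus>\<^bsub>U\<^esub>i\<in>{..<n}. (t i \<otimes>\<^bsub>U\<^esub> \<theta> (c i)) \<otimes>\<^bsub>U\<^esub> unit_const k)"
        unfolding vec_nth[OF k]
      proof (rule U.finsum_cong')
        fix i assume i: "i \<in> {..<n}"
        then have ci: "c i \<in> Fixed" "c i \<in> carrier H" using c Fixed_ops(5) by auto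
        \<comment> \<open>The coordinates of a base element are its multiples of the coordinates of
          one; this is how it moves across the tensor sign.\<close>
        have "\<pi> k (c i) = c i \<otimes> \<pi> k \<one>" using lin_smult[OF \<pi>_lin[OF k] ci(1), of \<one>] ci by simp
        then show "t i \<otimes>\<^bsub>U\<^esub> \<theta> (\<pi> k (c i)) = (t i \<otimes>\<^bsub>U\<^esub> \<theta> (c i)) \<otimes>\<^bsub>U\<^esub> unit_const k"
          using i xv ci k by (simp add: \<theta>_mult \<pi> \<theta>_closed unit_const_def U.m_assoc Pi_iff)
      qed (use xv c k in \<open>auto simp: \<theta>_closed \<pi> unit_const_def Pi_iff\<close>)
      also have "\<dots> = (\<Oplus>\<^bsub>U\<^esub>i\<in>{..<n}. t i \<otimes>\<^bsub>U\<^esub> \<theta> (c i)) \<otimes>\<^bsub>U\<^esub> unit_const k"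
        using xv c k by (intro U.finsum_ldistr[symmetric]) (auto simp: \<theta>_closed \<pi> unit_const_def)
      finally show "vec {..<n} t c ! k = scal (\<Oplus>\<^bsub>U\<^esub>i\<in>{..<n}. t i \<otimes>\<^bsub>U\<^esub> \<theta> (c i)) ! k"
        using k by (simp add: sc_emb_def)
    qed (simp_all add: T_nth sc_emb_def)
    finally show "x \<in> scal ` carrier U"
      using xv c by (auto simp: \<theta>_closed Pi_iff intro!: U.finsum_closed imageI)
  qed
qed

section \<open>The tensor product is a field\<close>

lemma \<theta>_nonzero: "x \<in> Fixed \<Longrightarrow> x \<noteq> \<zero> \<Longrightarrow> \<theta> x \<noteq> \<zero>\<^bsub>U\<^esub>"
proof
  assume x: "x \<in> Fixed" "x \<noteq> \<zero>" and 0: "\<theta> x = \<zero>\<^bsub>U\<^esub>"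
  have i: "inv x \<in> Fixed" "x \<otimes> inv x = \<one>" using subfield_m_inv[OF Fixed_subfield, of x] x by auto
  then have "\<theta> x \<otimes>\<^bsub>U\<^esub> \<theta> (inv x) = \<one>\<^bsub>U\<^esub>" using \<theta>_mult[of x "inv x"] x \<theta>_one by simp
  then show False using 0 i \<theta>_closed by simp
qed

lemma T_one_not_zero: "\<one>\<^bsub>T\<^esub> \<noteq> \<zero>\<^bsub>T\<^esub>"
proof
  assume *: "\<one>\<^bsub>T\<^esub> = \<zero>\<^bsub>T\<^esub>"
  have "\<pi> k \<one> = \<zero>" if k: "k < n" for k
  proof (rule ccontr)
    assume "\<pi> k \<one> \<noteq> \<zero>"
    then have "\<theta> (\<pi> k \<one>) \<noteq> \<zero>\<^bsub>U\<^esub>" using k by (intro \<theta>_nonzero) (auto simp: \<pi>)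
    moreover have "\<one>\<^bsub>T\<^esub> ! k = \<theta> (\<pi> k \<one>)" using k by (simp add: sc_ring_def unit_const_def)
    ultimately show False using * k by (simp add: T_nth)
  qed
  \<comment> \<open>If all coordinates of one were zero, one would be zero in \<open>H\<close>. This
    includes the case \<open>n = 0\<close>.\<close>
  then have "(\<Oplus>k\<in>{..<n}. \<pi> k \<one> \<otimes> e k) = (\<Oplus>k\<in>{..<n}. \<zero>)"
    using e by (intro finsum_cong') auto
  then show False using expand[of \<one>] by simp
qed

sublocale emb: ring_hom_ring H T emb
  by (intro ring_hom_ringI2 emb_hom ring_axioms T.ring_axioms)

sublocale scal: ring_hom_ring U T scal
  by (intro ring_hom_ringI2 scal_hom U.ring_axioms T.ring_axioms)

text \<open>Let \<open>p\<close> be a polynomial over the base that vanishes at \<open>h\<close>. On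
  \<open>x\<close> the elements \<open>emb h\<close> and \<open>scal u\<close> act alike, hence so
  do the values of \<open>p\<close> at them, and the value at \<open>u\<close> annihilates
  \<open>x\<close>. That value is a scalar from a field and \<open>x\<close> is nonzero, so
  \<open>u\<close> is a root of \<open>p\<close>.\<close>

lemma T_alg_closed:
  assumes h: "h \<in> carrier H" and u: "u \<in> carrier U" and x: "x \<in> carrier T" "x \<noteq> \<zero>\<^bsub>T\<^esub>"
    and eq: "emb h \<otimes>\<^bsub>T\<^esub> x = scal u \<otimes>\<^bsub>T\<^esub> x"
  shows "scal u \<in> emb ` carrier H"
proof -
  have F: "subring Fixed H" by (rule subfieldE(1)[OF Fixed_subfield])
  obtain p where p: "p \<in> carrier (Fixed[X])" "p \<noteq> []" "eval p h = \<zero>"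
    using algebraicE[OF F h] algebraic_Fixed[OF h] unfolding over_def by metis
  then have set_p: "set p \<subseteq> Fixed" "hd p \<noteq> \<zero>"
    by (auto simp: univ_poly_def polynomial_def)
  \<comment> \<open>On the base field both embeddings agree, so \<open>p\<close> has the same
    coefficients from either side.\<close>
  have emb_scal: "emb c = scal (\<theta> c)" if "c \<in> Fixed" for c
  proof (rule T_eqI)
    fix k assume k: "k < n"
    have cH: "c \<in> carrier H" using that Fixed_ops by auto
    have "\<pi> k c = c \<otimes> \<pi> k \<one>" using lin_smult[OF \<pi>_lin[OF k] that, of \<one>] cH by simp
    then show "emb c ! k = scal (\<theta> c) ! k"
      using that k cH by (simp add: emb_def vec_nth sc_emb_def unit_const_def \<theta>_mult \<pi> \<theta>_closed)
  qed (simp_all add: emb_def T_nth sc_emb_def)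
  have hx: "emb h \<in> carrier T" "scal u \<in> carrier T" using h u by auto
  have ev: "set q \<subseteq> Fixed \<Longrightarrow> T.eval (map emb q) (emb h) \<otimes>\<^bsub>T\<^esub> x = T.eval (map emb q) (scal u) \<otimes>\<^bsub>T\<^esub> x" for q
  proof (induction q)
    case (Cons c q)
    have pw: "emb h [^]\<^bsub>T\<^esub> j \<otimes>\<^bsub>T\<^esub> x = scal u [^]\<^bsub>T\<^esub> j \<otimes>\<^bsub>T\<^esub> x" for j :: nat
    proof (induction j)
      case (Suc j)
      have "emb h [^]\<^bsub>T\<^esub> Suc j \<otimes>\<^bsub>T\<^esub> x = emb h \<otimes>\<^bsub>T\<^esub> (emb h [^]\<^bsub>T\<^esub> j \<otimes>\<^bsub>T\<^esub> x)" using hx x by (simp add: T.m_ac)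
      also have "\<dots> = scal u [^]\<^bsub>T\<^esub> j \<otimes>\<^bsub>T\<^esub> (emb h \<otimes>\<^bsub>T\<^esub> x)" unfolding Suc using hx x by (simp add: T.m_ac)
      also have "\<dots> = scal u [^]\<^bsub>T\<^esub> Suc j \<otimes>\<^bsub>T\<^esub> x" unfolding eq using hx x by (simp add: T.m_ac)
      finally show ?case .
    qed simp
    have c: "emb c \<in> carrier T" "set (map emb q) \<subseteq> carrier T" using Cons.prems Fixed_ops(5) by auto
    have "T.eval (map emb (c # q)) (emb h) \<otimes>\<^bsub>T\<^esub> x =
       emb c \<otimes>\<^bsub>T\<^esub> (emb h [^]\<^bsub>T\<^esub> length q \<otimes>\<^bsub>T\<^esub> x) \<oplus>\<^bsub>T\<^esub> T.eval (map emb q) (emb h) \<otimes>\<^bsub>T\<^esub> x"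
      using c hx x T.eval_in_carrier[OF c(2)] by (simp add: T.l_distr T.m_assoc)
    also have "\<dots> = emb c \<otimes>\<^bsub>T\<^esub> (scal u [^]\<^bsub>T\<^esub> length q \<otimes>\<^bsub>T\<^esub> x) \<oplus>\<^bsub>T\<^esub> T.eval (map emb q) (scal u) \<otimes>\<^bsub>T\<^esub> x"
      using Cons pw by simp
    also have "\<dots> = T.eval (map emb (c # q)) (scal u) \<otimes>\<^bsub>T\<^esub> x"
      using c hx x T.eval_in_carrier[OF c(2)] by (simp add: T.l_distr T.m_assoc)
    finally show ?case .
  qed simp
  have "T.eval (map emb p) (emb h) = \<zero>\<^bsub>T\<^esub>"
  proof -
    have "set p \<subseteq> carrier H" using set_p Fixed_ops(5) by blast
    from emb.eval_hom'[OF h this] show ?thesis using p(3) by simp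
  qed
  then have 0: "T.eval (map emb p) (scal u) \<otimes>\<^bsub>T\<^esub> x = \<zero>\<^bsub>T\<^esub>"
    using ev[OF set_p(1)] x by simp
  have "map emb p = map scal (map \<theta> p)" using set_p emb_scal by auto
  moreover have \<theta>p: "set (map \<theta> p) \<subseteq> carrier U" using set_p \<theta>_closed by auto
  ultimately have "T.eval (map emb p) (scal u) = scal (U.eval (map \<theta> p) u)"
    using scal.eval_hom'[OF u \<theta>p] by (simp only:)
  then have 1: "scal (U.eval (map \<theta> p) u) \<otimes>\<^bsub>T\<^esub> x = \<zero>\<^bsub>T\<^esub>" using 0 by (simp only:)
  define v where "v = U.eval (map \<theta> p) u"
  have v: "v \<in> carrier U" using U.eval_in_carrier[OF \<theta>p u] by (simp add: v_def)
  have "v = \<zero>\<^bsub>U\<^esub>"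
  proof (rule ccontr)
    assume "v \<noteq> \<zero>\<^bsub>U\<^esub>"
    then have vi: "inv\<^bsub>U\<^esub> v \<in> carrier U" "inv\<^bsub>U\<^esub> v \<otimes>\<^bsub>U\<^esub> v = \<one>\<^bsub>U\<^esub>" using v U.field_Units by auto
    have "x = scal (inv\<^bsub>U\<^esub> v \<otimes>\<^bsub>U\<^esub> v) \<otimes>\<^bsub>T\<^esub> x" using vi x by simp
    also have "\<dots> = scal (inv\<^bsub>U\<^esub> v) \<otimes>\<^bsub>T\<^esub> (scal v \<otimes>\<^bsub>T\<^esub> x)" using vi(1) v x by (simp add: T.m_assoc)
    finally show False using 1 vi x by (simp add: v_def)
  qed
  then have "u \<in> \<theta> ` Fixed" using rel_closed[OF u set_p(1) p(2) set_p(2)] by (simp add: v_def)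
  then obtain c where "c \<in> Fixed" "u = \<theta> c" by auto
  then show ?thesis using emb_scal[of c] Fixed_ops(5) by (metis imageI)
qed

theorem T_field: "field T"
proof -
  obtain m a b where "galois_coords H \<Gamma> \<rho> m a b" using exists_galois_coords by blast
  then interpret c: galois_coords H \<Gamma> \<rho> m a b .
  have ab: "a l \<in> carrier H" "b l \<in> carrier H" if "l < m" for l using that c.ab by auto
  have E: "subfield (emb ` carrier H) T"
    by (rule emb.img_is_subfield(2)[OF carrier_is_subfield T_one_not_zero])
  have F: "subfield T.Fixed T"
    unfolding T_Fixed by (rule scal.img_is_subfield(2)[OF U.carrier_is_subfield T_one_not_zero])
  interpret embc: ring_hom_cring H T emb
    by (intro ring_hom_cringI emb_hom is_cring T_cring)
  \<comment> \<open>\<open>emb\<close> is an equivariant homomorphism, so coordinates of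
    \<open>H\<close> stay coordinates of the tensor product.\<close>
  have kernel: "T.coord_kernel m (\<lambda>l. emb (a l)) (\<lambda>l. emb (b l)) (act g) =
    (if g = \<one>\<^bsub>\<Gamma>\<^esub> then \<one>\<^bsub>T\<^esub> else \<zero>\<^bsub>T\<^esub>)" if g: "g \<in> carrier \<Gamma>" for g
  proof -
    have "T.coord_kernel m (\<lambda>l. emb (a l)) (\<lambda>l. emb (b l)) (act g) = (\<Oplus>\<^bsub>T\<^esub>l\<in>{..<m}. emb (a l \<otimes> \<rho> g (b l)))"
      unfolding T.coord_kernel_def using g ab
      by (intro T.finsum_cong') (auto simp: act_emb act_closed)
    also have "\<dots> = emb (coord_kernel m a b (\<rho> g))"
      unfolding coord_kernel_def using g ab embc.hom_finsum[of "\<lambda>l. a l \<otimes> \<rho> g (b l)" "{..<m}"]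
      by (simp add: comp_def Pi_iff act_closed)
    finally show ?thesis using c.kernel_act[OF g] by simp
  qed
  interpret ga: galois_algebra T \<Gamma> "\<lambda>g. act g" m "\<lambda>l. emb (a l)" "\<lambda>l. emb (b l)" "emb ` carrier H"
  proof (intro galois_algebra.intro galois_coords.intro galois_coords_axioms.intro galois_algebra_axioms.intro
      T.ring_action_axioms)

  next
    show "subfield (emb ` carrier H) T" by (rule E)
    show "subfield T.Fixed T" by (rule F)
    fix h u x assume "h \<in> emb ` carrier H" "u \<in> T.Fixed" "x \<in> carrier T" "x \<noteq> \<zero>\<^bsub>T\<^esub>" "h \<otimes>\<^bsub>T\<^esub> x = u \<otimes>\<^bsub>T\<^esub> x"
    then show "u \<in> emb ` carrier H" unfolding T_Fixed using T_alg_closed by auto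
  next
    fix g assume "g \<in> carrier \<Gamma>"
    then show "T.coord_kernel m (\<lambda>l. emb (a l)) (\<lambda>l. emb (b l)) (act g) =
      (if g = \<one>\<^bsub>\<Gamma>\<^esub> then \<one>\<^bsub>T\<^esub> else \<zero>\<^bsub>T\<^esub>)" by (rule kernel)
  next
    fix g x assume "g \<in> carrier \<Gamma>" "x \<in> emb ` carrier H"
    then show "act g x \<in> emb ` carrier H" by (auto simp: act_emb act_closed simp del: emb.hom_closed)
  qed (use ab emb_closed in blast)+
  show ?thesis by (rule ga.field_M)
qed

theorem T_field_action: "field_action T \<Gamma> (\<lambda>g. act g)"
proof -
  interpret TF: field T by (rule T_field)
  show ?thesis
  proof
    fix g assume g: "g \<in> carrier \<Gamma>" "g \<noteq> \<one>\<^bsub>\<Gamma>\<^esub>"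
    then obtain x where x: "x \<in> carrier H" "\<rho> g x \<noteq> x" using faithful by auto
    have "inj_on emb (carrier H)"
      by (rule emb.img_is_subfield(1)[OF carrier_is_subfield T_one_not_zero])
    then have "emb (\<rho> g x) \<noteq> emb x" using x g by (auto dest: inj_onD simp: act_closed)
    then show "\<exists>x\<in>carrier T. act g x \<noteq> x" using x g by (intro bexI[of _ "emb x"]) (auto simp: act_emb)
  qed
qed

end

section \<open>Realising Galois groups\<close>

text \<open>Finite dimension gives algebraicity, faithfulness gives injectivity of the map from
  \<open>\<Gamma>\<close>, and \<open>Artin\<close> shows that there are no further
  automorphisms.\<close>

lemma (in field_action) galois_ext_Gal:
  assumes B: "field B" and j: "j \<in> ring_hom B M" "Fixed = j ` carrier B"
  shows "galois_ext B M j" "\<Gamma> \<cong> Gal B M j"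
proof -
  \<comment> \<open>\<open>Bij\<close> consists of extensional maps, so the action is cut down to
    the carrier.\<close>
  let ?r = "\<lambda>g. restrict (\<rho> g) (carrier M)"
  have Bij: "?r g \<in> Bij (carrier M)" if g: "g \<in> carrier \<Gamma>" for g
  proof -
    have "bij_betw (?r g) (carrier M) (carrier M)"
      using g by (intro bij_betwI[where g = "\<rho> (inv\<^bsub>\<Gamma>\<^esub> g)"]) (auto simp: act_closed act_inv act_inv')
    then show ?thesis by (simp add: Bij_def)
  qed
  have r: "?r g \<in> carrier (Gal B M j)" if g: "g \<in> carrier \<Gamma>" for g
  proof -
    have "?r g \<in> ring_hom M M"
      using g by (intro ring_hom_memI) (auto simp: act_closed act_add act_times act_1)
    moreover have "?r g (j x) = j x" if "x \<in> carrier B" for x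
    proof -
      have "j x \<in> Fixed" using j that by auto
      then show ?thesis using g by (simp add: Fixed_def)
    qed
    ultimately show ?thesis using Bij[OF g] by (simp add: Gal_def)
  qed
  show "galois_ext B M j"
    unfolding galois_ext_def
  proof (intro conjI ballI B j(1))
    show "field M" by (rule field_axioms)
    show "algebraic (j ` carrier B) x" if "x \<in> carrier M" for x
      using algebraic_Fixed[OF that] j by simp
    show "{x \<in> carrier M. \<forall>\<sigma>\<in>carrier (Gal B M j). \<sigma> x = x} = j ` carrier B"
    proof
      show "j ` carrier B \<subseteq> {x \<in> carrier M. \<forall>\<sigma>\<in>carrier (Gal B M j). \<sigma> x = x}"
        using ring_hom_closed[OF j(1)] by (auto simp: Gal_def)
      show "{x \<in> carrier M. \<forall>\<sigma>\<in>carrier (Gal B M j). \<sigma> x = x} \<subseteq> j ` carrier B"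
        using r unfolding j(2)[symmetric] Fixed_def by force
    qed
  qed
  have "?r \<in> iso \<Gamma> (Gal B M j)"
  proof (rule isoI)
    show "?r \<in> hom \<Gamma> (Gal B M j)"
    proof (rule homI)
      fix g h assume gh: "g \<in> carrier \<Gamma>" "h \<in> carrier \<Gamma>"
      have "?r (g \<otimes>\<^bsub>\<Gamma>\<^esub> h) = compose (carrier M) (?r g) (?r h)"
        using gh by (auto simp: compose_def act_mult act_closed)
      then show "?r (g \<otimes>\<^bsub>\<Gamma>\<^esub> h) = ?r g \<otimes>\<^bsub>Gal B M j\<^esub> ?r h"
        using Bij gh by (simp add: Gal_def BijGroup_def)
    qed (rule r)
    show "bij_betw ?r (carrier \<Gamma>) (carrier (Gal B M j))"
    proof (rule bij_betw_imageI)
      show "inj_on ?r (carrier \<Gamma>)"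
      proof (rule inj_onI)
        fix g h assume gh: "g \<in> carrier \<Gamma>" "h \<in> carrier \<Gamma>" and eq: "?r g = ?r h"
        have "\<rho> (inv\<^bsub>\<Gamma>\<^esub> h \<otimes>\<^bsub>\<Gamma>\<^esub> g) x = x" if x: "x \<in> carrier M" for x
        proof -
          have "\<rho> g x = \<rho> h x" using fun_cong[OF eq, of x] x by simp
          then show ?thesis using gh x by (simp add: act_mult act_inv)
        qed
        then have "inv\<^bsub>\<Gamma>\<^esub> h \<otimes>\<^bsub>\<Gamma>\<^esub> g = \<one>\<^bsub>\<Gamma>\<^esub>"
          using faithful gh by (metis G.inv_closed G.m_closed)
        then show "g = h" using gh by (metis G.inv_closed G.inv_equality G.inv_inv)
      qed
      show "?r ` carrier \<Gamma> = carrier (Gal B M j)"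
      proof
        show "?r ` carrier \<Gamma> \<subseteq> carrier (Gal B M j)" using r by auto
        show "carrier (Gal B M j) \<subseteq> ?r ` carrier \<Gamma>"
        proof
          fix f assume "f \<in> carrier (Gal B M j)"
          then have f: "f \<in> Bij (carrier M)" "f \<in> ring_hom M M" "\<And>x. x \<in> Fixed \<Longrightarrow> f x = x"
            by (auto simp: Gal_def j(2))
          from Artin[OF f(2,3)] obtain g where g: "g \<in> carrier \<Gamma>" "\<forall>x\<in>carrier M. f x = \<rho> g x" by auto
          have "f = ?r g"
            using g Bij_imp_extensional[OF f(1)] by (auto simp: extensional_def)
          then show "f \<in> ?r ` carrier \<Gamma>" using g by auto
        qed
      qed
    qed
  qed
  then show "\<Gamma> \<cong> Gal B M j" by (auto simp: is_iso_def)
qed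

section \<open>Transfer along ultraproducts\<close>

text \<open>For a finite group its quantifiers are finite conjunctions, so this is first-order in
  \<open>L\<close> and \<open>T\<close>. Closure under \<open>act\<close> and \<open>j\<close> is
  left out; for structure constants it holds at every index.\<close>

definition galois_sentence where
  "galois_sentence L T \<Gamma> act j \<longleftrightarrow>
    (\<forall>g\<in>carrier \<Gamma>. \<forall>x\<in>carrier T. \<forall>y\<in>carrier T. act g (x \<otimes>\<^bsub>T\<^esub> y) = act g x \<otimes>\<^bsub>T\<^esub> act g y) \<and>
    (\<forall>g\<in>carrier \<Gamma>. \<forall>x\<in>carrier T. \<forall>y\<in>carrier T. act g (x \<oplus>\<^bsub>T\<^esub> y) = act g x \<oplus>\<^bsub>T\<^esub> act g y) \<and>
    (\<forall>g\<in>carrier \<Gamma>. act g \<one>\<^bsub>T\<^esub> = \<one>\<^bsub>T\<^esub>) \<and>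
    (\<forall>g\<in>carrier \<Gamma>. \<forall>h\<in>carrier \<Gamma>. \<forall>x\<in>carrier T. act (g \<otimes>\<^bsub>\<Gamma>\<^esub> h) x = act g (act h x)) \<and>
    (\<forall>x\<in>carrier T. act \<one>\<^bsub>\<Gamma>\<^esub> x = x) \<and>
    (\<forall>g\<in>carrier \<Gamma> - {\<one>\<^bsub>\<Gamma>\<^esub>}. \<exists>x\<in>carrier T. \<not> act g x = x) \<and>
    (\<forall>x\<in>carrier T. (\<forall>g\<in>carrier \<Gamma>. act g x = x) \<longrightarrow> (\<exists>u\<in>carrier L. x = j u)) \<and>
    (\<forall>g\<in>carrier \<Gamma>. \<forall>u\<in>carrier L. act g (j u) = j u) \<and>
    (\<forall>u\<in>carrier L. \<forall>v\<in>carrier L. j (u \<otimes>\<^bsub>L\<^esub> v) = j u \<otimes>\<^bsub>T\<^esub> j v) \<and>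
    (\<forall>u\<in>carrier L. \<forall>v\<in>carrier L. j (u \<oplus>\<^bsub>L\<^esub> v) = j u \<oplus>\<^bsub>T\<^esub> j v) \<and>
    j \<one>\<^bsub>L\<^esub> = \<one>\<^bsub>T\<^esub>"

lemma galois_sentenceI:
  assumes "field_action T \<Gamma> act" "j \<in> ring_hom L T" "ring_action.Fixed T \<Gamma> act = j ` carrier L"
  shows "galois_sentence L T \<Gamma> act j"
proof -
  interpret field_action T \<Gamma> act by fact
  have F: "x \<in> Fixed \<longleftrightarrow> x \<in> j ` carrier L" for x using assms(3) by simp
  have f: "act g (j u) = j u" if "g \<in> carrier \<Gamma>" "u \<in> carrier L" for g u
    using F[of "j u"] that by (auto simp: Fixed_def)
  have f': "\<exists>u\<in>carrier L. x = j u" if "x \<in> carrier T" "\<forall>g\<in>carrier \<Gamma>. act g x = x" for x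
    using F[of x] that by (auto simp: Fixed_def)
  show ?thesis
    unfolding galois_sentence_def
    using f f' faithful ring_hom_mult[OF assms(2)] ring_hom_add[OF assms(2)] ring_hom_one[OF assms(2)]
    by (simp add: act_times act_add act_1 act_mult act_one)
qed

text \<open>The way back from the sentence, used at each good index. The closure conditions missing
  from the sentence are supplied as hypotheses.\<close>

lemma galois_sentence_group_over:
  assumes L: "field L" and T: "field T" and \<Gamma>: "group \<Gamma>" "finite (carrier \<Gamma>)"
    and act: "\<And>g x. g \<in> carrier \<Gamma> \<Longrightarrow> x \<in> carrier T \<Longrightarrow> act g x \<in> carrier T"
    and j: "\<And>u. u \<in> carrier L \<Longrightarrow> j u \<in> carrier T"
    and gs: "galois_sentence L T \<Gamma> act j"
  shows "galois_ext L T j" "\<Gamma> \<cong> Gal L T j"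
proof -
  note g = gs[unfolded galois_sentence_def]
  interpret T: field T by fact
  interpret field_action T \<Gamma> act
  proof (intro field_action.intro ring_action.intro ring_action_axioms.intro field_action_axioms.intro \<Gamma> T
      T.is_cring)
    show "act x \<in> ring_hom T T" if "x \<in> carrier \<Gamma>" for x
      using g that act by (intro ring_hom_memI) auto
  qed (use g in auto)
  have jh: "j \<in> ring_hom L T" using g j by (intro ring_hom_memI) auto
  have F: "Fixed = j ` carrier L" using g j unfolding Fixed_def by blast
  show "galois_ext L T j" "\<Gamma> \<cong> Gal L T j" using galois_ext_Gal[OF L jh F] by auto
qed

text \<open>Capital letters are the families of structure constants over the factors, small letters
  their limits in \<open>U\<close>. The dimension \<open>n\<close> does not vary with the
  index.\<close>

locale sc_limit = ultralimit S D L U ulim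
  for S :: "'s set" and D and L :: "'s \<Rightarrow> ('l, 'b) ring_scheme" and U :: "('u, 'd) ring_scheme" and ulim +
  fixes n :: nat and c w C W and \<Gamma> :: "('g, 'm) monoid_scheme" and r R
  assumes L_field: "s \<in> S \<Longrightarrow> field (L s)"
    and C: "k < n \<Longrightarrow> i < n \<Longrightarrow> j < n \<Longrightarrow> (\<lambda>s. C s k i j) \<in> fam \<and> c k i j = ulim (\<lambda>s. C s k i j)"
    and W: "k < n \<Longrightarrow> (\<lambda>s. W s k) \<in> fam \<and> w k = ulim (\<lambda>s. W s k)"
    and R: "g \<in> carrier \<Gamma> \<Longrightarrow> k < n \<Longrightarrow> i < n \<Longrightarrow> (\<lambda>s. R s g k i) \<in> fam \<and> r g k i = ulim (\<lambda>s. R s g k i)"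
    and \<Gamma>: "group \<Gamma>" "finite (carrier \<Gamma>)"
begin

abbreviation "Ts s \<equiv> sc_ring (L s) n (C s) (W s)"
abbreviation "TU \<equiv> sc_ring U n c w"
abbreviation "acts s g \<equiv> sc_act (L s) n (R s g)"
abbreviation "actU g \<equiv> sc_act U n (r g)"
abbreviation "embs s \<equiv> sc_emb (L s) n (W s)"
abbreviation "embU \<equiv> sc_emb U n w"

definition vlim :: "('s \<Rightarrow> 'l list) \<Rightarrow> 'u list" where
  "vlim x = map (\<lambda>k. ulim (\<lambda>s. x s ! k)) [0..<n]"

lemma U_field: "field U"
  using losD[OF los_field] ae_all[of "\<lambda>s. field (L s)"] L_field by simp

lemma L_am: "s \<in> S \<Longrightarrow> abelian_monoid (L s)"
  using L_field field.axioms(1) domain.axioms(1) cring.axioms(1) ring.is_abelian_group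
    abelian_group.axioms(1) by blast

lemma fam_finsum:
  assumes "\<And>i. i \<in> I \<Longrightarrow> x i \<in> fam"
  shows "(\<lambda>s. \<Oplus>\<^bsub>L s\<^esub>i\<in>I. x i s) \<in> fam"
  using assms by (auto intro!: abelian_monoid.finsum_closed[OF L_am])

lemma ulim_finsum:
  assumes "finite I" "\<And>i. i \<in> I \<Longrightarrow> x i \<in> fam"
  shows "(\<Oplus>\<^bsub>U\<^esub>i\<in>I. ulim (x i)) = ulim (\<lambda>s. \<Oplus>\<^bsub>L s\<^esub>i\<in>I. x i s)"
proof -
  interpret U: field U by (rule U_field)
  show ?thesis using assms
  proof (induction I rule: finite_induct)
    case empty
    have "ulim (\<lambda>s. \<zero>\<^bsub>L s\<^esub>) = ulim (\<lambda>s. \<Oplus>\<^bsub>L s\<^esub>i\<in>{}. x i s)"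
      by (rule ulim_cong[OF fam_zero]) (simp add: abelian_monoid.finsum_empty[OF L_am])
    then show ?case by (simp add: ulim_zero)
  next
    case (insert a I)
    have "ulim (x a) \<oplus>\<^bsub>U\<^esub> ulim (\<lambda>s. \<Oplus>\<^bsub>L s\<^esub>i\<in>I. x i s) = ulim (\<lambda>s. x a s \<oplus>\<^bsub>L s\<^esub> (\<Oplus>\<^bsub>L s\<^esub>i\<in>I. x i s))"
      using insert.prems by (intro ulim_add fam_finsum) auto
    also have "\<dots> = ulim (\<lambda>s. \<Oplus>\<^bsub>L s\<^esub>i\<in>insert a I. x i s)"
    proof (rule ulim_cong)
      show "(\<lambda>s. x a s \<oplus>\<^bsub>L s\<^esub> (\<Oplus>\<^bsub>L s\<^esub>i\<in>I. x i s)) \<in> fam"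
        using insert.prems by (intro fam_add fam_finsum) auto
      show "x a s \<oplus>\<^bsub>L s\<^esub> (\<Oplus>\<^bsub>L s\<^esub>i\<in>I. x i s) = (\<Oplus>\<^bsub>L s\<^esub>i\<in>insert a I. x i s)" if "s \<in> S" for s
        using insert that by (subst abelian_monoid.finsum_insert[OF L_am]) (auto simp: Pi_iff)
    qed
    finally show ?case
      using insert by (subst U.finsum_insert) (auto simp: ulim_closed)
  qed
qed

lemma vfam_nth: "x \<in> Pi S (\<lambda>s. carrier (Ts s)) \<Longrightarrow> k < n \<Longrightarrow> (\<lambda>s. x s ! k) \<in> fam"
  by (fastforce simp: sc_ring_def Pi_iff)

lemma vfamI: "(\<And>s. s \<in> S \<Longrightarrow> length (x s) = n) \<Longrightarrow> (\<And>k. k < n \<Longrightarrow> (\<lambda>s. x s ! k) \<in> fam) \<Longrightarrow>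
    x \<in> Pi S (\<lambda>s. carrier (Ts s))"
  by (fastforce simp: sc_ring_def Pi_iff in_set_conv_nth)

lemma vlim_nth: "k < n \<Longrightarrow> vlim x ! k = ulim (\<lambda>s. x s ! k)" and vlim_length: "length (vlim x) = n"
  by (simp_all add: vlim_def)

lemma list_eqI: "length x = n \<Longrightarrow> length y = n \<Longrightarrow> (\<And>k. k < n \<Longrightarrow> x ! k = y ! k) \<Longrightarrow> x = y"
  by (rule nth_equalityI) auto

text \<open>Stated for arbitrary \<open>L'\<close>, \<open>c'\<close>, \<open>w'\<close> and
  \<open>r'\<close>, so that the same rules serve the factors and the algebra over
  \<open>U\<close>.\<close>

lemma Ts_nth:
  "k < n \<Longrightarrow> (x \<oplus>\<^bsub>sc_ring L' n c' w'\<^esub> y) ! k = x ! k \<oplus>\<^bsub>L'\<^esub> y ! k" "length (x \<oplus>\<^bsub>sc_ring L' n c' w'\<^esub> y) = n"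
  "k < n \<Longrightarrow> (x \<otimes>\<^bsub>sc_ring L' n c' w'\<^esub> y) ! k = (\<Oplus>\<^bsub>L'\<^esub>i\<in>{..<n}. \<Oplus>\<^bsub>L'\<^esub>j\<in>{..<n}. (x ! i \<otimes>\<^bsub>L'\<^esub> y ! j) \<otimes>\<^bsub>L'\<^esub> c' k i j)"
  "length (x \<otimes>\<^bsub>sc_ring L' n c' w'\<^esub> y) = n"
  "k < n \<Longrightarrow> \<zero>\<^bsub>sc_ring L' n c' w'\<^esub> ! k = \<zero>\<^bsub>L'\<^esub>" "length \<zero>\<^bsub>sc_ring L' n c' w'\<^esub> = n"
  "k < n \<Longrightarrow> \<one>\<^bsub>sc_ring L' n c' w'\<^esub> ! k = w' k" "length \<one>\<^bsub>sc_ring L' n c' w'\<^esub> = n"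
  "k < n \<Longrightarrow> sc_act L' n r' x ! k = (\<Oplus>\<^bsub>L'\<^esub>i\<in>{..<n}. x ! i \<otimes>\<^bsub>L'\<^esub> r' k i)" "length (sc_act L' n r' x) = n"
  "k < n \<Longrightarrow> sc_emb L' n w' u ! k = u \<otimes>\<^bsub>L'\<^esub> w' k" "length (sc_emb L' n w' u) = n"
  by (simp_all add: sc_ring_def sc_act_def sc_emb_def)

abbreviation "vfam \<equiv> Pi S (\<lambda>s. carrier (Ts s))"

lemma vfam_ops:
  "x \<in> vfam \<Longrightarrow> y \<in> vfam \<Longrightarrow> (\<lambda>s. x s \<oplus>\<^bsub>Ts s\<^esub> y s) \<in> vfam"
  "x \<in> vfam \<Longrightarrow> y \<in> vfam \<Longrightarrow> (\<lambda>s. x s \<otimes>\<^bsub>Ts s\<^esub> y s) \<in> vfam"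
  "(\<lambda>s. \<zero>\<^bsub>Ts s\<^esub>) \<in> vfam" "(\<lambda>s. \<one>\<^bsub>Ts s\<^esub>) \<in> vfam"
  "g \<in> carrier \<Gamma> \<Longrightarrow> x \<in> vfam \<Longrightarrow> (\<lambda>s. acts s g (x s)) \<in> vfam"
  "u \<in> fam \<Longrightarrow> (\<lambda>s. embs s (u s)) \<in> vfam"
  by (rule vfamI; simp add: Ts_nth; intro fam_add fam_mult fam_zero fam_finsum vfam_nth
      C[THEN conjunct1] W[THEN conjunct1] R[THEN conjunct1]; simp)+

lemma vlim_ops:
  "x \<in> vfam \<Longrightarrow> y \<in> vfam \<Longrightarrow> vlim x \<oplus>\<^bsub>TU\<^esub> vlim y = vlim (\<lambda>s. x s \<oplus>\<^bsub>Ts s\<^esub> y s)"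
  "x \<in> vfam \<Longrightarrow> y \<in> vfam \<Longrightarrow> vlim x \<otimes>\<^bsub>TU\<^esub> vlim y = vlim (\<lambda>s. x s \<otimes>\<^bsub>Ts s\<^esub> y s)"
  "\<zero>\<^bsub>TU\<^esub> = vlim (\<lambda>s. \<zero>\<^bsub>Ts s\<^esub>)" "\<one>\<^bsub>TU\<^esub> = vlim (\<lambda>s. \<one>\<^bsub>Ts s\<^esub>)"
  "g \<in> carrier \<Gamma> \<Longrightarrow> x \<in> vfam \<Longrightarrow> actU g (vlim x) = vlim (\<lambda>s. acts s g (x s))"
  "u \<in> fam \<Longrightarrow> embU (ulim u) = vlim (\<lambda>s. embs s (u s))"
proof -
  interpret U: field U by (rule U_field)
  { fix x y assume xy: "x \<in> vfam" "y \<in> vfam"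
    show "vlim x \<oplus>\<^bsub>TU\<^esub> vlim y = vlim (\<lambda>s. x s \<oplus>\<^bsub>Ts s\<^esub> y s)"
      using xy by (intro list_eqI) (simp_all add: Ts_nth vlim_length vlim_nth ulim_add vfam_nth)
    show "vlim x \<otimes>\<^bsub>TU\<^esub> vlim y = vlim (\<lambda>s. x s \<otimes>\<^bsub>Ts s\<^esub> y s)"
    proof (rule list_eqI)
      fix k assume k: "k < n"
      have t: "(\<lambda>s. (x s ! i \<otimes>\<^bsub>L s\<^esub> y s ! j) \<otimes>\<^bsub>L s\<^esub> C s k i j) \<in> fam" if "i < n" "j < n" for i j
        using that k xy C by (intro fam_mult vfam_nth) auto
      have "(\<Oplus>\<^bsub>U\<^esub>i\<in>{..<n}. \<Oplus>\<^bsub>U\<^esub>j\<in>{..<n}. (vlim x ! i \<otimes>\<^bsub>U\<^esub> vlim y ! j) \<otimes>\<^bsub>U\<^esub> c k i j) =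
        (\<Oplus>\<^bsub>U\<^esub>i\<in>{..<n}. ulim (\<lambda>s. \<Oplus>\<^bsub>L s\<^esub>j\<in>{..<n}. (x s ! i \<otimes>\<^bsub>L s\<^esub> y s ! j) \<otimes>\<^bsub>L s\<^esub> C s k i j))"
      proof (rule U.finsum_cong')
        fix i assume i: "i \<in> {..<n}"
        have "(\<Oplus>\<^bsub>U\<^esub>j\<in>{..<n}. (vlim x ! i \<otimes>\<^bsub>U\<^esub> vlim y ! j) \<otimes>\<^bsub>U\<^esub> c k i j) =
          (\<Oplus>\<^bsub>U\<^esub>j\<in>{..<n}. ulim (\<lambda>s. (x s ! i \<otimes>\<^bsub>L s\<^esub> y s ! j) \<otimes>\<^bsub>L s\<^esub> C s k i j))"
          using i k xy C t by (intro U.finsum_cong') (auto simp: vlim_nth ulim_mult vfam_nth fam_mult ulim_closed)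
        also have "\<dots> = ulim (\<lambda>s. \<Oplus>\<^bsub>L s\<^esub>j\<in>{..<n}. (x s ! i \<otimes>\<^bsub>L s\<^esub> y s ! j) \<otimes>\<^bsub>L s\<^esub> C s k i j)"
          using i t by (intro ulim_finsum) auto
        finally show "(\<Oplus>\<^bsub>U\<^esub>j\<in>{..<n}. (vlim x ! i \<otimes>\<^bsub>U\<^esub> vlim y ! j) \<otimes>\<^bsub>U\<^esub> c k i j) =
          ulim (\<lambda>s. \<Oplus>\<^bsub>L s\<^esub>j\<in>{..<n}. (x s ! i \<otimes>\<^bsub>L s\<^esub> y s ! j) \<otimes>\<^bsub>L s\<^esub> C s k i j)" .
      qed (use t in \<open>auto intro!: ulim_closed fam_finsum\<close>)
      also have "\<dots> = ulim (\<lambda>s. \<Oplus>\<^bsub>L s\<^esub>i\<in>{..<n}. \<Oplus>\<^bsub>L s\<^esub>j\<in>{..<n}. (x s ! i \<otimes>\<^bsub>L s\<^esub> y s ! j) \<otimes>\<^bsub>L s\<^esub> C s k i j)"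
        using t by (intro ulim_finsum fam_finsum) auto
      finally show "(vlim x \<otimes>\<^bsub>TU\<^esub> vlim y) ! k = vlim (\<lambda>s. x s \<otimes>\<^bsub>Ts s\<^esub> y s) ! k"
        using k by (simp add: Ts_nth vlim_nth)
    qed (simp_all add: Ts_nth vlim_length)
  }
  show "\<zero>\<^bsub>TU\<^esub> = vlim (\<lambda>s. \<zero>\<^bsub>Ts s\<^esub>)" "\<one>\<^bsub>TU\<^esub> = vlim (\<lambda>s. \<one>\<^bsub>Ts s\<^esub>)"
    using W by (auto intro!: list_eqI simp: Ts_nth vlim_length vlim_nth ulim_zero)
  show "actU g (vlim x) = vlim (\<lambda>s. acts s g (x s))" if g: "g \<in> carrier \<Gamma>" and x: "x \<in> vfam" for g x
  proof (rule list_eqI)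
    fix k assume k: "k < n"
    have t: "(\<lambda>s. x s ! i \<otimes>\<^bsub>L s\<^esub> R s g k i) \<in> fam" if "i < n" for i
      using that k x R g by (intro fam_mult vfam_nth) auto
    have "(\<Oplus>\<^bsub>U\<^esub>i\<in>{..<n}. vlim x ! i \<otimes>\<^bsub>U\<^esub> r g k i) = (\<Oplus>\<^bsub>U\<^esub>i\<in>{..<n}. ulim (\<lambda>s. x s ! i \<otimes>\<^bsub>L s\<^esub> R s g k i))"
      using k g x R t by (intro U.finsum_cong') (auto simp: vlim_nth ulim_mult vfam_nth ulim_closed)
    also have "\<dots> = ulim (\<lambda>s. \<Oplus>\<^bsub>L s\<^esub>i\<in>{..<n}. x s ! i \<otimes>\<^bsub>L s\<^esub> R s g k i)"
      using t by (intro ulim_finsum) auto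
    finally show "actU g (vlim x) ! k = vlim (\<lambda>s. acts s g (x s)) ! k"
      using k by (simp add: Ts_nth vlim_nth)
  qed (simp_all add: Ts_nth vlim_length)
  show "embU (ulim u) = vlim (\<lambda>s. embs s (u s))" if "u \<in> fam" for u
    using that W by (intro list_eqI) (simp_all add: Ts_nth vlim_length vlim_nth ulim_mult)
qed

lemma vlim_onto: "vlim ` vfam = carrier TU"
proof
  show "vlim ` vfam \<subseteq> carrier TU"
    using vfam_nth ulim_closed by (auto simp: vlim_def sc_ring_def)
  show "carrier TU \<subseteq> vlim ` vfam"
  proof
    fix y assume y: "y \<in> carrier TU"
    have yk: "length y = n" "\<And>k. k < n \<Longrightarrow> y ! k \<in> carrier U" using y by (auto simp: sc_ring_def)
    have "\<forall>k. \<exists>x. k < n \<longrightarrow> x \<in> fam \<and> y ! k = ulim x" using obtain_fam yk by metis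
    then obtain x where x: "\<And>k. k < n \<Longrightarrow> x k \<in> fam \<and> y ! k = ulim (x k)" by metis
    have "(\<lambda>s. map (\<lambda>k. x k s) [0..<n]) \<in> vfam" using x by (intro vfamI) auto
    moreover have "y = vlim (\<lambda>s. map (\<lambda>k. x k s) [0..<n])"
      using x yk by (intro list_eqI) (auto simp: vlim_nth vlim_length)
    ultimately show "y \<in> vlim ` vfam" by blast
  qed
qed

text \<open>Equality of vectors is a conjunction of \<open>n\<close> equations, and finite
  conjunctions commute with the ultraproduct.\<close>

lemma vlim_eq:
  assumes x: "x \<in> vfam" and y: "y \<in> vfam"
  shows "vlim x = vlim y \<longleftrightarrow> {s \<in> S. x s = y s} \<in> D"
proof -
  have "vlim x = vlim y \<longleftrightarrow> (\<forall>k\<in>{..<n}. ulim (\<lambda>s. x s ! k) = ulim (\<lambda>s. y s ! k))"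
    by (auto simp: vlim_def)
  also have "\<dots> \<longleftrightarrow> {s \<in> S. \<forall>k\<in>{..<n}. x s ! k = y s ! k} \<in> D"
    using losD[OF los_finite_ball[of "{..<n}", OF _ los_eq[OF vfam_nth[OF x] vfam_nth[OF y]]]] by simp
  also have "{s \<in> S. \<forall>k\<in>{..<n}. x s ! k = y s ! k} = {s \<in> S. x s = y s}"
  proof -
    have "(\<forall>k\<in>{..<n}. x s ! k = y s ! k) \<longleftrightarrow> x s = y s" if "s \<in> S" for s
    proof -
      have "length (x s) = n" "length (y s) = n" using x y that by (auto simp: sc_ring_def Pi_iff)
      then show ?thesis using list_eqI[of "x s" "y s"] by auto
    qed
    then show ?thesis by blast
  qed
  finally show ?thesis .
qed

text \<open>Makes the algebra over \<open>U\<close> an ultraproduct of the algebras over the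
  factors, so that quantifiers over vectors can be transferred as well.\<close>

sublocale T: ultralimit S D Ts TU vlim
proof
  show "closed_ring (Ts s)" if s: "s \<in> S" for s
  proof -
    \<comment> \<open>Closure at one index follows from closure of families, by extending an element
      by zero at all other indices.\<close>
    have x': "\<exists>x'\<in>vfam. x' s = x" if "x \<in> carrier (Ts s)" for x
      using that vfam_ops(3) by (intro bexI[of _ "\<lambda>s'. if s' = s then x else \<zero>\<^bsub>Ts s'\<^esub>"]) auto
    show ?thesis unfolding closed_ring_def
    proof (intro conjI ballI)
      fix x y assume "x \<in> carrier (Ts s)" "y \<in> carrier (Ts s)"
      then have "\<exists>x'\<in>vfam. x' s = x" "\<exists>y'\<in>vfam. y' s = y" by (simp_all only: x')
      then obtain x' y' where *: "x' \<in> vfam" "x' s = x" "y' \<in> vfam" "y' s = y" by (elim bexE)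
      show "x \<oplus>\<^bsub>Ts s\<^esub> y \<in> carrier (Ts s)" "x \<otimes>\<^bsub>Ts s\<^esub> y \<in> carrier (Ts s)"
        using vfam_ops(1,2)[OF *(1,3)] s * by auto
    qed (use vfam_ops(3,4) s in auto)
  qed
qed (simp_all add: vlim_onto vlim_eq vlim_ops)

lemma acts_closed: "s \<in> S \<Longrightarrow> g \<in> carrier \<Gamma> \<Longrightarrow> x \<in> carrier (Ts s) \<Longrightarrow> acts s g x \<in> carrier (Ts s)"
  using vfam_ops(5)[of g "\<lambda>s'. if s' = s then x else \<zero>\<^bsub>Ts s'\<^esub>"] vfam_ops(3)
  by (fastforce simp: Pi_iff split: if_splits)

lemma embs_closed: "s \<in> S \<Longrightarrow> u \<in> carrier (L s) \<Longrightarrow> embs s u \<in> carrier (Ts s)"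
  using vfam_ops(6)[of "\<lambda>s'. if s' = s then u else \<zero>\<^bsub>L s'\<^esub>"] fam_zero
  by (fastforce simp: Pi_iff split: if_splits)

lemma los_galois:
  "los (\<lambda>s. galois_sentence (L s) (Ts s) \<Gamma> (acts s) (embs s)) (galois_sentence U TU \<Gamma> actU embU)"
proof -
  have fin: "finite (carrier \<Gamma> - {\<one>\<^bsub>\<Gamma>\<^esub>})" using \<Gamma> by simp
  have [simp]: "\<one>\<^bsub>\<Gamma>\<^esub> \<in> carrier \<Gamma>" "\<And>g h. g \<in> carrier \<Gamma> \<Longrightarrow> h \<in> carrier \<Gamma> \<Longrightarrow> g \<otimes>\<^bsub>\<Gamma>\<^esub> h \<in> carrier \<Gamma>"
    using group.is_monoid[OF \<Gamma>(1)] by (auto simp: monoid.one_closed monoid.m_closed)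
  show ?thesis
    unfolding galois_sentence_def
    \<comment> \<open>Group quantifiers are treated as finite conjunctions, quantifiers over vectors
      by the limit map \<open>vlim\<close>, and those over scalars by \<open>ulim\<close>.\<close>
    by (intro los_conj los_finite_ball[OF \<Gamma>(2)] los_finite_ball[OF fin] T.los_allM T.los_exM los_allM los_exM los_imp los_not;
        simp add: vlim_ops vfam_ops ulim_one ulim_add ulim_mult fam_add fam_mult fam_one T.los_eq)
qed

theorem ae_galois_group_over:
  assumes "field TU" "galois_sentence U TU \<Gamma> actU embU"
  shows "{s \<in> S. galois_group_over (L s) \<Gamma>} \<in> D"
proof -
  have "{s \<in> S. field (Ts s)} \<in> D" using losD[OF T.los_field] assms by simp
  moreover have "{s \<in> S. galois_sentence (L s) (Ts s) \<Gamma> (acts s) (embs s)} \<in> D"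
    using losD[OF los_galois] assms by simp
  ultimately have "{s \<in> S. field (Ts s) \<and> galois_sentence (L s) (Ts s) \<Gamma> (acts s) (embs s)} \<in> D"
    by (rule ae_conj)
  then show ?thesis
  proof (rule ae_mono)
    fix s assume s: "s \<in> S" and *: "field (Ts s) \<and> galois_sentence (L s) (Ts s) \<Gamma> (acts s) (embs s)"
    have "galois_ext (L s) (Ts s) (embs s) \<and> \<Gamma> \<cong> Gal (L s) (Ts s) (embs s)"
      using * galois_sentence_group_over[OF L_field[OF s] _ \<Gamma>, of "Ts s" "acts s" "embs s"]
        acts_closed[OF s] embs_closed[OF s] by blast
    then show "galois_group_over (L s) \<Gamma>" unfolding galois_group_over_def by blast
  qed
qed

end

section \<open>Rational roots\<close>

context principal_domain
begin

text \<open>Numerator and denominator are divided by a generator of the ideal they span. Coprimality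
  is recorded as a Bezout identity, the form in which it is applied.\<close>

lemma frac_coprime_rep:
  assumes "v \<in> carrier (frac_field R)"
  obtains a b x y where "a \<in> carrier R" "b \<in> carrier R - {\<zero>}" "v = frac a b"
    "x \<in> carrier R" "y \<in> carrier R" "x \<otimes> a \<oplus> y \<otimes> b = \<one>"
proof -
  obtain a b where ab: "a \<in> carrier R" "b \<in> carrier R - {\<zero>}" "v = frac a b"
    using assms unfolding frac_field_carrier by blast
  have "ideal (PIdl a <+>\<^bsub>R\<^esub> PIdl b) R"
    using ab by (intro add_ideals cgenideal_ideal) auto
  then obtain g where g: "g \<in> carrier R" "PIdl a <+>\<^bsub>R\<^esub> PIdl b = PIdl g"
    using exists_gen by blast
  have mem: "z \<in> PIdl a <+>\<^bsub>R\<^esub> PIdl b \<longleftrightarrow> (\<exists>x\<in>carrier R. \<exists>y\<in>carrier R. z = x \<otimes> a \<oplus> y \<otimes> b)" for z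
    unfolding set_add_def' cgenideal_def by blast
  have mem': "z \<in> PIdl g \<longleftrightarrow> (\<exists>x\<in>carrier R. z = x \<otimes> g)" for z
    unfolding cgenideal_def by blast
  have "a \<in> PIdl a <+>\<^bsub>R\<^esub> PIdl b"
    unfolding mem using ab by (intro bexI[of _ \<one>] bexI[of _ \<zero>]) auto
  then obtain a' where a': "a' \<in> carrier R" "a = a' \<otimes> g" unfolding g(2) mem' by blast
  have "b \<in> PIdl a <+>\<^bsub>R\<^esub> PIdl b"
    unfolding mem using ab by (intro bexI[of _ \<zero>] bexI[of _ \<one>]) auto
  then obtain b' where b': "b' \<in> carrier R" "b = b' \<otimes> g" unfolding g(2) mem' by blast
  have "g \<in> PIdl g" unfolding mem' using g by (intro bexI[of _ \<one>]) auto
  then obtain x y where xy: "x \<in> carrier R" "y \<in> carrier R" "g = x \<otimes> a \<oplus> y \<otimes> b"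
    unfolding g(2)[symmetric] mem by blast
  have nz: "g \<noteq> \<zero>" "b' \<noteq> \<zero>" using ab b' g by auto
  have "g \<otimes> (x \<otimes> a' \<oplus> y \<otimes> b') = x \<otimes> (a' \<otimes> g) \<oplus> y \<otimes> (b' \<otimes> g)"
    using xy(1,2) a'(1) b'(1) g(1) by (simp add: r_distr m_ac)
  also have "\<dots> = g \<otimes> \<one>" using g(1) unfolding a'(2)[symmetric] b'(2)[symmetric] xy(3)[symmetric] by simp
  finally have "x \<otimes> a' \<oplus> y \<otimes> b' = \<one>"
    using m_lcancel[of g "x \<otimes> a' \<oplus> y \<otimes> b'" \<one>] nz(1) g(1) xy(1,2) a'(1) b'(1) by blast
  moreover have "v = frac a' b'"
  proof -
    have "a \<otimes> b' = a' \<otimes> b"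
      unfolding a'(2) b'(2) using a'(1) b'(1) g(1) by (simp add: m_assoc m_comm[of b'])
    then show ?thesis using frac_eq_iff[OF ab(1,2) a'(1), of b'] b'(1) nz ab(3) by blast
  qed
  ultimately show ?thesis using that[of a' b' x y] a'(1) b'(1) nz(2) xy(1,2) by blast
qed

text \<open>Multiplying the Bezout identity by \<open>d = c \<otimes> a [^] n\<close> writes
  \<open>d\<close> as a combination of \<open>d \<otimes> a\<close> and \<open>b\<close>. So one
  power of \<open>a\<close> can be removed at a time.\<close>

lemma coprime_cancel:
  assumes c: "x \<in> carrier R" "y \<in> carrier R" "a \<in> carrier R" "b \<in> carrier R" "x \<otimes> a \<oplus> y \<otimes> b = \<one>"
  shows "c \<in> carrier R \<Longrightarrow> b divides c \<otimes> a [^] (n::nat) \<Longrightarrow> b divides c"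
proof (induction n)
  case 0
  then show ?case by simp
next
  case (Suc n)
  define d where "d = c \<otimes> a [^] n"
  have d: "d \<in> carrier R" using Suc c by (simp add: d_def)
  obtain m where m: "m \<in> carrier R" "c \<otimes> a [^] Suc n = b \<otimes> m" using Suc by (auto simp: factor_def)
  then have da: "d \<otimes> a = b \<otimes> m" using Suc c by (simp add: d_def m_assoc)
  have "d = d \<otimes> (x \<otimes> a \<oplus> y \<otimes> b)" using d c(5) by simp
  also have "\<dots> = x \<otimes> (d \<otimes> a) \<oplus> b \<otimes> (d \<otimes> y)" using d c(1-4) by (simp add: r_distr m_ac)
  also have "\<dots> = b \<otimes> (x \<otimes> m \<oplus> d \<otimes> y)" unfolding da using d c(1-4) m(1) by (simp add: r_distr m_ac)
  finally have "b divides d" using d c m by (intro dividesI[of "x \<otimes> m \<oplus> d \<otimes> y"]) auto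
  then show ?case using Suc by (simp add: d_def)
qed

abbreviation "Q \<equiv> frac_field R"
abbreviation "of_R a \<equiv> frac a \<one>"

text \<open>The list \<open>q\<close> starts with the leading coefficient. Multiplied by a power of
  the denominator \<open>b\<close>, the equation shows that \<open>b\<close> divides the leading
  coefficient times a power of \<open>a\<close>, and that \<open>a\<close> divides the constant
  coefficient times a power of \<open>b\<close>; coprimality removes the powers.\<close>

lemma rational_root:
  assumes v: "v \<in> carrier Q" and q: "set q \<subseteq> carrier R" "q \<noteq> []" "hd q \<noteq> \<zero>" "last q \<noteq> \<zero>"
    and root: "ring.eval Q (map of_R q) v = \<zero>\<^bsub>Q\<^esub>"
  shows "\<exists>a\<in>carrier R. \<exists>b\<in>carrier R - {\<zero>}. v = frac a b \<and> b divides hd q \<and> a divides last q"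
proof -
  interpret Q: field Q by (rule frac_field_field)
  interpret j: ring_hom_ring R Q of_R
    by (intro ring_hom_ringI2 frac_embed_hom ring_axioms Q.ring_axioms)
  have j_inj: "of_R x = of_R y \<longleftrightarrow> x = y" if "x \<in> carrier R" "y \<in> carrier R" for x y
    using that frac_embed_inj by (auto dest: inj_onD)
  obtain a b x y where ab: "a \<in> carrier R" "b \<in> carrier R - {\<zero>}" "v = frac a b"
    and xy: "x \<in> carrier R" "y \<in> carrier R" "x \<otimes> a \<oplus> y \<otimes> b = \<one>"
    using frac_coprime_rep[OF v] .
  have bc: "b \<in> carrier R" "of_R b \<in> carrier Q" using ab by (auto simp: frac_closed)
  have bv: "of_R b \<otimes>\<^bsub>Q\<^esub> v = of_R a"
    using frac_eq_div[OF ab(1,2)] v bc by (simp add: ab(3)[symmetric] Q.m_comm)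
  have jpow: "of_R (x [^] k) = of_R x [^]\<^bsub>Q\<^esub> k" if "x \<in> carrier R" for x and k :: nat
    using that by (induction k) auto
  have bvn: "of_R b [^]\<^bsub>Q\<^esub> n \<otimes>\<^bsub>Q\<^esub> v [^]\<^bsub>Q\<^esub> n = of_R (a [^] n)" for n :: nat
    using bv v bc ab(1) by (simp add: Q.nat_pow_distrib[symmetric] jpow)
  \<comment> \<open>The degree is one less than the length, so \<open>b\<close> to the power
    \<open>length q\<close> clears the denominator with one factor \<open>b\<close> to spare. Hence
    the multiple of \<open>b\<close> on the right.\<close>
  have A: "set q \<subseteq> carrier R \<Longrightarrow>
    \<exists>m\<in>carrier R. of_R b [^]\<^bsub>Q\<^esub> length q \<otimes>\<^bsub>Q\<^esub> Q.eval (map of_R q) v = of_R (b \<otimes> m)" for q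
  proof (induction q)
    case Nil
    show ?case using bc by (intro bexI[of _ \<zero>]) auto
  next
    case (Cons c q)
    then obtain m where m: "m \<in> carrier R"
      "of_R b [^]\<^bsub>Q\<^esub> length q \<otimes>\<^bsub>Q\<^esub> Q.eval (map of_R q) v = of_R (b \<otimes> m)" by auto
    have c: "c \<in> carrier R" "of_R c \<in> carrier Q" using Cons.prems by auto
    have ev: "Q.eval (map of_R q) v \<in> carrier Q"
      using Cons.prems v by (intro Q.eval_in_carrier) auto
    have "of_R b [^]\<^bsub>Q\<^esub> length (c # q) \<otimes>\<^bsub>Q\<^esub> Q.eval (map of_R (c # q)) v =
      of_R b \<otimes>\<^bsub>Q\<^esub> (of_R c \<otimes>\<^bsub>Q\<^esub> (of_R b [^]\<^bsub>Q\<^esub> length q \<otimes>\<^bsub>Q\<^esub> v [^]\<^bsub>Q\<^esub> length q)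
        \<oplus>\<^bsub>Q\<^esub> of_R b [^]\<^bsub>Q\<^esub> length q \<otimes>\<^bsub>Q\<^esub> Q.eval (map of_R q) v)"
      using c bc(2) v ev by (simp add: Q.r_distr Q.m_ac)
    also have "\<dots> = of_R (b \<otimes> (c \<otimes> a [^] length q \<oplus> b \<otimes> m))"
      unfolding bvn m(2) using c(1) ab(1) bc(1) m(1) by simp
    finally show ?case using c ab(1) bc m by (intro bexI[of _ "c \<otimes> a [^] length q \<oplus> b \<otimes> m"]) auto
  qed
  obtain c q' where cq: "q = c # q'" using q by (cases q) auto
  have "b divides c"
  proof -
    have cc: "c \<in> carrier R" "set q' \<subseteq> carrier R" "of_R c \<in> carrier Q" using q cq by auto
    obtain m where m: "m \<in> carrier R"
      "of_R b [^]\<^bsub>Q\<^esub> length q' \<otimes>\<^bsub>Q\<^esub> Q.eval (map of_R q') v = of_R (b \<otimes> m)" using A[OF cc(2)] by auto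
    have ev: "Q.eval (map of_R q') v \<in> carrier Q" using cc v by (intro Q.eval_in_carrier) auto
    have "\<zero>\<^bsub>Q\<^esub> = of_R b [^]\<^bsub>Q\<^esub> length q' \<otimes>\<^bsub>Q\<^esub> (of_R c \<otimes>\<^bsub>Q\<^esub> v [^]\<^bsub>Q\<^esub> length q' \<oplus>\<^bsub>Q\<^esub> Q.eval (map of_R q') v)"
      using root bc by (simp add: cq)
    also have "\<dots> = of_R c \<otimes>\<^bsub>Q\<^esub> (of_R b [^]\<^bsub>Q\<^esub> length q' \<otimes>\<^bsub>Q\<^esub> v [^]\<^bsub>Q\<^esub> length q') \<oplus>\<^bsub>Q\<^esub>
        of_R b [^]\<^bsub>Q\<^esub> length q' \<otimes>\<^bsub>Q\<^esub> Q.eval (map of_R q') v"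
      using cc bc(2) v ev by (simp add: Q.r_distr Q.m_ac)
    also have "\<dots> = of_R (c \<otimes> a [^] length q' \<oplus> b \<otimes> m)"
      unfolding bvn m(2) using cc ab(1) bc(1) m(1) by simp
    finally have "of_R \<zero> = of_R (c \<otimes> a [^] length q' \<oplus> b \<otimes> m)" by simp
    then have "c \<otimes> a [^] length q' \<oplus> b \<otimes> m = \<zero>"
      using cc ab(1) bc(1) m(1) by (subst (asm) j_inj) auto
    then have "c \<otimes> a [^] length q' = b \<otimes> (\<ominus> m)"
      using cc ab(1) bc(1) m(1) by (simp add: r_minus minus_equality[symmetric])
    then have "b divides c \<otimes> a [^] length q'" using m by (intro dividesI[of "\<ominus> m"]) auto
    then show ?thesis using coprime_cancel[OF xy(1,2) ab(1) bc(1) xy(3) cc(1)] by blast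
  qed
  \<comment> \<open>Now the constant coefficient is split off at the other end. The spare factor
    \<open>b\<close> of the remaining part meets the factor \<open>v\<close> and becomes
    \<open>a\<close>.\<close>
  moreover obtain d q'' where dq: "q = q'' @ [d]" using q by (cases q rule: rev_cases) auto
  have "a divides d"
  proof -
    have cc: "d \<in> carrier R" "set q'' \<subseteq> carrier R" "of_R d \<in> carrier Q" using q dq by auto
    have set_j: "set (map of_R q'') \<subseteq> carrier Q" using cc by auto
    obtain m where m: "m \<in> carrier R"
      "of_R b [^]\<^bsub>Q\<^esub> length q'' \<otimes>\<^bsub>Q\<^esub> Q.eval (map of_R q'') v = of_R (b \<otimes> m)" using A[OF cc(2)] by auto
    have ev: "Q.eval (map of_R q'') v \<in> carrier Q" using cc v by (intro Q.eval_in_carrier) auto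
    have "\<zero>\<^bsub>Q\<^esub> = of_R b [^]\<^bsub>Q\<^esub> length q'' \<otimes>\<^bsub>Q\<^esub> (Q.eval (map of_R q'') v \<otimes>\<^bsub>Q\<^esub> v \<oplus>\<^bsub>Q\<^esub> of_R d)"
      using root bc Q.eval_append_aux[OF set_j cc(3) v] by (simp add: dq)
    also have "\<dots> = (of_R b [^]\<^bsub>Q\<^esub> length q'' \<otimes>\<^bsub>Q\<^esub> Q.eval (map of_R q'') v) \<otimes>\<^bsub>Q\<^esub> v \<oplus>\<^bsub>Q\<^esub>
        of_R b [^]\<^bsub>Q\<^esub> length q'' \<otimes>\<^bsub>Q\<^esub> of_R d"
      using cc bc(2) v ev by (simp add: Q.r_distr Q.m_ac)
    also have "\<dots> = of_R m \<otimes>\<^bsub>Q\<^esub> (of_R b \<otimes>\<^bsub>Q\<^esub> v) \<oplus>\<^bsub>Q\<^esub> of_R b [^]\<^bsub>Q\<^esub> length q'' \<otimes>\<^bsub>Q\<^esub> of_R d"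
      unfolding m(2) using bc m(1) v by (simp add: Q.m_ac)
    also have "\<dots> = of_R (m \<otimes> a \<oplus> b [^] length q'' \<otimes> d)"
      unfolding bv using cc ab(1) bc(1) m(1) by (simp add: jpow)
    finally have "of_R \<zero> = of_R (m \<otimes> a \<oplus> b [^] length q'' \<otimes> d)" by simp
    then have 0: "m \<otimes> a \<oplus> b [^] length q'' \<otimes> d = \<zero>"
      using cc ab(1) bc(1) m(1) by (subst (asm) j_inj) auto
    have "d \<otimes> b [^] length q'' = \<ominus> (m \<otimes> a)"
      using 0 cc ab(1) bc(1) m(1) by (metis a_comm m_closed m_comm minus_equality nat_pow_closed)
    then have "d \<otimes> b [^] length q'' = a \<otimes> (\<ominus> m)" using ab(1) m(1) by (simp add: r_minus m_comm)
    then have "a divides d \<otimes> b [^] length q''" using m by (intro dividesI[of "\<ominus> m"]) auto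
    moreover have "y \<otimes> b \<oplus> x \<otimes> a = \<one>" using xy ab bc by (simp add: a_comm)
    ultimately show ?thesis using coprime_cancel[OF xy(2,1) bc(1) ab(1) _ cc(1)] by blast
  qed
  moreover have "hd q = c" "last q = d" using cq dq by (simp, metis last_snoc)
  ultimately have "b divides hd q" "a divides last q" by simp_all
  then show ?thesis using ab by blast
qed

end

section \<open>Common denominators and extension of homomorphisms to fractions\<close>

text \<open>One multiplier serves the whole list, so it scales a polynomial without changing its
  roots.\<close>

lemma (in domain) clear_denominators:
  "set p \<subseteq> carrier (frac_field R) \<Longrightarrow>
   \<exists>d\<in>carrier R - {\<zero>}. \<exists>q. set q \<subseteq> carrier R \<and>
     map (\<lambda>x. frac d \<one> \<otimes>\<^bsub>frac_field R\<^esub> x) p = map (\<lambda>c. frac c \<one>) q"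
proof (induction p)
  case Nil
  show ?case by (intro bexI[of _ \<one>] exI[of _ "[]"]) auto
next
  case (Cons x p)
  interpret Q: field "frac_field R" by (rule frac_field_field)
  obtain d q where d: "d \<in> carrier R - {\<zero>}" and q: "set q \<subseteq> carrier R"
    and eq: "map (\<lambda>x. frac d \<one> \<otimes>\<^bsub>frac_field R\<^esub> x) p = map (\<lambda>c. frac c \<one>) q"
    using Cons by auto
  obtain a b where ab: "a \<in> carrier R" "b \<in> carrier R - {\<zero>}" "x = frac a b"
    using Cons.prems by (auto simp: frac_field_carrier)
  have one: "\<one> \<in> carrier R - {\<zero>}" by auto
  have db: "d \<otimes> b \<in> carrier R - {\<zero>}" using d ab by (auto simp: integral_iff)
  have split: "frac (d \<otimes> b) \<one> = frac b \<one> \<otimes>\<^bsub>frac_field R\<^esub> frac d \<one>"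
    using d ab by (simp add: frac_mult one m_comm)
  have "frac (d \<otimes> b) \<one> \<otimes>\<^bsub>frac_field R\<^esub> x = frac (d \<otimes> a) \<one>"
    using d ab db by (simp add: frac_mult frac_eq_iff one m_ac)
  moreover have "map (\<lambda>x. frac (d \<otimes> b) \<one> \<otimes>\<^bsub>frac_field R\<^esub> x) p = map (\<lambda>c. frac c \<one>) (map (\<lambda>c. b \<otimes> c) q)"
  proof -
    have "map (\<lambda>x. frac (d \<otimes> b) \<one> \<otimes>\<^bsub>frac_field R\<^esub> x) p = map (\<lambda>y. frac b \<one> \<otimes>\<^bsub>frac_field R\<^esub> y) (map (\<lambda>x. frac d \<one> \<otimes>\<^bsub>frac_field R\<^esub> x) p)"
      unfolding split using Cons.prems d ab by (auto simp: Q.m_assoc frac_closed)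
    also have "\<dots> = map (\<lambda>c. frac c \<one>) (map (\<lambda>c. b \<otimes> c) q)"
      unfolding eq using q ab by (auto simp: frac_mult)
    finally show ?thesis .
  qed
  ultimately show ?case
    using d ab q db
    by (intro bexI[of _ "d \<otimes> b"] exI[of _ "(d \<otimes> a) # map (\<lambda>c. b \<otimes> c) q"]) auto
qed

text \<open>The universal property of the fraction field. The map is defined through a chosen
  numerator and denominator, and cross multiplication gives the same value for any other
  choice.\<close>

lemma (in domain) frac_field_extend_hom:
  assumes U: "field U" and \<phi>: "\<phi> \<in> ring_hom R U" and inj: "\<And>b. b \<in> carrier R - {\<zero>} \<Longrightarrow> \<phi> b \<noteq> \<zero>\<^bsub>U\<^esub>"
  obtains \<theta> where "\<theta> \<in> ring_hom (frac_field R) U"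
    "\<And>a b. a \<in> carrier R \<Longrightarrow> b \<in> carrier R - {\<zero>} \<Longrightarrow> \<theta> (frac a b) = \<phi> a \<otimes>\<^bsub>U\<^esub> inv\<^bsub>U\<^esub> \<phi> b"
proof -
  interpret U: field U by fact
  define rep where "rep A = (SOME p. fst p \<in> carrier R \<and> snd p \<in> carrier R - {\<zero>} \<and> A = frac (fst p) (snd p))" for A
  define \<theta> where "\<theta> A = \<phi> (fst (rep A)) \<otimes>\<^bsub>U\<^esub> inv\<^bsub>U\<^esub> \<phi> (snd (rep A))" for A
  have \<phi>c: "\<phi> a \<in> carrier U" if "a \<in> carrier R" for a using ring_hom_closed[OF \<phi> that] .
  have \<phi>u: "\<phi> b \<in> Units U" "inv\<^bsub>U\<^esub> \<phi> b \<in> carrier U" if "b \<in> carrier R - {\<zero>}" for b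
  proof -
    show "\<phi> b \<in> Units U" using \<phi>c that inj by (simp add: U.field_Units)
    then show "inv\<^bsub>U\<^esub> \<phi> b \<in> carrier U" by simp
  qed
  have \<theta>: "\<theta> (frac a b) = \<phi> a \<otimes>\<^bsub>U\<^esub> inv\<^bsub>U\<^esub> \<phi> b" if a: "a \<in> carrier R" and b: "b \<in> carrier R - {\<zero>}" for a b
  proof -
    define c d where "c = fst (rep (frac a b))" and "d = snd (rep (frac a b))"
    have "fst (rep (frac a b)) \<in> carrier R \<and> snd (rep (frac a b)) \<in> carrier R - {\<zero>} \<and>
      frac a b = frac (fst (rep (frac a b))) (snd (rep (frac a b)))"
      unfolding rep_def by (rule someI[of _ "(a, b)"]) (use a b in auto)
    then have cd: "c \<in> carrier R" "d \<in> carrier R - {\<zero>}" "frac a b = frac c d" by (auto simp: c_def d_def)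
    then have "a \<otimes> d = c \<otimes> b" using a b frac_eq_iff by blast
    then have e: "\<phi> a \<otimes>\<^bsub>U\<^esub> \<phi> d = \<phi> c \<otimes>\<^bsub>U\<^esub> \<phi> b"
      using a b cd ring_hom_mult[OF \<phi>] by (metis DiffD1)
    have "\<phi> a \<otimes>\<^bsub>U\<^esub> inv\<^bsub>U\<^esub> \<phi> b = (\<phi> a \<otimes>\<^bsub>U\<^esub> \<phi> d) \<otimes>\<^bsub>U\<^esub> (inv\<^bsub>U\<^esub> \<phi> d \<otimes>\<^bsub>U\<^esub> inv\<^bsub>U\<^esub> \<phi> b)"
    proof -
      have "(\<phi> a \<otimes>\<^bsub>U\<^esub> \<phi> d) \<otimes>\<^bsub>U\<^esub> (inv\<^bsub>U\<^esub> \<phi> d \<otimes>\<^bsub>U\<^esub> inv\<^bsub>U\<^esub> \<phi> b) = \<phi> a \<otimes>\<^bsub>U\<^esub> ((\<phi> d \<otimes>\<^bsub>U\<^esub> inv\<^bsub>U\<^esub> \<phi> d) \<otimes>\<^bsub>U\<^esub> inv\<^bsub>U\<^esub> \<phi> b)"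
        using \<phi>c[OF a] \<phi>c[of d] cd \<phi>u(2)[OF b] \<phi>u(2)[OF cd(2)] by (simp add: U.m_assoc)
      then show ?thesis using \<phi>u[OF cd(2)] \<phi>u[OF b] by simp
    qed
    also have "\<dots> = \<phi> c \<otimes>\<^bsub>U\<^esub> inv\<^bsub>U\<^esub> \<phi> d"
    proof -
      have "(\<phi> c \<otimes>\<^bsub>U\<^esub> \<phi> b) \<otimes>\<^bsub>U\<^esub> (inv\<^bsub>U\<^esub> \<phi> d \<otimes>\<^bsub>U\<^esub> inv\<^bsub>U\<^esub> \<phi> b) = \<phi> c \<otimes>\<^bsub>U\<^esub> ((\<phi> b \<otimes>\<^bsub>U\<^esub> inv\<^bsub>U\<^esub> \<phi> b) \<otimes>\<^bsub>U\<^esub> inv\<^bsub>U\<^esub> \<phi> d)"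
        using \<phi>c[OF cd(1)] \<phi>c[of b] b \<phi>u(2)[OF b] \<phi>u(2)[OF cd(2)] by (simp add: U.m_ac)
      then show ?thesis unfolding e using \<phi>u[OF cd(2)] \<phi>u[OF b] by simp
    qed
    finally show ?thesis by (simp add: \<theta>_def c_def d_def)
  qed
  interpret Q: field "frac_field R" by (rule frac_field_field)
  have one: "\<one> \<in> carrier R - {\<zero>}" by auto
  have "\<theta> \<in> ring_hom (frac_field R) U"
  proof (rule ring_hom_memI)
    fix x assume "x \<in> carrier (frac_field R)"
    then obtain a b where "a \<in> carrier R" "b \<in> carrier R - {\<zero>}" "x = frac a b"
      unfolding frac_field_carrier by blast
    then show "\<theta> x \<in> carrier U" using \<phi>c \<phi>u(2) by (simp add: \<theta>)
  next
    fix x y assume "x \<in> carrier (frac_field R)" "y \<in> carrier (frac_field R)"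
    then obtain a b c d where *: "a \<in> carrier R" "b \<in> carrier R - {\<zero>}" "x = frac a b"
      "c \<in> carrier R" "d \<in> carrier R - {\<zero>}" "y = frac c d"
      unfolding frac_field_carrier by blast
    have bd: "b \<otimes> d \<in> carrier R - {\<zero>}" using * by (auto simp: integral_iff)
    note cl = \<phi>c[OF *(1)] \<phi>c[OF *(4)] \<phi>u(2)[OF *(2)] \<phi>u(2)[OF *(5)] Units_closed
    have u: "\<phi> b \<in> carrier U" "\<phi> d \<in> carrier U" using * \<phi>c by auto
    have i: "inv\<^bsub>U\<^esub> \<phi> (b \<otimes> d) = inv\<^bsub>U\<^esub> \<phi> b \<otimes>\<^bsub>U\<^esub> inv\<^bsub>U\<^esub> \<phi> d"
    proof -
      have e: "\<phi> (b \<otimes> d) = \<phi> b \<otimes>\<^bsub>U\<^esub> \<phi> d" using * ring_hom_mult[OF \<phi>] by auto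
      have "(\<phi> b \<otimes>\<^bsub>U\<^esub> \<phi> d) \<otimes>\<^bsub>U\<^esub> (inv\<^bsub>U\<^esub> \<phi> b \<otimes>\<^bsub>U\<^esub> inv\<^bsub>U\<^esub> \<phi> d) =
          (\<phi> b \<otimes>\<^bsub>U\<^esub> inv\<^bsub>U\<^esub> \<phi> b) \<otimes>\<^bsub>U\<^esub> (\<phi> d \<otimes>\<^bsub>U\<^esub> inv\<^bsub>U\<^esub> \<phi> d)"
        using u cl(3,4) by (simp add: U.m_ac)
      also have "\<dots> = \<one>\<^bsub>U\<^esub>" using \<phi>u(1)[OF *(2)] \<phi>u(1)[OF *(5)] by simp
      finally show ?thesis unfolding e using u cl(3,4) by (intro U.comm_inv_char) auto
    qed
    show "\<theta> (x \<otimes>\<^bsub>frac_field R\<^esub> y) = \<theta> x \<otimes>\<^bsub>U\<^esub> \<theta> y"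
      using * bd cl ring_hom_mult[OF \<phi>, of a c] by (simp add: frac_mult \<theta> i U.m_ac)
    have "\<phi> (a \<otimes> d \<oplus> c \<otimes> b) = \<phi> a \<otimes>\<^bsub>U\<^esub> \<phi> d \<oplus>\<^bsub>U\<^esub> \<phi> c \<otimes>\<^bsub>U\<^esub> \<phi> b"
      using * by (simp add: ring_hom_add[OF \<phi>] ring_hom_mult[OF \<phi>])
    then have "\<theta> (x \<oplus>\<^bsub>frac_field R\<^esub> y) =
      (\<phi> a \<otimes>\<^bsub>U\<^esub> \<phi> d \<oplus>\<^bsub>U\<^esub> \<phi> c \<otimes>\<^bsub>U\<^esub> \<phi> b) \<otimes>\<^bsub>U\<^esub> (inv\<^bsub>U\<^esub> \<phi> b \<otimes>\<^bsub>U\<^esub> inv\<^bsub>U\<^esub> \<phi> d)"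
      using * bd by (simp add: frac_add \<theta> i)
    also have "\<dots> = \<phi> a \<otimes>\<^bsub>U\<^esub> inv\<^bsub>U\<^esub> \<phi> b \<otimes>\<^bsub>U\<^esub> (\<phi> d \<otimes>\<^bsub>U\<^esub> inv\<^bsub>U\<^esub> \<phi> d) \<oplus>\<^bsub>U\<^esub> \<phi> c \<otimes>\<^bsub>U\<^esub> inv\<^bsub>U\<^esub> \<phi> d \<otimes>\<^bsub>U\<^esub> (\<phi> b \<otimes>\<^bsub>U\<^esub> inv\<^bsub>U\<^esub> \<phi> b)"
      using cl(1-4) u by (simp add: U.l_distr U.r_distr U.m_ac)
    also have "\<dots> = \<theta> x \<oplus>\<^bsub>U\<^esub> \<theta> y"
      using * cl(1-4) \<phi>u(1)[OF *(2)] \<phi>u(1)[OF *(5)] by (simp add: \<theta>)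
    finally show "\<theta> (x \<oplus>\<^bsub>frac_field R\<^esub> y) = \<theta> x \<oplus>\<^bsub>U\<^esub> \<theta> y" .
  next
    show "\<theta> \<one>\<^bsub>frac_field R\<^esub> = \<one>\<^bsub>U\<^esub>" using ring_hom_one[OF \<phi>] by (simp add: frac_one \<theta> one)
  qed
  then show thesis using that \<theta> by blast
qed

section \<open>Rational functions over an ultraproduct\<close>

text \<open>Substituting the variable for itself. Normalisation is present because coefficient lists
  of a prescribed length may begin with zeros.\<close>

lemma (in domain) eval_poly_of_const:
  assumes "set q \<subseteq> carrier R"
  shows "ring.eval (poly_ring R) (map poly_of_const q) X = normalize q"
proof -
  interpret P: domain "poly_ring R" by (rule univ_poly_is_domain[OF carrier_is_subring])
  have X: "X \<in> carrier (poly_ring R)" by (rule var_closed(1)[OF carrier_is_subring])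
  have "P.eval (map poly_of_const (normalize q)) X = P.eval (map poly_of_const q) X"
    using assms
  proof (induction q)
    case (Cons a q)
    have "set (map poly_of_const q) \<subseteq> carrier (poly_ring R)"
      using Cons.prems by (auto simp: poly_of_const_def univ_poly_def polynomial_def)
    then have "P.eval (map poly_of_const q) X \<in> carrier (poly_ring R)"
      using X by (rule P.eval_in_carrier)
    moreover have "poly_of_const \<zero> = \<zero>\<^bsub>poly_ring R\<^esub>" by (simp add: poly_of_const_def univ_poly_def)
    ultimately show ?case using Cons X by simp
  qed simp
  moreover have "normalize q \<in> carrier (poly_ring R)"
    using normalize_gives_polynomial[OF assms] by (simp add: univ_poly_carrier)
  ultimately show ?thesis using eval_rewrite[OF carrier_is_subring] by metis
qed

text \<open>The homomorphism may kill leading coefficients, so the mapped lists agree only up to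
  leading zeros, which evaluation does not see.\<close>

lemma (in ring_hom_ring) eval_map_hom:
  assumes x: "x \<in> carrier S" and p: "set p \<subseteq> carrier R" and q: "set q \<subseteq> carrier R" and S: "cring S"
  shows "S.eval (map h (R.poly_add p q)) x = S.eval (map h p) x \<oplus>\<^bsub>S\<^esub> S.eval (map h q) x"
    "S.eval (map h (R.poly_mult p q)) x = S.eval (map h p) x \<otimes>\<^bsub>S\<^esub> S.eval (map h q) x"
proof -
  have hp: "set (map h p) \<subseteq> carrier S" "set (map h q) \<subseteq> carrier S" using p q by auto
  have a: "set (map h (R.poly_add p q)) \<subseteq> carrier S" using R.poly_add_in_carrier[OF p q] by auto
  have m: "set (map h (R.poly_mult p q)) \<subseteq> carrier S" using R.poly_mult_in_carrier[OF p q] by auto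
  show "S.eval (map h (R.poly_add p q)) x = S.eval (map h p) x \<oplus>\<^bsub>S\<^esub> S.eval (map h q) x"
    using S.eval_normalize[OF a x] S.eval_poly_add[OF hp x] poly_add_hom'[OF p q] by metis
  show "S.eval (map h (R.poly_mult p q)) x = S.eval (map h p) x \<otimes>\<^bsub>S\<^esub> S.eval (map h q) x"
    using S.eval_normalize[OF m x] cring.eval_poly_mult[OF S hp x] poly_mult_hom'[OF p q] by metis
qed

lemma (in ring_hom_ring) eval_map_poly_hom:
  assumes x: "x \<in> carrier S" and S: "cring S"
  shows "(\<lambda>p. S.eval (map h p) x) \<in> ring_hom (poly_ring R) S"
proof (rule ring_hom_memI)
  have c: "set p \<subseteq> carrier R" if "p \<in> carrier (poly_ring R)" for p
    using that by (auto simp: univ_poly_def polynomial_def)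
  fix p assume p: "p \<in> carrier (poly_ring R)"
  show "S.eval (map h p) x \<in> carrier S" using c[OF p] x by (intro S.eval_in_carrier) auto
  fix q assume q: "q \<in> carrier (poly_ring R)"
  show "S.eval (map h (p \<otimes>\<^bsub>poly_ring R\<^esub> q)) x = S.eval (map h p) x \<otimes>\<^bsub>S\<^esub> S.eval (map h q) x"
    "S.eval (map h (p \<oplus>\<^bsub>poly_ring R\<^esub> q)) x = S.eval (map h p) x \<oplus>\<^bsub>S\<^esub> S.eval (map h q) x"
    using eval_map_hom[OF x c[OF p] c[OF q] S] by (simp_all add: univ_poly_mult univ_poly_add)
next
  show "S.eval (map h \<one>\<^bsub>poly_ring R\<^esub>) x = \<one>\<^bsub>S\<^esub>" using x by (simp add: univ_poly_one)
qed

lemma (in field) poly_divides_length: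
  assumes "a \<in> carrier (poly_ring R)" "c \<in> carrier (poly_ring R)" "c \<noteq> []" "a divides\<^bsub>poly_ring R\<^esub> c"
  shows "length a \<le> length c"
proof -
  obtain m where m: "m \<in> carrier (poly_ring R)" "c = a \<otimes>\<^bsub>poly_ring R\<^esub> m" using assms by (auto simp: factor_def)
  interpret P: domain "poly_ring R" by (rule univ_poly_is_domain[OF carrier_is_subring])
  have "a \<noteq> []" using assms(3) m(2) P.l_null[OF m(1)] unfolding univ_poly_zero by blast
  moreover have "m \<noteq> []" using assms(3) m(2) P.r_null[OF assms(1)] unfolding univ_poly_zero by blast
  ultimately have "degree c = degree a + degree m"
    unfolding m(2) univ_poly_mult
    using poly_mult_degree_eq[OF carrier_is_subring, of a m] m(1) assms(1) by (simp only: univ_poly_carrier if_False simp_thms)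
  moreover have "length c = Suc (degree c)" "length a = Suc (degree a)" using assms(3) \<open>a \<noteq> []\<close> by auto
  ultimately show ?thesis by linarith
qed

text \<open>With a fixed number of coefficients, evaluation is one fixed term in addition and
  multiplication.\<close>

lemma (in ultralimit) ulim_eval:
  assumes R: "\<And>s. s \<in> S \<Longrightarrow> ring (R s)" and M: "ring M" and v: "v \<in> fam" and gs: "set gs \<subseteq> fam"
  shows "(\<lambda>s. ring.eval (R s) (map (\<lambda>g. g s) gs) (v s)) \<in> fam \<and>
    ring.eval M (map ulim gs) (ulim v) = ulim (\<lambda>s. ring.eval (R s) (map (\<lambda>g. g s) gs) (v s))"
  using gs
proof (induction gs)
  case Nil
  have "(\<lambda>s. ring.eval (R s) (map (\<lambda>g. g s) []) (v s)) \<in> fam"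
    using fam_zero by (auto simp: ring.eval.simps[OF R])
  moreover from ulim_cong[OF this, of "\<lambda>s. \<zero>\<^bsub>R s\<^esub>"] have
    "ulim (\<lambda>s. ring.eval (R s) (map (\<lambda>g. g s) []) (v s)) = \<zero>\<^bsub>M\<^esub>"
    unfolding ulim_zero by (simp add: ring.eval.simps[OF R])
  ultimately show ?case by (simp add: ring.eval.simps[OF M])
next
  case (Cons g gs)
  have pow: "(\<lambda>s. v s [^]\<^bsub>R s\<^esub> n) \<in> fam \<and> ulim v [^]\<^bsub>M\<^esub> n = ulim (\<lambda>s. v s [^]\<^bsub>R s\<^esub> n)" for n :: nat
    using v by (induction n) (auto simp: fam_one ulim_one ulim_mult fam_mult)
  define e where "e s = ring.eval (R s) (map (\<lambda>g. g s) gs) (v s)" for s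
  have e: "e \<in> fam" "ring.eval M (map ulim gs) (ulim v) = ulim e"
    using Cons unfolding e_def by auto
  have eq: "ring.eval (R s) (map (\<lambda>g. g s) (g # gs)) (v s) = g s \<otimes>\<^bsub>R s\<^esub> v s [^]\<^bsub>R s\<^esub> length gs \<oplus>\<^bsub>R s\<^esub> e s"
    if "s \<in> S" for s
    using ring.eval.simps(2)[OF R[OF that]] by (simp add: e_def)
  have f: "(\<lambda>s. g s \<otimes>\<^bsub>R s\<^esub> v s [^]\<^bsub>R s\<^esub> length gs \<oplus>\<^bsub>R s\<^esub> e s) \<in> fam"
    using Cons.prems pow e by (intro fam_add fam_mult) auto
  have "ring.eval M (map ulim (g # gs)) (ulim v) = ulim g \<otimes>\<^bsub>M\<^esub> ulim v [^]\<^bsub>M\<^esub> length gs \<oplus>\<^bsub>M\<^esub> ulim e"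
    using e(2) ring.eval.simps(2)[OF M] by simp
  also have "\<dots> = ulim (\<lambda>s. g s \<otimes>\<^bsub>R s\<^esub> v s [^]\<^bsub>R s\<^esub> length gs \<oplus>\<^bsub>R s\<^esub> e s)"
    using Cons.prems pow[of "length gs"] e(1) by (simp add: ulim_mult ulim_add fam_mult)
  also have "\<dots> = ulim (\<lambda>s. ring.eval (R s) (map (\<lambda>g. g s) (g # gs)) (v s))"
    by (rule ulim_cong[OF f]) (simp only: eq)
  finally show ?case using f eq by (auto simp: Pi_iff)
qed

section \<open>Rational functions over the ultraproduct inside the ultraproduct of rational function
  fields\<close>

locale ratfun_limit = ultrafilter_on S D for S :: "'s set" and D +
  fixes F :: "'s \<Rightarrow> ('a, 'b) ring_scheme"
  assumes F: "s \<in> S \<Longrightarrow> field (F s)"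
begin

abbreviation "K \<equiv> ultraprod S D F"
abbreviation "L s \<equiv> rat_fun_field (F s)"
abbreviation "U \<equiv> ultraprod S D L"
abbreviation "klim \<equiv> ulim_cls S D F"
abbreviation "ulim \<equiv> ulim_cls S D L"
abbreviation "P s \<equiv> poly_ring (F s)"

lemma P_principal: "s \<in> S \<Longrightarrow> principal_domain (P s)"
  using F domain.univ_poly_is_principal field.carrier_is_subfield field.axioms(1) by blast

lemma P_domain: "s \<in> S \<Longrightarrow> domain (P s)"
  using P_principal principal_domain.axioms(1) by blast

lemma L_field: "s \<in> S \<Longrightarrow> field (L s)"
  unfolding rat_fun_field_def by (rule domain.frac_field_field[OF P_domain])

sublocale K: ultralimit S D F K klim
  by (rule ultralimit_ultraprod) (rule field_closed_ring[OF F])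

sublocale U: ultralimit S D L U ulim
  by (rule ultralimit_ultraprod) (rule field_closed_ring[OF L_field])

lemma K_field: "field K"
  using losD[OF K.los_field] ae_all[of "\<lambda>s. field (F s)"] F by simp

lemma U_field: "field U"
  using losD[OF U.los_field] ae_all[of "\<lambda>s. field (L s)"] L_field by simp

sublocale K: field K by (rule K_field)
sublocale U: field U by (rule U_field)

definition "of_P s a = domain.frac (P s) a \<one>\<^bsub>P s\<^esub>"

lemma of_P_hom: "s \<in> S \<Longrightarrow> of_P s \<in> ring_hom (P s) (L s)"
  unfolding of_P_def rat_fun_field_def by (rule domain.frac_embed_hom[OF P_domain])

lemma of_P_ring_hom: "s \<in> S \<Longrightarrow> ring_hom_ring (P s) (L s) (of_P s)"
  using of_P_hom P_domain L_field
  by (intro ring_hom_ringI2) (auto simp: domain.axioms cring.axioms field.axioms)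

lemma of_P_inj: "s \<in> S \<Longrightarrow> a \<in> carrier (P s) \<Longrightarrow> b \<in> carrier (P s) \<Longrightarrow> of_P s a = of_P s b \<longleftrightarrow> a = b"
  unfolding of_P_def using domain.frac_embed_inj[OF P_domain] by (auto dest: inj_onD)

definition "const s c = of_P s (ring.poly_of_const (F s) c)"

lemma const_hom: "s \<in> S \<Longrightarrow> const s \<in> ring_hom (F s) (L s)"
proof -
  assume s: "s \<in> S"
  interpret F: field "F s" by (rule F[OF s])
  have "F.poly_of_const \<in> ring_hom (F s\<lparr>carrier := carrier (F s)\<rparr>) (P s)"
    by (rule F.canonical_embedding_is_hom[OF F.carrier_is_subring])
  then have "F.poly_of_const \<in> ring_hom (F s) (P s)" by (simp add: ring_hom_def)
  from ring_hom_trans[OF this of_P_hom[OF s]] show ?thesis by (simp add: const_def[abs_def] o_def)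
qed

definition rep :: "('s \<Rightarrow> 'a) set \<Rightarrow> 's \<Rightarrow> 'a" where
  "rep c = (SOME x. x \<in> K.fam \<and> klim x = c)"

lemma rep: "c \<in> carrier K \<Longrightarrow> rep c \<in> K.fam" "c \<in> carrier K \<Longrightarrow> klim (rep c) = c"
proof -
  assume "c \<in> carrier K"
  then have "\<exists>x. x \<in> K.fam \<and> klim x = c" using K.obtain_fam by metis
  from someI_ex[OF this] show "rep c \<in> K.fam" "klim (rep c) = c" by (auto simp: rep_def)
qed

text \<open>Embeds \<open>K\<close> in \<open>U\<close> as limits of constant functions. A
  representing family is chosen for \<open>c\<close>; by \<open>\<kappa>_klim\<close> any other
  gives the same value.\<close>

definition "\<kappa> c = ulim (\<lambda>s. const s (rep c s))"

lemma const_fam: "f \<in> K.fam \<Longrightarrow> (\<lambda>s. const s (f s)) \<in> U.fam"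
  using ring_hom_closed[OF const_hom] by (auto simp: Pi_iff)

lemma \<kappa>_klim: "f \<in> K.fam \<Longrightarrow> \<kappa> (klim f) = ulim (\<lambda>s. const s (f s))"
proof -
  assume f: "f \<in> K.fam"
  note r = rep[OF K.ulim_closed[OF f]]
  have "{s \<in> S. rep (klim f) s = f s} \<in> D" using K.ulim_eq[OF r(1) f] r(2) by simp
  then have "{s \<in> S. const s (rep (klim f) s) = const s (f s)} \<in> D" by (rule ae_mono) simp
  then show ?thesis unfolding \<kappa>_def using U.ulim_eq[OF const_fam[OF r(1)] const_fam[OF f]] by simp
qed

lemma \<kappa>_hom: "\<kappa> \<in> ring_hom K U"
proof (rule ring_hom_memI)
  fix c assume c: "c \<in> carrier K"
  show "\<kappa> c \<in> carrier U" unfolding \<kappa>_def by (rule U.ulim_closed[OF const_fam[OF rep(1)[OF c]]])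
next
  fix c d assume "c \<in> carrier K" "d \<in> carrier K"
  then obtain f g where fg: "f \<in> K.fam" "c = klim f" "g \<in> K.fam" "d = klim g" using K.obtain_fam by metis
  have "ulim (\<lambda>s. const s (f s \<otimes>\<^bsub>F s\<^esub> g s)) = ulim (\<lambda>s. const s (f s) \<otimes>\<^bsub>L s\<^esub> const s (g s))"
    using fg ring_hom_mult[OF const_hom] by (intro U.ulim_cong const_fam K.fam_mult) (auto simp: Pi_iff)
  then show "\<kappa> (c \<otimes>\<^bsub>K\<^esub> d) = \<kappa> c \<otimes>\<^bsub>U\<^esub> \<kappa> d"
    using fg by (simp add: K.ulim_mult \<kappa>_klim K.fam_mult U.ulim_mult const_fam)
  have "ulim (\<lambda>s. const s (f s \<oplus>\<^bsub>F s\<^esub> g s)) = ulim (\<lambda>s. const s (f s) \<oplus>\<^bsub>L s\<^esub> const s (g s))"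
    using fg ring_hom_add[OF const_hom] by (intro U.ulim_cong const_fam K.fam_add) (auto simp: Pi_iff)
  then show "\<kappa> (c \<oplus>\<^bsub>K\<^esub> d) = \<kappa> c \<oplus>\<^bsub>U\<^esub> \<kappa> d"
    using fg by (simp add: K.ulim_add \<kappa>_klim K.fam_add U.ulim_add const_fam)
next
  have "ulim (\<lambda>s. const s \<one>\<^bsub>F s\<^esub>) = ulim (\<lambda>s. \<one>\<^bsub>L s\<^esub>)"
    using ring_hom_one[OF const_hom] by (intro U.ulim_cong const_fam K.fam_one) auto
  then show "\<kappa> \<one>\<^bsub>K\<^esub> = \<one>\<^bsub>U\<^esub>" by (simp add: K.ulim_one \<kappa>_klim K.fam_one U.ulim_one)
qed

sublocale \<kappa>: ring_hom_ring K U \<kappa>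
  by (intro ring_hom_ringI2 \<kappa>_hom K.ring_axioms U.ring_axioms)

definition "XU = ulim (\<lambda>s. of_P s X\<^bsub>F s\<^esub>)"
text \<open>Embeds K[t] in \<open>U\<close> by sending t to the limit of the variables of the
  factors.\<close>

definition "ev p = U.eval (map \<kappa> p) XU"

lemma X_fam: "(\<lambda>s. of_P s X\<^bsub>F s\<^esub>) \<in> U.fam"
proof -
  have "X\<^bsub>F s\<^esub> \<in> carrier (P s)" if "s \<in> S" for s
    using F[OF that] by (intro domain.var_closed(1) ring.carrier_is_subring)
      (auto simp: domain.axioms cring.axioms field.axioms)
  then show ?thesis using ring_hom_closed[OF of_P_hom] by auto
qed

lemma XU_closed: "XU \<in> carrier U"
  unfolding XU_def by (rule U.ulim_closed[OF X_fam])

lemma ev_hom: "ev \<in> ring_hom (poly_ring K) U"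
  using \<kappa>.eval_map_poly_hom[OF XU_closed U.is_cring] by (simp add: ev_def[abs_def])

abbreviation "nrm s \<equiv> ring.normalize (F s)"

lemma norm_closed: "s \<in> S \<Longrightarrow> set q \<subseteq> carrier (F s) \<Longrightarrow> nrm s q \<in> carrier (P s)"
  using ring.normalize_gives_polynomial[of "F s" q "carrier (F s)"] F
  by (auto simp: univ_poly_carrier domain.axioms cring.axioms field.axioms)

text \<open>Links the two descriptions of a polynomial in \<open>U\<close>: limits of coefficients
  evaluated at \<open>XU\<close>, and the limit of the polynomials assembled at each
  \<open>s\<close>. It is used in both directions.\<close>

lemma eval_fam:
  assumes "set fs \<subseteq> K.fam"
  shows "U.eval (map (\<lambda>f. \<kappa> (klim f)) fs) XU = ulim (\<lambda>s. of_P s (nrm s (map (\<lambda>f. f s) fs)))"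
    "(\<lambda>s. of_P s (nrm s (map (\<lambda>f. f s) fs))) \<in> U.fam"
proof -
  let ?gs = "map (\<lambda>f s. const s (f s)) fs"
  have gs: "set ?gs \<subseteq> U.fam"
  proof
    fix g assume "g \<in> set ?gs"
    then obtain f where "f \<in> set fs" "g = (\<lambda>s. const s (f s))" by auto
    then show "g \<in> U.fam" using const_fam[of f] assms by blast
  qed
  have fsc: "set (map (\<lambda>f. f s) fs) \<subseteq> carrier (F s)" if s: "s \<in> S" for s
  proof
    fix x assume "x \<in> set (map (\<lambda>f. f s) fs)"
    then obtain f where "f \<in> set fs" "x = f s" by auto
    then show "x \<in> carrier (F s)" using assms s by blast
  qed
  show fam: "(\<lambda>s. of_P s (nrm s (map (\<lambda>f. f s) fs))) \<in> U.fam"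
    using fsc by (intro Pi_I ring_hom_closed[OF of_P_hom] norm_closed) auto
  have m: "map (\<lambda>f. \<kappa> (klim f)) fs = map ulim ?gs" using assms \<kappa>_klim by auto
  have "U.eval (map (\<lambda>f. \<kappa> (klim f)) fs) XU =
    ulim (\<lambda>s. ring.eval (L s) (map (\<lambda>g. g s) ?gs) (of_P s X\<^bsub>F s\<^esub>))"
    unfolding XU_def m
    by (rule conjunct2[OF U.ulim_eval[OF field.is_ring[OF L_field] U.ring_axioms X_fam gs]])
  also have "\<dots> = ulim (\<lambda>s. of_P s (nrm s (map (\<lambda>f. f s) fs)))"
  proof (rule U.ulim_cong[symmetric, OF fam])
    fix s assume s: "s \<in> S"
    interpret F: field "F s" by (rule F[OF s])
    interpret j: ring_hom_ring "P s" "L s" "of_P s" by (rule of_P_ring_hom[OF s])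
    let ?q = "map (\<lambda>f. f s) fs"
    have q: "set ?q \<subseteq> carrier (F s)" by (rule fsc[OF s])
    have q': "set (map F.poly_of_const ?q) \<subseteq> carrier (P s)"
      using q by (auto simp: F.poly_of_const_def univ_poly_def polynomial_def)
    have "of_P s (nrm s ?q) = of_P s (ring.eval (P s) (map F.poly_of_const ?q) X\<^bsub>F s\<^esub>)"
      using F.eval_poly_of_const[OF q] by simp
    also have "\<dots> = ring.eval (L s) (map (of_P s) (map F.poly_of_const ?q)) (of_P s X\<^bsub>F s\<^esub>)"
      by (rule j.eval_hom'[OF F.var_closed(1)[OF F.carrier_is_subring] q'])
    finally show "of_P s (nrm s ?q) = ring.eval (L s) (map (\<lambda>g. g s) ?gs) (of_P s X\<^bsub>F s\<^esub>)"
      by (simp add: const_def o_def)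
  qed
  finally show "U.eval (map (\<lambda>f. \<kappa> (klim f)) fs) XU = ulim (\<lambda>s. of_P s (nrm s (map (\<lambda>f. f s) fs)))" .
qed

text \<open>Normalised because the representative of the leading coefficient may vanish at some
  \<open>s\<close>.\<close>

definition "component p s = nrm s (map (\<lambda>c. rep c s) p)"

lemma poly_set: "p \<in> carrier (poly_ring K) \<Longrightarrow> set p \<subseteq> carrier K"
  by (auto simp: univ_poly_def polynomial_def)

lemma component:
  assumes p: "p \<in> carrier (poly_ring K)"
  shows "s \<in> S \<Longrightarrow> component p s \<in> carrier (P s)" "s \<in> S \<Longrightarrow> length (component p s) \<le> length p"
    "ev p = ulim (\<lambda>s. of_P s (component p s))" "(\<lambda>s. of_P s (component p s)) \<in> U.fam"
proof -
  have r: "set (map rep p) \<subseteq> K.fam" using rep(1) poly_set[OF p] by auto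
  have m: "map (\<lambda>f. \<kappa> (klim f)) (map rep p) = map \<kappa> p" using rep(2) poly_set[OF p] by auto
  show "ev p = ulim (\<lambda>s. of_P s (component p s))" "(\<lambda>s. of_P s (component p s)) \<in> U.fam"
    using eval_fam[OF r] unfolding m ev_def component_def by (simp_all add: component_def o_def)
  assume s: "s \<in> S"
  show "component p s \<in> carrier (P s)"
    unfolding component_def using r s by (intro norm_closed) auto
  show "length (component p s) \<le> length p"
    unfolding component_def using ring.normalize_length_le[OF field.is_ring[OF F[OF s]], of "map (\<lambda>c. rep c s) p"] by simp
qed

text \<open>A leading coefficient that is nonzero in \<open>K\<close> is nonzero at almost all
  \<open>s\<close>, and there no entry is stripped.\<close>

lemma component_nonzero:
  assumes p: "p \<in> carrier (poly_ring K)" "p \<noteq> []"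
  shows "{s \<in> S. component p s \<noteq> []} \<in> D"
proof -
  obtain c q where cq: "p = c # q" using p by (cases p) auto
  have c: "c \<in> carrier K" "c \<noteq> \<zero>\<^bsub>K\<^esub>" using p by (auto simp: cq univ_poly_def polynomial_def)
  have "klim (rep c) \<noteq> klim (\<lambda>s. \<zero>\<^bsub>F s\<^esub>)" using c rep(2)[OF c(1)] K.ulim_zero by simp
  then have "{s \<in> S. rep c s \<noteq> \<zero>\<^bsub>F s\<^esub>} \<in> D"
    using K.ulim_eq[OF rep(1)[OF c(1)] K.fam_zero] ae_not[of "\<lambda>s. rep c s = \<zero>\<^bsub>F s\<^esub>"] by simp
  then show ?thesis
  proof (rule ae_mono)
    fix s assume s: "s \<in> S" and nz: "rep c s \<noteq> \<zero>\<^bsub>F s\<^esub>"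
    interpret F: field "F s" by (rule F[OF s])
    show "component p s \<noteq> []" using nz by (simp add: component_def cq)
  qed
qed

lemma of_P_eq_zero:
  assumes "q \<in> Pi S (\<lambda>s. carrier (P s))" "ulim (\<lambda>s. of_P s (q s)) = \<zero>\<^bsub>U\<^esub>"
  shows "{s \<in> S. q s = []} \<in> D"
proof -
  have fam: "(\<lambda>s. of_P s (q s)) \<in> U.fam" using assms(1) by (auto intro: ring_hom_closed[OF of_P_hom])
  have "{s \<in> S. of_P s (q s) = \<zero>\<^bsub>L s\<^esub>} \<in> D"
    using assms(2) U.ulim_eq[OF fam U.fam_zero] by (simp add: U.ulim_zero)
  then show ?thesis
  proof (rule ae_mono)
    fix s assume s: "s \<in> S" and 0: "of_P s (q s) = \<zero>\<^bsub>L s\<^esub>"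
    interpret j: ring_hom_ring "P s" "L s" "of_P s" by (rule of_P_ring_hom[OF s])
    have "of_P s (q s) = of_P s \<zero>\<^bsub>P s\<^esub>" using 0 by simp
    then show "q s = []" using of_P_inj[OF s] assms(1) s by (auto simp: univ_poly_zero)
  qed
qed

lemma ev_nonzero:
  assumes p: "p \<in> carrier (poly_ring K)" "p \<noteq> []"
  shows "ev p \<noteq> \<zero>\<^bsub>U\<^esub>"
proof
  assume "ev p = \<zero>\<^bsub>U\<^esub>"
  then have "{s \<in> S. component p s = []} \<in> D"
    using component[OF p(1)] by (intro of_P_eq_zero) auto
  then show False using component_nonzero[OF p] ae_not[of "\<lambda>s. component p s = []"] by simp
qed

text \<open>Once the lists have the common length \<open>d\<close>, the entries at each position
  form a family of scalars, and their limits are the coefficients of \<open>p\<close>.\<close>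

lemma bounded_in_ev:
  assumes q: "q \<in> Pi S (\<lambda>s. carrier (P s))" and d: "{s \<in> S. length (q s) \<le> d} \<in> D"
  shows "\<exists>p\<in>carrier (poly_ring K). ulim (\<lambda>s. of_P s (q s)) = ev p"
proof -
  \<comment> \<open>At indices where the bound fails a list of zeros is used, so that the length is
    \<open>d\<close> everywhere; these indices do not affect the limit.\<close>
  define pad where "pad s = (if length (q s) \<le> d then replicate (d - length (q s)) \<zero>\<^bsub>F s\<^esub> @ q s
    else replicate d \<zero>\<^bsub>F s\<^esub>)" for s
  have len: "length (pad s) = d" for s by (simp add: pad_def)
  have qs: "set (q s) \<subseteq> carrier (F s)" if "s \<in> S" for s
    using that q by (auto simp: Pi_iff univ_poly_def polynomial_def)
  have pad: "set (pad s) \<subseteq> carrier (F s)" if s: "s \<in> S" for s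
  proof -
    have "\<zero>\<^bsub>F s\<^esub> \<in> carrier (F s)" using K.fam_zero s by auto
    then show ?thesis using qs[OF s] by (auto simp: pad_def)
  qed
  define fs where "fs = map (\<lambda>i s. pad s ! i) [0..<d]"
  have fs: "set fs \<subseteq> K.fam" using pad len by (auto simp: fs_def subset_iff)
  have mfs: "map (\<lambda>f. f s) fs = pad s" for s
    by (rule nth_equalityI) (auto simp: fs_def len)
  have q_fam: "(\<lambda>s. of_P s (q s)) \<in> U.fam" using q by (auto intro: ring_hom_closed[OF of_P_hom])
  have "{s \<in> S. of_P s (nrm s (map (\<lambda>f. f s) fs)) = of_P s (q s)} \<in> D"
    using d
  proof (rule ae_mono)
    fix s assume s: "s \<in> S" and l: "length (q s) \<le> d"
    interpret F: field "F s" by (rule F[OF s])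
    have "F.normalize (q s) = q s" using q s by (intro F.normalize_polynomial) (auto simp: univ_poly_carrier)
    then show "of_P s (nrm s (map (\<lambda>f. f s) fs)) = of_P s (q s)"
      using l by (simp add: mfs pad_def F.normalize_replicate_zero)
  qed
  then have "ulim (\<lambda>s. of_P s (q s)) = U.eval (map (\<lambda>f. \<kappa> (klim f)) fs) XU"
    unfolding eval_fam(1)[OF fs] using U.ulim_eq[OF eval_fam(2)[OF fs] q_fam] by simp
  also have "\<dots> = U.eval (map \<kappa> (map klim fs)) XU" by (simp add: o_def)
  \<comment> \<open>The limits of the leading entries can be zero in \<open>K\<close>, so the list
    is not yet a polynomial.\<close>
  also have "\<dots> = ev (K.normalize (map klim fs))"
  proof -
    have c: "set (map klim fs) \<subseteq> carrier K" using fs K.ulim_closed by auto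
    have k0: "\<kappa> \<zero>\<^bsub>K\<^esub> = \<zero>\<^bsub>U\<^esub>" by simp
    show ?thesis unfolding ev_def using c
    proof (induction "map klim fs" arbitrary: fs)
      case (Cons a l)
      then obtain f fs' where f: "fs = f # fs'" by (cases fs) auto
      have l: "set (map \<kappa> l) \<subseteq> carrier U" using Cons(2,3) by (auto simp flip: Cons(2))
      have ev: "U.eval (map \<kappa> l) XU \<in> carrier U" by (rule U.eval_in_carrier[OF l XU_closed])
      have "U.eval (map \<kappa> l) XU = U.eval (map \<kappa> (K.normalize l)) XU"
        using Cons(1)[of fs'] Cons(2,3) f by auto
      then show ?case unfolding Cons(2)[symmetric] using ev XU_closed by auto
    qed simp
  qed
  moreover have "set (map klim fs) \<subseteq> carrier K" using fs K.ulim_closed by auto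
  then have "K.normalize (map klim fs) \<in> carrier (poly_ring K)"
    unfolding univ_poly_carrier[symmetric] by (rule K.normalize_gives_polynomial)
  ultimately show ?thesis by blast
qed

sublocale PK: domain "poly_ring K"
  by (rule K.univ_poly_is_domain[OF K.carrier_is_subring])

text \<open>At almost all \<open>s\<close> the root is a fraction whose numerator and denominator
  divide fixed coefficients, so both come from K[t] in the limit. The product form of the conclusion
  avoids inverses in \<open>U\<close>.\<close>

lemma root_is_fraction:
  assumes u: "u \<in> carrier U" and q: "set q \<subseteq> carrier (poly_ring K)" "q \<noteq> []" "hd q \<noteq> []" "last q \<noteq> []"
    and root: "U.eval (map ev q) u = \<zero>\<^bsub>U\<^esub>"
  shows "\<exists>a\<in>carrier (poly_ring K). \<exists>b\<in>carrier (poly_ring K) - {[]}. u \<otimes>\<^bsub>U\<^esub> ev b = ev a"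
proof -
  obtain v where v: "v \<in> U.fam" "u = ulim v" using U.obtain_fam[OF u] .
  let ?gs = "map (\<lambda>p s. of_P s (component p s)) q"
  have gs: "set ?gs \<subseteq> U.fam" using component(4) q(1) by auto
  have m: "map ulim ?gs = map ev q" using component(3) q(1) by auto
  note ue = U.ulim_eval[OF field.is_ring[OF L_field] U.ring_axioms v(1) gs]
  have efam: "(\<lambda>s. ring.eval (L s) (map (\<lambda>g. g s) ?gs) (v s)) \<in> U.fam" using ue by (rule conjunct1)
  have "ulim (\<lambda>s. ring.eval (L s) (map (\<lambda>g. g s) ?gs) (v s)) = \<zero>\<^bsub>U\<^esub>"
    using conjunct2[OF ue] unfolding m v(2)[symmetric] root by (rule sym)
  then have e1: "{s \<in> S. ring.eval (L s) (map (\<lambda>g. g s) ?gs) (v s) = \<zero>\<^bsub>L s\<^esub>} \<in> D"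
    using U.ulim_eq[OF efam U.fam_zero] by (simp add: U.ulim_zero)
  have hl: "hd q \<in> carrier (poly_ring K)" "last q \<in> carrier (poly_ring K)" using q by auto
  \<comment> \<open>A component is no longer than the polynomial over \<open>K\<close> it comes
    from, so \<open>d\<close> bounds numerator and denominator at almost all indices.\<close>
  define d where "d = length (hd q) + length (last q)"
  define Q where "Q s a b \<longleftrightarrow> a \<in> carrier (P s) \<and> b \<in> carrier (P s) \<and> b \<noteq> [] \<and>
    v s \<otimes>\<^bsub>L s\<^esub> of_P s b = of_P s a \<and> length a \<le> d \<and> length b \<le> d" for s a b
  have "{s \<in> S. (ring.eval (L s) (map (\<lambda>g. g s) ?gs) (v s) = \<zero>\<^bsub>L s\<^esub> \<and> component (hd q) s \<noteq> []) \<and> component (last q) s \<noteq> []} \<in> D"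
    by (intro ae_conj e1 component_nonzero hl q)
  then have ae: "{s \<in> S. \<exists>a b. Q s a b} \<in> D"
  proof (rule ae_mono)
    fix s assume s: "s \<in> S"
    assume *: "(ring.eval (L s) (map (\<lambda>g. g s) ?gs) (v s) = \<zero>\<^bsub>L s\<^esub> \<and> component (hd q) s \<noteq> []) \<and> component (last q) s \<noteq> []"
    interpret F: field "F s" by (rule F[OF s])
    interpret P: principal_domain "P s" by (rule P_principal[OF s])
    let ?q = "map (\<lambda>p. component p s) q"
    have "\<exists>a\<in>carrier (P s). \<exists>b\<in>carrier (P s) - {\<zero>\<^bsub>P s\<^esub>}. v s = P.frac a b \<and>
        b divides\<^bsub>P s\<^esub> hd ?q \<and> a divides\<^bsub>P s\<^esub> last ?q"
    proof (rule P.rational_root)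
      show "v s \<in> carrier (frac_field (P s))" using v s by (auto simp: rat_fun_field_def)
      show "set ?q \<subseteq> carrier (P s)" using component(1) s q(1) by auto
      show "ring.eval (frac_field (P s)) (map (\<lambda>a. P.frac a \<one>\<^bsub>P s\<^esub>) ?q) (v s) = \<zero>\<^bsub>frac_field (P s)\<^esub>"
        using * by (simp add: rat_fun_field_def of_P_def component_def o_def)
    qed (use * q in \<open>auto simp: hd_map last_map univ_poly_zero\<close>)
    then obtain a b where ab: "a \<in> carrier (P s)" "b \<in> carrier (P s)" "b \<noteq> []" "v s = P.frac a b"
      "b divides\<^bsub>P s\<^esub> component (hd q) s" "a divides\<^bsub>P s\<^esub> component (last q) s"
      using q by (auto simp: hd_map last_map univ_poly_zero)
    have "v s \<otimes>\<^bsub>L s\<^esub> of_P s b = of_P s a"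
      unfolding ab(4) of_P_def rat_fun_field_def
      using ab by (intro P.frac_eq_div) (auto simp: univ_poly_zero)
    moreover have "length b \<le> length (component (hd q) s)"
      using ab * component(1)[OF hl(1) s] by (intro F.poly_divides_length) auto
    moreover have "length a \<le> length (component (last q) s)"
      using ab * component(1)[OF hl(2) s] by (intro F.poly_divides_length) auto
    ultimately have "Q s a b"
      using ab component(2)[OF hl(1) s] component(2)[OF hl(2) s] by (auto simp: Q_def d_def)
    then show "\<exists>a b. Q s a b" by blast
  qed
  \<comment> \<open>The default is the fraction 0/1, so that the denominators are nonzero at every
    index.\<close>
  define ab where "ab s = (if \<exists>a b. Q s a b then SOME p. Q s (fst p) (snd p) else ([], [\<one>\<^bsub>F s\<^esub>]))" for s
  have Qab: "Q s (fst (ab s)) (snd (ab s))" if ex: "\<exists>a b. Q s a b" for s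
  proof -
    have "\<exists>p. Q s (fst p) (snd p)" using ex by auto
    from someI_ex[OF this] show ?thesis using ex by (simp add: ab_def)
  qed
  have abc: "fst (ab s) \<in> carrier (P s)" "snd (ab s) \<in> carrier (P s)" "snd (ab s) \<noteq> []" if s: "s \<in> S" for s
  proof -
    interpret F: field "F s" by (rule F[OF s])
    show "fst (ab s) \<in> carrier (P s)" "snd (ab s) \<in> carrier (P s)" "snd (ab s) \<noteq> []"
      using Qab[of s] by (cases "\<exists>a b. Q s a b"; auto simp: Q_def ab_def univ_poly_def polynomial_def)+
  qed
  obtain a where a: "a \<in> carrier (poly_ring K)" "ulim (\<lambda>s. of_P s (fst (ab s))) = ev a"
    using bounded_in_ev[of "\<lambda>s. fst (ab s)" d] ae_mono[OF ae, of "\<lambda>s. length (fst (ab s)) \<le> d"] abc Qab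
    by (auto simp: Q_def)
  obtain b where b: "b \<in> carrier (poly_ring K)" "ulim (\<lambda>s. of_P s (snd (ab s))) = ev b"
    using bounded_in_ev[of "\<lambda>s. snd (ab s)" d] ae_mono[OF ae, of "\<lambda>s. length (snd (ab s)) \<le> d"] abc Qab
    by (auto simp: Q_def)
  have fams: "(\<lambda>s. of_P s (fst (ab s))) \<in> U.fam" "(\<lambda>s. of_P s (snd (ab s))) \<in> U.fam"
    using abc by (auto intro: ring_hom_closed[OF of_P_hom])
  have "b \<noteq> []"
  \<comment> \<open>A zero limit would force zero denominators at almost all indices, but there are
    none.\<close>
  proof
    assume "b = []"
    then have "ulim (\<lambda>s. of_P s (snd (ab s))) = \<zero>\<^bsub>U\<^esub>" using b(2) by (simp add: ev_def)
    then have "{s \<in> S. snd (ab s) = []} \<in> D" using abc by (intro of_P_eq_zero) auto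
    moreover have "{s \<in> S. snd (ab s) = []} = {}" using abc by auto
    ultimately show False using bot by simp
  qed
  moreover have "u \<otimes>\<^bsub>U\<^esub> ev b = ev a"
  proof -
    have "u \<otimes>\<^bsub>U\<^esub> ev b = ulim (\<lambda>s. v s \<otimes>\<^bsub>L s\<^esub> of_P s (snd (ab s)))"
      unfolding v(2) b(2)[symmetric] by (rule U.ulim_mult[OF v(1) fams(2)])
    also have "\<dots> = ulim (\<lambda>s. of_P s (fst (ab s)))"
    proof -
      have "{s \<in> S. v s \<otimes>\<^bsub>L s\<^esub> of_P s (snd (ab s)) = of_P s (fst (ab s))} \<in> D"
        using ae by (rule ae_mono) (use Qab in \<open>auto simp: Q_def\<close>)
      then show ?thesis using U.ulim_eq[OF U.fam_mult[OF v(1) fams(2)] fams(1)] by simp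
    qed
    finally show ?thesis by (simp add: a(2))
  qed
  ultimately show ?thesis using a b by blast
qed

text \<open>Clearing denominators and removing zero constant coefficients reduces a polynomial over
  K(t) to the situation of \<open>root_is_fraction\<close>.\<close>

theorem relatively_algebraically_closed:
  obtains \<theta> where "\<theta> \<in> ring_hom (rat_fun_field K) U"
    "\<And>u p. u \<in> carrier U \<Longrightarrow> set p \<subseteq> carrier (rat_fun_field K) \<Longrightarrow> p \<noteq> [] \<Longrightarrow> hd p \<noteq> \<zero>\<^bsub>rat_fun_field K\<^esub> \<Longrightarrow>
      U.eval (map \<theta> p) u = \<zero>\<^bsub>U\<^esub> \<Longrightarrow> u \<in> \<theta> ` carrier (rat_fun_field K)"
proof -
  let ?B = "rat_fun_field K"
  have B: "?B = frac_field (poly_ring K)" by (simp add: rat_fun_field_def)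
  have nz: "ev b \<noteq> \<zero>\<^bsub>U\<^esub>" if "b \<in> carrier (poly_ring K) - {\<zero>\<^bsub>poly_ring K\<^esub>}" for b
    using that ev_nonzero by (auto simp: univ_poly_zero)
  obtain \<theta> where \<theta>: "\<theta> \<in> ring_hom ?B U"
    and \<theta>f: "\<And>a b. a \<in> carrier (poly_ring K) \<Longrightarrow> b \<in> carrier (poly_ring K) - {\<zero>\<^bsub>poly_ring K\<^esub>} \<Longrightarrow>
      \<theta> (PK.frac a b) = ev a \<otimes>\<^bsub>U\<^esub> inv\<^bsub>U\<^esub> ev b"
    using PK.frac_field_extend_hom[OF U_field ev_hom nz] unfolding B by blast
  interpret B: field ?B unfolding B by (rule PK.frac_field_field)
  interpret \<theta>: ring_hom_ring ?B U \<theta> by (intro ring_hom_ringI2 \<theta> B.ring_axioms U.ring_axioms)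
  note evc = ring_hom_closed[OF ev_hom]
  have \<theta>1: "\<theta> (PK.frac a \<one>\<^bsub>poly_ring K\<^esub>) = ev a" if "a \<in> carrier (poly_ring K)" for a
    using \<theta>f[OF that, of "\<one>\<^bsub>poly_ring K\<^esub>"] ring_hom_one[OF ev_hom] evc[OF that] PK.one_not_zero by simp
  \<comment> \<open>The root zero is treated apart, because a factor equal to the variable can only
    be cancelled at a nonzero root.\<close>
  have claim: "u \<in> \<theta> ` carrier ?B"
    if u: "u \<in> carrier U" "u \<noteq> \<zero>\<^bsub>U\<^esub>" and q: "set q \<subseteq> carrier (poly_ring K)" "q \<noteq> []" "hd q \<noteq> []"
      and root: "U.eval (map ev q) u = \<zero>\<^bsub>U\<^esub>" for u q
    using q root
  proof (induction q rule: rev_induct)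
    case Nil
    then show ?case by simp
  next
    case (snoc c q)
    show ?case
    proof (cases "c = []")
      case False
      obtain a b where ab: "a \<in> carrier (poly_ring K)" "b \<in> carrier (poly_ring K) - {[]}" "u \<otimes>\<^bsub>U\<^esub> ev b = ev a"
        using root_is_fraction[OF u(1) snoc.prems(1,2,3) _ snoc.prems(4)] False by auto
      have b: "ev b \<in> carrier U" "ev b \<in> Units U"
        using ab evc ev_nonzero by (auto simp: U.field_Units)
      have "\<theta> (PK.frac a b) = (u \<otimes>\<^bsub>U\<^esub> ev b) \<otimes>\<^bsub>U\<^esub> inv\<^bsub>U\<^esub> ev b"
        using \<theta>f[of a b] ab by (simp add: univ_poly_zero)
      also have "\<dots> = u" using u b by (simp add: U.m_assoc)
      finally show ?thesis
        using ab PK.frac_closed[of a b] unfolding B by (metis imageI univ_poly_zero)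
    next
      \<comment> \<open>The constant coefficient is zero, so the value at \<open>u\<close> is the
        value of the shorter list times \<open>u\<close>.\<close>
      case True
      have qne: "q \<noteq> []" using snoc.prems(3) True by auto
      have sq: "set (map ev q) \<subseteq> carrier U" using snoc.prems(1) evc by auto
      have e0: "ev [] = \<zero>\<^bsub>U\<^esub>" by (simp add: ev_def)
      have eqc: "U.eval (map ev q) u \<in> carrier U" by (rule U.eval_in_carrier[OF sq u(1)])
      have "U.eval (map ev q) u \<otimes>\<^bsub>U\<^esub> u = \<zero>\<^bsub>U\<^esub>"
        using snoc.prems(4) U.eval_append_aux[OF sq U.zero_closed u(1)] eqc u by (simp add: True e0)
      then have "U.eval (map ev q) u = \<zero>\<^bsub>U\<^esub>" using U.integral[OF _ eqc u(1)] u(2) by auto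
      then show ?thesis using snoc qne by auto
    qed
  qed
  show thesis
  proof (rule that[OF \<theta>])
    fix u p assume u: "u \<in> carrier U" and p: "set p \<subseteq> carrier ?B" "p \<noteq> []" "hd p \<noteq> \<zero>\<^bsub>?B\<^esub>"
      and root: "U.eval (map \<theta> p) u = \<zero>\<^bsub>U\<^esub>"
    show "u \<in> \<theta> ` carrier ?B"
    proof (cases "u = \<zero>\<^bsub>U\<^esub>")
      case True
      then show ?thesis using \<theta>.hom_zero B.zero_closed by (metis imageI)
    next
      case False
      \<comment> \<open>Scaling \<open>p\<close> by \<open>d\<close> moves its coefficients into
        K[t] and multiplies the value at \<open>u\<close> by \<open>ev d\<close>.\<close>
      obtain d q where d: "d \<in> carrier (poly_ring K) - {\<zero>\<^bsub>poly_ring K\<^esub>}" and q: "set q \<subseteq> carrier (poly_ring K)"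
        and eq: "map (\<lambda>x. PK.frac d \<one>\<^bsub>poly_ring K\<^esub> \<otimes>\<^bsub>?B\<^esub> x) p = map (\<lambda>c. PK.frac c \<one>\<^bsub>poly_ring K\<^esub>) q"
        using PK.clear_denominators[of p] p(1) unfolding B by blast
      have dB: "PK.frac d \<one>\<^bsub>poly_ring K\<^esub> \<in> carrier ?B"
        unfolding B using d by (intro PK.frac_closed) auto
      have evd: "ev d \<in> carrier U" using d evc by auto
      have mapq: "map ev q = map (\<lambda>x. ev d \<otimes>\<^bsub>U\<^esub> \<theta> x) p"
      proof -
        have "map ev q = map \<theta> (map (\<lambda>c. PK.frac c \<one>\<^bsub>poly_ring K\<^esub>) q)" using q \<theta>1 by auto
        also have "\<dots> = map (\<lambda>x. ev d \<otimes>\<^bsub>U\<^esub> \<theta> x) p"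
          unfolding eq[symmetric] using p(1) dB d \<theta>1 by (auto simp: \<theta>.hom_mult)
        finally show ?thesis .
      qed
      have "U.eval (map (\<lambda>x. ev d \<otimes>\<^bsub>U\<^esub> \<theta> x) p') u = ev d \<otimes>\<^bsub>U\<^esub> U.eval (map \<theta> p') u"
        if "set p' \<subseteq> carrier ?B" for p'
        using that
      proof (induction p')
        case (Cons x p')
        have "U.eval (map \<theta> p') u \<in> carrier U" using Cons.prems u by (intro U.eval_in_carrier) auto
        then show ?case using Cons evd u by (simp add: U.r_distr U.m_assoc)
      qed (use evd in simp)
      then have "U.eval (map ev q) u = \<zero>\<^bsub>U\<^esub>" using p(1) root evd by (simp add: mapq)
      moreover have "q \<noteq> []" using eq p(2) by auto
      moreover have "hd q \<noteq> []"
      proof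
        assume 0: "hd q = []"
        have "PK.frac d \<one>\<^bsub>poly_ring K\<^esub> \<otimes>\<^bsub>?B\<^esub> hd p = PK.frac (hd q) \<one>\<^bsub>poly_ring K\<^esub>"
          using arg_cong[OF eq, of hd] p(2) \<open>q \<noteq> []\<close> by (simp add: hd_map)
        also have "\<dots> = \<zero>\<^bsub>?B\<^esub>" unfolding 0 B PK.frac_zero by (simp add: univ_poly_zero)
        finally have "PK.frac d \<one>\<^bsub>poly_ring K\<^esub> = \<zero>\<^bsub>?B\<^esub>"
        proof -
          assume 0: "PK.frac d \<one>\<^bsub>poly_ring K\<^esub> \<otimes>\<^bsub>?B\<^esub> hd p = \<zero>\<^bsub>?B\<^esub>"
          have "hd p \<in> carrier ?B" using p(1,2) hd_in_set by blast
          from B.integral[OF 0 dB this] show ?thesis using p(3) by blast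
        qed
        then have "PK.frac d \<one>\<^bsub>poly_ring K\<^esub> = PK.frac \<zero>\<^bsub>poly_ring K\<^esub> \<one>\<^bsub>poly_ring K\<^esub>"
          unfolding B PK.frac_zero .
        then show False using d PK.frac_embed_inj by (auto dest: inj_onD)
      qed
      ultimately show ?thesis using claim[OF u False q] by blast
    qed
  qed
qed

end

section \<open>Galois groups over rational function fields\<close>

text \<open>Transports the action of the Galois group to \<open>G\<close> along the isomorphism, so
  that what follows concerns an abstract finite group.\<close>

lemma galois_ext_field_action:
  assumes G: "group G" "finite (carrier G)" and ext: "galois_ext B H i" and iso: "G \<cong> Gal B H i"
  obtains \<rho> where "field_action H G \<rho>" "ring_action.Fixed H G \<rho> = i ` carrier B"
proof -
  interpret G: group G by fact
  have H: "field H" and fixed: "{x \<in> carrier H. \<forall>\<sigma>\<in>carrier (Gal B H i). \<sigma> x = x} = i ` carrier B"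
    using ext by (auto simp: galois_ext_def)
  interpret H: field H by (rule H)
  obtain f where f: "f \<in> iso G (Gal B H i)" using iso by (auto simp: is_iso_def)
  have f_img: "f ` carrier G = carrier (Gal B H i)" and f_inj: "inj_on f (carrier G)"
    using f by (auto simp: iso_def bij_betw_def)
  have fg: "f g \<in> Bij (carrier H)" "f g \<in> ring_hom H H" if "g \<in> carrier G" for g
    using f_img that by (auto simp: Gal_def)
  have f_mult: "f (g \<otimes>\<^bsub>G\<^esub> h) = compose (carrier H) (f g) (f h)" if "g \<in> carrier G" "h \<in> carrier G" for g h
  proof -
    have "f (g \<otimes>\<^bsub>G\<^esub> h) = f g \<otimes>\<^bsub>Gal B H i\<^esub> f h" using f that by (auto simp: iso_def hom_def)
    then show ?thesis using fg that by (simp add: Gal_def BijGroup_def)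
  qed
  \<comment> \<open>Multiplicativity makes the image of the identity an idempotent bijection, hence
    the identity map on the carrier.\<close>
  have f_one: "f \<one>\<^bsub>G\<^esub> x = x" if x: "x \<in> carrier H" for x
  proof -
    have b: "bij_betw (f \<one>\<^bsub>G\<^esub>) (carrier H) (carrier H)" using fg(1)[OF G.one_closed] by (simp add: Bij_def)
    have "f \<one>\<^bsub>G\<^esub> (f \<one>\<^bsub>G\<^esub> x) = f \<one>\<^bsub>G\<^esub> x"
      using f_mult[of "\<one>\<^bsub>G\<^esub>" "\<one>\<^bsub>G\<^esub>"] x by (simp add: compose_def) (metis (full_types) restrict_apply')
    then show ?thesis
      using b x ring_hom_closed[OF fg(2)[OF G.one_closed] x] by (auto simp: bij_betw_def dest: inj_onD)
  qed
  have act: "field_action H G f"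
  proof (intro field_action.intro ring_action.intro ring_action_axioms.intro field_action_axioms.intro G H H.is_cring fg(2) f_one)
    show "f (g \<otimes>\<^bsub>G\<^esub> h) x = f g (f h x)" if "g \<in> carrier G" "h \<in> carrier G" "x \<in> carrier H" for g h x
      using f_mult[OF that(1,2)] that(3) by (simp add: compose_def)
    show "\<exists>x\<in>carrier H. f g x \<noteq> x" if g: "g \<in> carrier G" "g \<noteq> \<one>\<^bsub>G\<^esub>" for g
    proof (rule ccontr)
      assume "\<not> ?thesis"
      then have "\<And>x. x \<in> carrier H \<Longrightarrow> f g x = f \<one>\<^bsub>G\<^esub> x" using f_one by auto
      then have "f g = f \<one>\<^bsub>G\<^esub>"
        using Bij_imp_extensional[OF fg(1)[OF g(1)]] Bij_imp_extensional[OF fg(1)[OF G.one_closed]]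
        by (intro extensionalityI)
      then show False using f_inj g by (auto dest: inj_onD)
    qed
  qed
  interpret field_action H G f by (rule act)
  have "Fixed = i ` carrier B" unfolding fixed[symmetric] f_img[symmetric] Fixed_def by auto
  then show thesis using that act by blast
qed

context ratfun_limit
begin

theorem galois_group_transfer:
  fixes G :: "('g, 'm) monoid_scheme" and H :: "('h, 'c) ring_scheme"
  assumes G: "group G" "finite (carrier G)"
    and ext: "galois_ext (rat_fun_field K) H i" and iso: "G \<cong> Gal (rat_fun_field K) H i"
  shows "{s \<in> S. galois_group_over (L s) G} \<in> D" "galois_group_over U G"
proof -
  let ?B = "rat_fun_field K"
  obtain \<rho> where act: "field_action H G \<rho>" and Fixed: "ring_action.Fixed H G \<rho> = i ` carrier ?B"
    using galois_ext_field_action[OF G ext iso] .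
  interpret H: field_action H G \<rho> by (rule act)
  have B: "field ?B" and i: "i \<in> ring_hom ?B H" using ext by (auto simp: galois_ext_def)
  interpret B: field ?B by (rule B)
  obtain \<theta> where \<theta>: "\<theta> \<in> ring_hom ?B U"
    and rc: "\<And>u p. u \<in> carrier U \<Longrightarrow> set p \<subseteq> carrier ?B \<Longrightarrow> p \<noteq> [] \<Longrightarrow> hd p \<noteq> \<zero>\<^bsub>?B\<^esub> \<Longrightarrow>
      U.eval (map \<theta> p) u = \<zero>\<^bsub>U\<^esub> \<Longrightarrow> u \<in> \<theta> ` carrier ?B"
  proof (rule relatively_algebraically_closed)
    fix \<theta>
    assume 1: "\<theta> \<in> ring_hom ?B U"
      and 2: "\<And>u p. u \<in> carrier U \<Longrightarrow> set p \<subseteq> carrier ?B \<Longrightarrow> p \<noteq> [] \<Longrightarrow> hd p \<noteq> \<zero>\<^bsub>?B\<^esub> \<Longrightarrow>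
        U.eval (map \<theta> p) u = \<zero>\<^bsub>U\<^esub> \<Longrightarrow> u \<in> \<theta> ` carrier ?B"
    show thesis by (rule that[OF 1]) (rule 2; assumption)
  qed
  \<comment> \<open>The base change expects a map out of the fixed field of \<open>H\<close>, so the
    embedding of the base in \<open>H\<close> has to be inverted.\<close>
  define i' where "i' = inv_into (carrier ?B) i"
  have inj: "inj_on i (carrier ?B)" by (rule non_trivial_field_hom_is_inj[OF i B H.field_axioms])
  have i'_i: "i' (i x) = x" if "x \<in> carrier ?B" for x using inj that by (simp add: i'_def)
  have F: "x \<in> H.Fixed \<longleftrightarrow> (\<exists>y\<in>carrier ?B. x = i y)" for x using Fixed by auto
  have i'c: "i' x \<in> carrier ?B" "i (i' x) = x" if "x \<in> H.Fixed" for x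
    using that F[of x] i'_i by auto
  have i0: "i \<zero>\<^bsub>?B\<^esub> = \<zero>\<^bsub>H\<^esub>" by (rule ring_hom_zero[OF i B.ring_axioms H.ring_axioms])
  obtain n :: nat and e \<pi> where basis: "e \<in> {..<n} \<rightarrow> carrier H"
    "\<And>k x. k < n \<Longrightarrow> x \<in> carrier H \<Longrightarrow> \<pi> k x \<in> H.Fixed"
    "\<And>x. x \<in> carrier H \<Longrightarrow> (\<Oplus>\<^bsub>H\<^esub>k\<in>{..<n}. \<pi> k x \<otimes>\<^bsub>H\<^esub> e k) = x"
    "\<And>c k. c \<in> {..<n} \<rightarrow> H.Fixed \<Longrightarrow> k < n \<Longrightarrow> \<pi> k (\<Oplus>\<^bsub>H\<^esub>k\<in>{..<n}. c k \<otimes>\<^bsub>H\<^esub> e k) = c k"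
    by (rule H.exists_basis) (rule that; assumption)
  interpret bc: base_change H G \<rho> U "\<lambda>x. \<theta> (i' x)" n e \<pi>
  proof (intro base_change.intro base_change_axioms.intro act U_field basis)
    show "(\<lambda>x. \<theta> (i' x)) \<in> ring_hom (H\<lparr>carrier := H.Fixed\<rparr>) U"
    proof (rule ring_hom_memI)
      fix x y assume "x \<in> carrier (H\<lparr>carrier := H.Fixed\<rparr>)" "y \<in> carrier (H\<lparr>carrier := H.Fixed\<rparr>)"
      then obtain a b where ab: "a \<in> carrier ?B" "x = i a" "b \<in> carrier ?B" "y = i b" using F by auto
      show "\<theta> (i' x) \<in> carrier U" using ab ring_hom_closed[OF \<theta>] by (simp add: i'_i)
      have "i' (i a \<otimes>\<^bsub>H\<^esub> i b) = a \<otimes>\<^bsub>?B\<^esub> b" "i' (i a \<oplus>\<^bsub>H\<^esub> i b) = a \<oplus>\<^bsub>?B\<^esub> b"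
        using ab i'_i[of "a \<otimes>\<^bsub>?B\<^esub> b"] i'_i[of "a \<oplus>\<^bsub>?B\<^esub> b"]
        by (simp_all add: ring_hom_mult[OF i] ring_hom_add[OF i])
      then show "\<theta> (i' (x \<otimes>\<^bsub>H\<lparr>carrier := H.Fixed\<rparr>\<^esub> y)) = \<theta> (i' x) \<otimes>\<^bsub>U\<^esub> \<theta> (i' y)"
        "\<theta> (i' (x \<oplus>\<^bsub>H\<lparr>carrier := H.Fixed\<rparr>\<^esub> y)) = \<theta> (i' x) \<oplus>\<^bsub>U\<^esub> \<theta> (i' y)"
        using ab by (simp_all add: i'_i ring_hom_mult[OF \<theta>] ring_hom_add[OF \<theta>])
    next
      show "\<theta> (i' \<one>\<^bsub>H\<lparr>carrier := H.Fixed\<rparr>\<^esub>) = \<one>\<^bsub>U\<^esub>"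
        using i'_i[OF B.one_closed] by (simp add: ring_hom_one[OF i] ring_hom_one[OF \<theta>])
    qed
  next
    fix u p assume u: "u \<in> carrier U" and p: "set p \<subseteq> H.Fixed" "p \<noteq> []" "hd p \<noteq> \<zero>\<^bsub>H\<^esub>"
      and root: "U.eval (map (\<lambda>x. \<theta> (i' x)) p) u = \<zero>\<^bsub>U\<^esub>"
    have "hd (map i' p) \<noteq> \<zero>\<^bsub>?B\<^esub>"
    proof
      assume "hd (map i' p) = \<zero>\<^bsub>?B\<^esub>"
      then have "i' (hd p) = \<zero>\<^bsub>?B\<^esub>" using p(2) by (simp add: hd_map)
      moreover have "hd p \<in> H.Fixed" using p(1,2) hd_in_set by blast
      ultimately show False using i'c(2)[of "hd p"] i0 p(3) by simp
    qed
    moreover have "set (map i' p) \<subseteq> carrier ?B" using p(1) i'c(1) by auto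
    moreover have "U.eval (map \<theta> (map i' p)) u = \<zero>\<^bsub>U\<^esub>" using root by (simp add: o_def)
    ultimately obtain x where "x \<in> carrier ?B" "u = \<theta> x"
      using rc[OF u, of "map i' p"] p(2) by auto
    then show "u \<in> (\<lambda>x. \<theta> (i' x)) ` H.Fixed" using F[of "i x"] i'_i[of x] by (intro image_eqI[of _ _ "i x"]) auto
  qed (use basis in auto)
  interpret TA: field_action bc.T G "\<lambda>g. bc.act g" by (rule bc.T_field_action)
  show "galois_group_over U G"
    unfolding galois_group_over_def
    using TA.galois_ext_Gal[OF U_field bc.scal_hom bc.T_Fixed] by blast
  have gs: "galois_sentence U bc.T G bc.act bc.scal"
    by (rule galois_sentenceI[OF bc.T_field_action bc.scal_hom bc.T_Fixed])
  have c1: "bc.str_const k j l \<in> carrier U" if "k < n" "j < n" "l < n" for k j l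
    using that by (simp add: bc.str_const_def bc.\<theta>_closed bc.\<pi> bc.e)
  have c2: "bc.unit_const k \<in> carrier U" if "k < n" for k
    using that by (simp add: bc.unit_const_def bc.\<theta>_closed bc.\<pi>)
  have c3: "bc.act_const g k j \<in> carrier U" if "g \<in> carrier G" "k < n" "j < n" for g k j
    using that by (simp add: bc.act_const_def bc.\<theta>_closed bc.\<pi> bc.e H.act_closed)
  \<comment> \<open>Each structure constant in \<open>U\<close> is represented by a family; the
    entries at \<open>s\<close> define the algebra over the factor at \<open>s\<close>.\<close>
  define r where "r c = (SOME x. x \<in> U.fam \<and> c = ulim x)" for c
  have r: "r c \<in> U.fam \<and> c = ulim (r c)" if "c \<in> carrier U" for c
  proof -
    have "\<exists>x. x \<in> U.fam \<and> c = ulim x" using U.obtain_fam[OF that] by metis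
    then show ?thesis unfolding r_def by (rule someI_ex)
  qed
  interpret sl: sc_limit S D L U ulim n bc.str_const bc.unit_const "\<lambda>s k j l. r (bc.str_const k j l) s"
    "\<lambda>s k. r (bc.unit_const k) s" G bc.act_const "\<lambda>s g k j. r (bc.act_const g k j) s"
    by (intro sc_limit.intro sc_limit_axioms.intro U.ultralimit_axioms L_field G)
      (use r[OF c1] r[OF c2] r[OF c3] in auto)
  show "{s \<in> S. galois_group_over (L s) G} \<in> D"
    by (rule sl.ae_galois_group_over[OF bc.T_field gs])
qed

end

text \<open>The given extension may live in any type, while the extensions found consist of
  coordinate lists, in the type fixed by \<open>galois_group_over\<close>.\<close>

theorem mainTheorem11:
  fixes S :: "'s set" and D :: "'s set set"
    and F :: "'s \<Rightarrow> ('a, 'b) ring_scheme"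
    and G :: "('g, 'm) monoid_scheme"
    and H :: "('h, 'c) ring_scheme" and i :: "(('s \<Rightarrow> 'a) set list \<times> ('s \<Rightarrow> 'a) set list) set \<Rightarrow> 'h"
  assumes "infinite S"
    and "nonprincipal_ultrafilter S D"
    and "\<forall>s\<in>S. field (F s)"
    and "group G" and "finite (carrier G)"
    and "galois_ext (rat_fun_field (ultraprod S D F)) H i"
    and "G \<cong> Gal (rat_fun_field (ultraprod S D F)) H i"
  shows "{s \<in> S. galois_group_over (rat_fun_field (F s)) G} \<in> D
       \<and> galois_group_over (ultraprod S D (\<lambda>s. rat_fun_field (F s))) G
       \<and> ((\<forall>G' :: 'g monoid. group G' \<and> finite (carrier G')
              \<longrightarrow> galois_group_over (rat_fun_field (ultraprod S D F)) G')
          \<longrightarrow> (\<forall>G' :: 'g monoid. group G' \<and> finite (carrier G')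
              \<longrightarrow> galois_group_over (ultraprod S D (\<lambda>s. rat_fun_field (F s))) G'))"
proof -
  interpret ratfun_limit S D F
    using assms(2,3)
    by (intro ratfun_limit.intro ultrafilter_on.intro ratfun_limit_axioms.intro) simp_all
  \<comment> \<open>For the last claim the transfer is applied to each group separately, with the
    extension its own hypothesis provides.\<close>
  have "galois_group_over U G'"
    if "group G'" "finite (carrier G')" "galois_group_over (rat_fun_field K) G'" for G' :: "'g monoid"
    using that galois_group_transfer(2)[OF that(1,2)] unfolding galois_group_over_def[of "rat_fun_field K"] by blast
  then show ?thesis
    using galois_group_transfer[OF assms(4-7)] by blast
qed

end
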